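(* Let $A \in \mathcal{B}(H^2(\mathbb{T}))$. Then $A$ is a sum of a Toeplitz operator and a non-injective Hankel operator if and only if $T_z^* A T_z - A$ is a non-injective Hankel operator. Additionally, if \[ T_z^* A T_z - A = H_{\psi_1} \] for some $\psi_1 \in L^\infty(\mathbb{T})$ with $H_{\psi_1}$ non-injective, then there exist an inner function $\theta \in H^\infty(\mathbb{D})$ and a symbol $\varphi_2 \in L^\infty(\mathbb{T})$ such that \[ \ker H_{\psi_1} = \theta H^2(\mathbb{T}) \quad\text{and}\quad A T_\theta = T_{\varphi_2}, \] and $A = T_\varphi + H_\psi$ for some symbol $\psi \in L^\infty(\mathbb{T})$, where $\varphi = \overline{\theta}\,\varphi_2$.
   Context: $\mathbb{T}$ is the unit circle and $\mathbb{D}$ the open unit disc in $\mathbb{C}$; $\mathcal{B}(\mathcal{H})$ denotes the bounded linear operators on a Hilbert space $\mathcal{H}$. $L^2(\mathbb{T})$ and $L^\infty(\mathbb{T})$ are the usual scalar spaces with respect to normalized arc length measure, and $H^2(\mathbb{T})$ is the closed subspace of $L^2(\mathbb{T})$ of functions whose Fourier coefficients of negative index all vanish; $P_{H^2(\mathbb{T})}$ is the orthogonal projection of $L^2(\mathbb{T})$ onto it. For $\varphi\in L^\infty(\mathbb{T})$, $M_\varphi$ is multiplication by $\varphi$ on $L^2(\mathbb{T})$; the Toeplitz operator with symbol $\varphi$ is $T_\varphi = P_{H^2(\mathbb{T})}M_\varphi|_{H^2(\mathbb{T})}$; the Hankel operator with symbol $\varphi$ is $H_\varphi = P_{H^2(\mathbb{T})}M_\varphi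 J|_{H^2(\mathbb{T})}$, where $(Jf)(z) = f(\bar z)$ for $f \in L^2(\mathbb{T})$, $z\in\mathbb{T}$. An operator on $H^2(\mathbb{T})$ is called a Toeplitz (respectively Hankel) operator if it equals $T_\varphi$ (respectively $H_\varphi$) for some $\varphi\in L^\infty(\mathbb{T})$. $T_z$ is the Toeplitz operator with symbol $z$. A Hankel operator is non-injective if its kernel is not $\{0\}$. $H^\infty(\mathbb{D})$ is the algebra of bounded analytic functions on $\mathbb{D}$, identified via radial limits with a subspace of $L^\infty(\mathbb{T})$. A function $\theta\in H^\infty(\mathbb{D})$ is inner if its radial limit function satisfies $|\theta(z)|=1$ for almost all $z\in\mathbb{T}$. *)

theory Defs
  imports "HOL-Analysis.Analysis"
begin

section \<open>The unit circle\<close>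

text \<open>Normalized arc length on the unit circle, as a Borel probability measure on the complex plane
  that is carried by the circle. The values of a function off the circle are irrelevant.\<close>

definition circle :: "complex measure" where
  "circle = distr (uniform_measure lborel {0..2 * pi}) borel cis"

lemma sets_circle [simp, measurable_cong]: "sets circle = sets borel"
  by (simp add: circle_def)

lemma space_circle [simp]: "space circle = UNIV"
  by (simp add: circle_def)

lemma cis_measurable [measurable]: "cis \<in> borel_measurable borel"
  by (intro borel_measurable_continuous_onI continuous_intros)

lemma cnj_measurable [measurable]: "cnj \<in> borel_measurable borel"
  by (intro borel_measurable_continuous_onI continuous_intros)

lemma emeasure_circle_UNIV: "emeasure circle UNIV = 1"
proof -
  have "emeasure lborel {0..2 * pi} \<noteq> 0" by simp
  then show ?thesis
    unfolding circle_def by (subst emeasure_distr) (auto simp: emeasure_uniform_measure ennreal_divide_self)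
qed

lemma finite_measure_circle: "finite_measure circle"
  by (rule finite_measureI) (simp add: emeasure_circle_UNIV)

lemma AE_circle_norm: "AE z in circle. cmod z = 1"
  unfolding circle_def by (subst AE_distr_iff) auto

lemma distr_cnj_circle: "distr circle borel cnj = circle"
proof -
  let ?g = "\<lambda>x::real. indicator {0..2 * pi} x / emeasure lborel {0..2 * pi} :: ennreal"
  have refl: "distr lborel borel (\<lambda>x. 2 * pi - x :: real) = lborel"
    using lborel_real_affine[of "-1" "2 * pi"] by (simp add: density_1)
  have cis: "cnj (cis x) = cis (2 * pi - x)" for x
    by (simp add: complex_eq_iff)
  have "distr circle borel cnj = distr (density lborel ?g) borel (\<lambda>x. cis (2 * pi - x))"
    unfolding circle_def uniform_measure_def by (subst distr_distr) (simp_all add: o_def cis)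
  also have "\<dots> = distr (distr (density lborel ?g) borel (\<lambda>x. 2 * pi - x)) borel cis"
    by (subst distr_distr) (simp_all add: o_def)
  also have "distr (density lborel ?g) borel (\<lambda>x. 2 * pi - x) =
      distr (density lborel (\<lambda>x. ?g (2 * pi - x))) borel (\<lambda>x. 2 * pi - x)"
    by (intro arg_cong2[where f="\<lambda>a b. distr a borel b"] density_cong refl) (auto simp: indicator_def)
  also have "\<dots> = density (distr lborel borel (\<lambda>x. 2 * pi - x)) ?g"
    by (subst density_distr) simp_all
  also have "\<dots> = density lborel ?g" by (simp add: refl)
  finally show ?thesis by (simp add: circle_def uniform_measure_def)
qed


section \<open>The Hilbert space \<open>L\<^sup>2\<close> of the circle\<close>

definition sq_integrable :: "(complex \<Rightarrow> complex) set" where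
  "sq_integrable =
     {f \<in> borel_measurable circle. integrable circle (\<lambda>z. (cmod (f z))\<^sup>2)}"

definition l2_rel :: "(complex \<Rightarrow> complex) \<Rightarrow> (complex \<Rightarrow> complex) \<Rightarrow> bool" where
  "l2_rel f g \<longleftrightarrow> f \<in> sq_integrable \<and> g \<in> sq_integrable \<and> (AE z in circle. f z = g z)"

lemma sq_integrable_zero: "(\<lambda>_. 0) \<in> sq_integrable"
  by (simp add: sq_integrable_def)

lemma sq_integrable_scale: "f \<in> sq_integrable \<Longrightarrow> (\<lambda>z. c * f z) \<in> sq_integrable"
  by (auto simp: sq_integrable_def norm_mult power_mult_distrib)

lemma sq_integrable_mult:
  assumes "f \<in> sq_integrable" "g \<in> sq_integrable"
  shows "integrable circle (\<lambda>z. f z * g z)"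
proof (rule Bochner_Integration.integrable_bound)
  show "integrable circle (\<lambda>z. (cmod (f z))\<^sup>2 + (cmod (g z))\<^sup>2)"
    using assms by (auto simp: sq_integrable_def)
  have "cmod (f z * g z) \<le> norm ((cmod (f z))\<^sup>2 + (cmod (g z))\<^sup>2)" for z
    using sum_squares_bound[of "cmod (f z)" "cmod (g z)"]
      mult_nonneg_nonneg[OF norm_ge_zero[of "f z"] norm_ge_zero[of "g z"]]
    unfolding norm_mult real_norm_def by linarith
  then show "AE z in circle. cmod (f z * g z) \<le> norm ((cmod (f z))\<^sup>2 + (cmod (g z))\<^sup>2)"
    by simp
qed (use assms in \<open>auto simp: sq_integrable_def\<close>)

lemma sq_integrable_cnj: "f \<in> sq_integrable \<Longrightarrow> (\<lambda>z. cnj (f z)) \<in> sq_integrable"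
  by (auto simp: sq_integrable_def intro: measurable_compose)

lemma sq_integrable_add:
  assumes "f \<in> sq_integrable" "g \<in> sq_integrable"
  shows "(\<lambda>z. f z + g z) \<in> sq_integrable"
proof -
  have "integrable circle (\<lambda>z. (cmod (f z + g z))\<^sup>2)"
  proof (rule Bochner_Integration.integrable_bound)
    show "integrable circle (\<lambda>z. 2 * (cmod (f z))\<^sup>2 + 2 * (cmod (g z))\<^sup>2)"
      using assms by (auto simp: sq_integrable_def)
    have "(cmod (f z + g z))\<^sup>2 \<le> 2 * (cmod (f z))\<^sup>2 + 2 * (cmod (g z))\<^sup>2" for z
    proof -
      have "(cmod (f z + g z))\<^sup>2 \<le> (cmod (f z) + cmod (g z))\<^sup>2"
        by (intro power_mono norm_triangle_ineq) simp
      also have "\<dots> \<le> 2 * (cmod (f z))\<^sup>2 + 2 * (cmod (g z))\<^sup>2"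
        using sum_squares_bound[of "cmod (f z)" "cmod (g z)"] by (simp add: power2_sum)
      finally show ?thesis .
    qed
    then show "AE z in circle. norm ((cmod (f z + g z))\<^sup>2) \<le>
        norm (2 * (cmod (f z))\<^sup>2 + 2 * (cmod (g z))\<^sup>2)"
      by simp
  qed (use assms in \<open>auto simp: sq_integrable_def\<close>)
  then show ?thesis using assms by (auto simp: sq_integrable_def)
qed

lemma sq_integrable_integrable:
  assumes "f \<in> sq_integrable"
  shows "integrable circle f"
proof -
  have "(\<lambda>_. 1) \<in> sq_integrable"
    using finite_measure.integrable_const[OF finite_measure_circle, of "1 :: real"]
    by (simp add: sq_integrable_def)
  from sq_integrable_mult[OF assms this] show ?thesis by simp
qed

lemma l2_rel_borel:
  assumes "l2_rel f g"
  shows "f \<in> borel_measurable borel" "g \<in> borel_measurable borel"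
  using assms by (auto simp: l2_rel_def sq_integrable_def)

quotient_type l2 = "complex \<Rightarrow> complex" / partial: l2_rel
proof (rule part_equivpI)
  show "\<exists>f. l2_rel f f"
    using sq_integrable_zero by (auto simp: l2_rel_def)
  show "symp l2_rel"
    by (rule sympI) (auto simp: l2_rel_def)
  show "transp l2_rel"
    by (rule transpI) (auto simp: l2_rel_def)
qed

text \<open>The complex inner product and scalar multiplication; they are kept apart from the
  \<^class>\<open>real_inner\<close> structure, whose inner product is the real part of the complex one.\<close>

lift_definition l2_cinner :: "l2 \<Rightarrow> l2 \<Rightarrow> complex" is
  "\<lambda>f g. LINT z|circle. f z * cnj (g z)"
proof -
  fix f f' g g' assume "l2_rel f f'" "l2_rel g g'"
  note [measurable] = l2_rel_borel[OF this(1)] l2_rel_borel[OF this(2)]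
  show "(LINT z|circle. f z * cnj (g z)) = (LINT z|circle. f' z * cnj (g' z))"
    using \<open>l2_rel f f'\<close> \<open>l2_rel g g'\<close>
    by (intro integral_cong_AE) (auto simp: l2_rel_def)
qed

lift_definition l2_scaleC :: "complex \<Rightarrow> l2 \<Rightarrow> l2" is "\<lambda>c f z. c * f z"
  by (auto simp: l2_rel_def sq_integrable_scale)

instantiation l2 :: real_inner
begin

lift_definition zero_l2 :: l2 is "\<lambda>_. 0"
  by (simp add: l2_rel_def sq_integrable_zero)

lift_definition plus_l2 :: "l2 \<Rightarrow> l2 \<Rightarrow> l2" is "\<lambda>f g z. f z + g z"
  by (auto simp: l2_rel_def sq_integrable_add)

definition uminus_l2 :: "l2 \<Rightarrow> l2" where "- f = l2_scaleC (- 1) f"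
definition minus_l2 :: "l2 \<Rightarrow> l2 \<Rightarrow> l2" where "f - g = f + (- g :: l2)"
definition scaleR_l2 :: "real \<Rightarrow> l2 \<Rightarrow> l2" where "r *\<^sub>R f = l2_scaleC (complex_of_real r) f"
definition inner_l2 :: "l2 \<Rightarrow> l2 \<Rightarrow> real" where "f \<bullet> g = Re (l2_cinner f g)"
definition norm_l2 :: "l2 \<Rightarrow> real" where "norm f = sqrt (f \<bullet> (f :: l2))"
definition sgn_l2 :: "l2 \<Rightarrow> l2" where "sgn f = inverse (norm f) *\<^sub>R (f :: l2)"
definition dist_l2 :: "l2 \<Rightarrow> l2 \<Rightarrow> real" where "dist f g = norm (f - g :: l2)"
definition uniformity_l2 :: "(l2 \<times> l2) filter" where
  "uniformity = (INF e\<in>{0<..}. principal {(f :: l2, g). dist f g < e})"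
definition open_l2 :: "l2 set \<Rightarrow> bool" where
  "open U \<longleftrightarrow> (\<forall>f\<in>U. \<forall>\<^sub>F (f', g) in uniformity. f' = (f :: l2) \<longrightarrow> g \<in> U)"

lemma l2_scaleC_simps:
  "l2_scaleC c (f + g) = l2_scaleC c f + l2_scaleC c g"
  "l2_scaleC (c + d) f = l2_scaleC c f + l2_scaleC d f"
  "l2_scaleC c (l2_scaleC d f) = l2_scaleC (c * d) f"
  "l2_scaleC 1 f = f"
  by (transfer, auto simp: l2_rel_def sq_integrable_add sq_integrable_scale algebra_simps)+

lemma l2_cinner_commute: "l2_cinner g f = cnj (l2_cinner f g)"
  by transfer (subst Bochner_Integration.integral_cnj[symmetric], simp add: mult.commute)

lemma l2_cinner_add_left: "l2_cinner (f + g) h = l2_cinner f h + l2_cinner g h"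
  by transfer (auto simp: l2_rel_def algebra_simps
      intro!: Bochner_Integration.integral_add sq_integrable_mult sq_integrable_cnj)

lemma l2_cinner_scaleC_left: "l2_cinner (l2_scaleC c f) g = c * l2_cinner f g"
  by transfer (simp add: mult.assoc)

lemma Re_l2_cinner_self:
  assumes "f \<in> sq_integrable"
  shows "Re (LINT z|circle. f z * cnj (f z)) = (LINT z|circle. (cmod (f z))\<^sup>2)"
  by (simp only: complex_norm_square[symmetric] integral_complex_of_real Re_complex_of_real)

instance
proof
  fix f g h :: l2 and r s :: real
  show "f + g + h = f + (g + h)"
    by transfer (auto simp: l2_rel_def sq_integrable_add add.assoc)
  show "f + g = g + f"
    by transfer (auto simp: l2_rel_def sq_integrable_add add.commute)
  show "0 + f = f"
    by transfer (auto simp: l2_rel_def)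
  show "- f + f = 0"
    unfolding uminus_l2_def
    by transfer (auto simp: l2_rel_def sq_integrable_zero)
  show "f - g = f + - g" by (fact minus_l2_def)
  show "r *\<^sub>R (f + g) = r *\<^sub>R f + r *\<^sub>R g" "(r + s) *\<^sub>R f = r *\<^sub>R f + s *\<^sub>R f"
    "r *\<^sub>R s *\<^sub>R f = (r * s) *\<^sub>R f" "1 *\<^sub>R f = f"
    by (simp_all add: scaleR_l2_def l2_scaleC_simps)
  show "f \<bullet> g = g \<bullet> f"
    unfolding inner_l2_def by (subst l2_cinner_commute) simp
  show "(f + g) \<bullet> h = f \<bullet> h + g \<bullet> h" "(r *\<^sub>R f) \<bullet> g = r * (f \<bullet> g)"
    by (simp_all add: inner_l2_def scaleR_l2_def l2_cinner_add_left l2_cinner_scaleC_left)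
  show "0 \<le> f \<bullet> f"
    unfolding inner_l2_def by transfer (auto simp: l2_rel_def Re_l2_cinner_self)
  show "f \<bullet> f = 0 \<longleftrightarrow> f = 0"
    unfolding inner_l2_def
  proof transfer
    fix f assume "l2_rel f f"
    then have f: "f \<in> sq_integrable" by (simp add: l2_rel_def)
    have "(LINT z|circle. (cmod (f z))\<^sup>2) = 0 \<longleftrightarrow> (AE z in circle. (cmod (f z))\<^sup>2 = 0)"
      using f by (intro integral_nonneg_eq_0_iff_AE) (auto simp: sq_integrable_def)
    then show "Re (LINT z|circle. f z * cnj (f z)) = 0 \<longleftrightarrow> l2_rel f (\<lambda>_. 0)"
      using f by (simp add: Re_l2_cinner_self l2_rel_def sq_integrable_zero)
  qed
  show "norm f = sqrt (f \<bullet> f)" by (fact norm_l2_def)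
  show "sgn f = inverse (norm f) *\<^sub>R f" by (fact sgn_l2_def)
  show "dist f g = norm (f - g)" by (fact dist_l2_def)
  show "uniformity = (INF e\<in>{0<..}. principal {(f :: l2, g). dist f g < e})"
    by (fact uniformity_l2_def)
  show "open U \<longleftrightarrow> (\<forall>f\<in>U. \<forall>\<^sub>F (f', g) in uniformity. f' = f \<longrightarrow> g \<in> U)" for U :: "l2 set"
    by (fact open_l2_def)
qed

end

lemma l2_scaleC_0 [simp]: "l2_scaleC c 0 = 0"
  using l2_scaleC_simps(1)[of c 0 0] by simp


section \<open>The Hardy space\<close>

lift_definition fourier :: "l2 \<Rightarrow> int \<Rightarrow> complex" is
  "\<lambda>f n. LINT z|circle. f z * z powi (- n)"
proof -
  fix f g assume "l2_rel f g"
  note [measurable] = l2_rel_borel[OF this]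
  show "(\<lambda>n. LINT z|circle. f z * z powi (- n)) = (\<lambda>n. LINT z|circle. g z * z powi (- n))"
    using \<open>l2_rel f g\<close> by (intro ext integral_cong_AE) (auto simp: l2_rel_def power_int_def)
qed

lemma fourier_integrable:
  assumes "f \<in> sq_integrable"
  shows "integrable circle (\<lambda>z. f z * z powi n)"
proof (rule Bochner_Integration.integrable_bound[OF sq_integrable_integrable[OF assms]])
  have [measurable]: "f \<in> borel_measurable borel"
    using assms by (auto simp: sq_integrable_def)
  show "(\<lambda>z. f z * z powi n) \<in> borel_measurable circle"
    by (simp add: power_int_def)
  show "AE z in circle. cmod (f z * z powi n) \<le> cmod (f z)"
    using AE_circle_norm by eventually_elim (simp add: norm_mult norm_power_int)
qed

lemma fourier_add: "fourier (f + g) n = fourier f n + fourier g n"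
  by transfer (auto simp: l2_rel_def distrib_right
      intro!: Bochner_Integration.integral_add fourier_integrable)

lemma fourier_scaleC: "fourier (l2_scaleC c f) n = c * fourier f n"
  by transfer (simp add: mult.assoc)

typedef h2 = "{f :: l2. \<forall>n<0. fourier f n = 0}" morphisms to_l2 of_l2
proof
  show "0 \<in> {f. \<forall>n<0. fourier f n = 0}"
    using fourier_scaleC[of 0 0] by simp
qed

setup_lifting type_definition_h2

definition H2 :: "l2 set" where
  "H2 = range to_l2"

lift_definition h2_scaleC :: "complex \<Rightarrow> h2 \<Rightarrow> h2" is l2_scaleC
  by (simp add: fourier_scaleC)

instantiation h2 :: real_inner
begin

lift_definition zero_h2 :: h2 is 0
  using fourier_scaleC[of 0 0] by simp
lift_definition plus_h2 :: "h2 \<Rightarrow> h2 \<Rightarrow> h2" is "(+)"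
  by (simp add: fourier_add)
lift_definition uminus_h2 :: "h2 \<Rightarrow> h2" is uminus
  by (simp add: uminus_l2_def fourier_scaleC)
lift_definition minus_h2 :: "h2 \<Rightarrow> h2 \<Rightarrow> h2" is "(-)"
  by (simp add: minus_l2_def uminus_l2_def fourier_add fourier_scaleC)
lift_definition scaleR_h2 :: "real \<Rightarrow> h2 \<Rightarrow> h2" is "(*\<^sub>R)"
  by (simp add: scaleR_l2_def fourier_scaleC)
lift_definition inner_h2 :: "h2 \<Rightarrow> h2 \<Rightarrow> real" is "(\<bullet>)" .
lift_definition norm_h2 :: "h2 \<Rightarrow> real" is norm .
lift_definition dist_h2 :: "h2 \<Rightarrow> h2 \<Rightarrow> real" is dist .
definition sgn_h2 :: "h2 \<Rightarrow> h2" where "sgn f = inverse (norm f) *\<^sub>R (f :: h2)"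
definition uniformity_h2 :: "(h2 \<times> h2) filter" where
  "uniformity = (INF e\<in>{0<..}. principal {(f :: h2, g). dist f g < e})"
definition open_h2 :: "h2 set \<Rightarrow> bool" where
  "open U \<longleftrightarrow> (\<forall>f\<in>U. \<forall>\<^sub>F (f', g) in uniformity. f' = (f :: h2) \<longrightarrow> g \<in> U)"

instance
proof
  fix f g h :: h2 and r s :: real
  show "f + g + h = f + (g + h)" by transfer (simp add: add.assoc)
  show "f + g = g + f" by transfer (simp add: add.commute)
  show "0 + f = f" "- f + f = 0" "f - g = f + - g" by (transfer, simp)+
  show "r *\<^sub>R (f + g) = r *\<^sub>R f + r *\<^sub>R g" "(r + s) *\<^sub>R f = r *\<^sub>R f + s *\<^sub>R f"
    "r *\<^sub>R s *\<^sub>R f = (r * s) *\<^sub>R f" "1 *\<^sub>R f = f"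
    by (transfer, simp add: scaleR_add_left scaleR_add_right)+
  show "f \<bullet> g = g \<bullet> f" by transfer (simp add: inner_commute)
  show "(f + g) \<bullet> h = f \<bullet> h + g \<bullet> h" "(r *\<^sub>R f) \<bullet> g = r * (f \<bullet> g)"
    by (transfer, simp add: inner_add_left)+
  show "0 \<le> f \<bullet> f" "f \<bullet> f = 0 \<longleftrightarrow> f = 0" by (transfer, simp)+
  show "norm f = sqrt (f \<bullet> f)" by transfer (simp add: norm_eq_sqrt_inner)
  show "dist f g = norm (f - g)" by transfer (simp add: dist_norm)
  show "sgn f = inverse (norm f) *\<^sub>R f" by (fact sgn_h2_def)
  show "uniformity = (INF e\<in>{0<..}. principal {(f :: h2, g). dist f g < e})"
    by (fact uniformity_h2_def)
  show "open U \<longleftrightarrow> (\<forall>f\<in>U. \<forall>\<^sub>F (f', g) in uniformity. f' = f \<longrightarrow> g \<in> U)" for U :: "h2 set"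
    by (fact open_h2_def)
qed

end

definition h2_cinner :: "h2 \<Rightarrow> h2 \<Rightarrow> complex" where
  "h2_cinner f g = l2_cinner (to_l2 f) (to_l2 g)"

definition proj_H2 :: "l2 \<Rightarrow> h2" where
  "proj_H2 f = (THE g. \<forall>h. l2_cinner (f - to_l2 g) (to_l2 h) = 0)"

text \<open>\<^const>\<open>bounded_linear\<close> only asks for real-linearity.\<close>

definition bounded_clinear_H2 :: "(h2 \<Rightarrow> h2) \<Rightarrow> bool" where
  "bounded_clinear_H2 A \<longleftrightarrow>
     bounded_linear A \<and> (\<forall>c f. A (h2_scaleC c f) = h2_scaleC c (A f))"

definition adjoint_H2 :: "(h2 \<Rightarrow> h2) \<Rightarrow> h2 \<Rightarrow> h2" where
  "adjoint_H2 A = (THE B. \<forall>f g. h2_cinner (A f) g = h2_cinner f (B g))"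

definition ker_H2 :: "(h2 \<Rightarrow> h2) \<Rightarrow> h2 set" where
  "ker_H2 A = {f. A f = 0}"


section \<open>Toeplitz and Hankel operators\<close>

text \<open>Elements of \<open>L\<^sup>\<infinity>\<close> are represented by functions, not by classes modulo null sets; the operators
  below only depend on the class of the symbol.\<close>

definition Linf :: "(complex \<Rightarrow> complex) set" where
  "Linf = {\<phi> \<in> borel_measurable circle. \<exists>C. AE z in circle. cmod (\<phi> z) \<le> C}"

lemma sq_integrable_Linf_mult:
  assumes "\<phi> \<in> Linf" "f \<in> sq_integrable"
  shows "(\<lambda>z. \<phi> z * f z) \<in> sq_integrable"
proof -
  from assms(1) obtain C where C: "AE z in circle. cmod (\<phi> z) \<le> C" by (auto simp: Linf_def)
  have [measurable]: "\<phi> \<in> borel_measurable borel" "f \<in> borel_measurable borel"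
    using assms by (auto simp: Linf_def sq_integrable_def)
  have "integrable circle (\<lambda>z. (cmod (\<phi> z * f z))\<^sup>2)"
  proof (rule Bochner_Integration.integrable_bound)
    show "integrable circle (\<lambda>z. C\<^sup>2 * (cmod (f z))\<^sup>2)"
      using assms(2) by (auto simp: sq_integrable_def)
    show "AE z in circle. norm ((cmod (\<phi> z * f z))\<^sup>2) \<le> norm (C\<^sup>2 * (cmod (f z))\<^sup>2)"
      using C by eventually_elim (auto simp: norm_mult power_mult_distrib intro!: mult_right_mono power_mono)
  qed measurable
  then show ?thesis by (simp add: sq_integrable_def)
qed

text \<open>Multiplication by a symbol; the value for a function outside \<^const>\<open>Linf\<close> is a dummy.\<close>

lift_definition mult_op :: "(complex \<Rightarrow> complex) \<Rightarrow> l2 \<Rightarrow> l2" is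
  "\<lambda>\<phi> f. if \<phi> \<in> Linf then (\<lambda>z. \<phi> z * f z) else (\<lambda>_. 0)"
  by (auto simp: l2_rel_def sq_integrable_Linf_mult sq_integrable_zero)

lift_definition flip_op :: "l2 \<Rightarrow> l2" is "\<lambda>f z. f (cnj z)"
proof -
  fix f g assume fg: "l2_rel f g"
  note [measurable] = l2_rel_borel[OF fg]
  have sq: "(\<lambda>z. h (cnj z)) \<in> sq_integrable" if "h \<in> sq_integrable" for h
  proof -
    have [measurable]: "h \<in> borel_measurable borel" using that by (auto simp: sq_integrable_def)
    have "integrable (distr circle borel cnj) (\<lambda>z. (cmod (h z))\<^sup>2)"
      using that by (simp add: distr_cnj_circle sq_integrable_def)
    then have "integrable circle (\<lambda>z. (cmod (h (cnj z)))\<^sup>2)"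
      by (subst (asm) integrable_distr_eq) auto
    then show ?thesis by (simp add: sq_integrable_def)
  qed
  have "AE z in distr circle borel cnj. f z = g z"
    unfolding distr_cnj_circle using fg by (simp add: l2_rel_def)
  then have "AE z in circle. f (cnj z) = g (cnj z)"
    by (subst (asm) AE_distr_iff) auto
  then show "l2_rel (\<lambda>z. f (cnj z)) (\<lambda>z. g (cnj z))"
    using fg by (simp add: l2_rel_def sq)
qed

definition toeplitz :: "(complex \<Rightarrow> complex) \<Rightarrow> h2 \<Rightarrow> h2" where
  "toeplitz \<phi> f = proj_H2 (mult_op \<phi> (to_l2 f))"

definition hankel :: "(complex \<Rightarrow> complex) \<Rightarrow> h2 \<Rightarrow> h2" where
  "hankel \<phi> f = proj_H2 (mult_op \<phi> (flip_op (to_l2 f)))"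

abbreviation T_z :: "h2 \<Rightarrow> h2" where
  "T_z \<equiv> toeplitz (\<lambda>z. z)"

definition is_toeplitz :: "(h2 \<Rightarrow> h2) \<Rightarrow> bool" where
  "is_toeplitz A \<longleftrightarrow> (\<exists>\<phi>\<in>Linf. A = toeplitz \<phi>)"

definition is_hankel :: "(h2 \<Rightarrow> h2) \<Rightarrow> bool" where
  "is_hankel A \<longleftrightarrow> (\<exists>\<phi>\<in>Linf. A = hankel \<phi>)"

definition is_noninjective_hankel :: "(h2 \<Rightarrow> h2) \<Rightarrow> bool" where
  "is_noninjective_hankel A \<longleftrightarrow> is_hankel A \<and> ker_H2 A \<noteq> {0}"


section \<open>Inner functions\<close>

definition Hinf :: "(complex \<Rightarrow> complex) set" where
  "Hinf = {\<theta>. \<theta> holomorphic_on ball 0 1 \<and> bounded (\<theta> ` ball 0 1)}"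

text \<open>For \<open>\<theta>\<close> in \<^const>\<open>Hinf\<close> the radial limit exists almost everywhere on the circle, by Fatou's
  theorem; elsewhere the value is an unspecified constant.\<close>

definition radial_limit :: "(complex \<Rightarrow> complex) \<Rightarrow> complex \<Rightarrow> complex" where
  "radial_limit \<theta> z = Lim (at_left (1::real)) (\<lambda>r. \<theta> (complex_of_real r * z))"

definition inner_function :: "(complex \<Rightarrow> complex) \<Rightarrow> bool" where
  "inner_function \<theta> \<longleftrightarrow> \<theta> \<in> Hinf \<and> (AE z in circle. cmod (radial_limit \<theta> z) = 1)"

end

theory Submission
  imports Defs "HOL-Complex_Analysis.Complex_Analysis"
    "HOL-Computational_Algebra.Fundamental_Theorem_Algebra"
begin

text \<open>
  Write \<open>S = T_z\<close>. A Toeplitz operator satisfies \<open>S\<^sup>* T S = T\<close> and a Hankel operator \<open>S\<^sup>* H = H S\<close>; both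
  identities characterise their class among bounded operators (the theorems of Brown-Halmos and of
  Nehari). If \<open>A = T\<^sub>\<phi> + H\<^sub>\<psi>\<close>, then \<open>S\<^sup>* A S - A = S\<^sup>* S\<^sup>* H\<^sub>\<psi> - H\<^sub>\<psi>\<close> is again a Hankel operator, and it
  vanishes on the kernel of \<open>H\<^sub>\<psi>\<close>.

  For the converse, suppose that \<open>S\<^sup>* A S - A = H\<close> is a non-injective Hankel operator. Its kernel is
  closed and invariant under \<open>S\<close>, so it equals \<open>\<theta> H\<^sup>2\<close> for an inner function \<open>\<theta>\<close> (Beurling), whose
  boundary function is the radial limit of a bounded analytic function (Fatou). As \<open>H T\<^sub>\<theta> = 0\<close>, the
  operator \<open>A T\<^sub>\<theta>\<close> satisfies the Toeplitz identity, so \<open>A T\<^sub>\<theta> = T\<^bsub>\<phi>2\<^esub>\<close>. Put \<open>\<phi> = cnj \<theta> * \<phi>2\<close> and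
  \<open>C = A - T\<^sub>\<phi>\<close>. Then \<open>C T\<^sub>\<theta> = 0\<close> and still \<open>S\<^sup>* C S - C = H\<close>. The defect \<open>D = S\<^sup>* C - C S\<close> from being a
  Hankel operator satisfies \<open>S\<^sup>* D S = D\<close>, because \<open>S\<^sup>* H = H S\<close>; so \<open>D = T\<^sub>\<delta>\<close>, and \<open>T\<^sub>\<delta> T\<^sub>\<theta> = D T\<^sub>\<theta> = 0\<close> forces
  \<open>\<delta> \<theta> = 0\<close>, that is \<open>D = 0\<close>. Hence \<open>C\<close> has the Hankel property, and Nehari's theorem gives it a
  bounded symbol. This argument is \<open>toeplitz_plus_hankel_decomposition\<close>.

  Nehari's theorem is the deep ingredient. The functional \<open>f \<mapsto> \<langle>C f, 1\<rangle>\<close> is bounded on polynomials in the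
  \<open>L\<^sup>1\<close> norm, because a polynomial \<open>p\<close> is a product \<open>a b\<close> of two functions of the disc algebra with
  \<open>|a|\<^sup>2 = |b|\<^sup>2 = |p|\<close> on the circle, and \<open>\<langle>C (a b), 1\<rangle>\<close> is at most \<open>\<parallel>C\<parallel>\<close> times the product of the two \<open>L\<^sup>2\<close> norms.
  The Hahn-Banach theorem extends the functional to all of \<open>L\<^sup>2\<close> with the same bound, and a functional
  bounded in the \<open>L\<^sup>1\<close> norm is given by a bounded function.

  Fatou's theorem is obtained from the primitive \<open>T\<close> of the analytic function, which is continuous on the
  closed disc and Lipschitz on the circle, with derivative \<open>\<theta>\<close> along it almost everywhere by Lebesgue's
  differentiation theorem. One Cauchy integral estimate, \<open>deriv_bound_from_boundary_modulus\<close>, turns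
  the Lipschitz bound into boundedness of \<open>\<theta>\<close> and the differentiability into radial limits.
\<close>

section \<open>Projections, linear functionals and the Hahn-Banach theorem\<close>

text \<open>A minimising sequence for the distance to \<open>M\<close> is Cauchy by the parallelogram law, and at the minimum
  the first variation in each direction of \<open>M\<close> vanishes.\<close>

lemma orthogonal_projection_exists:
  fixes M :: "'a::real_inner set"
  assumes M: "subspace M" "complete M"
  obtains m where "m \<in> M" "\<And>v. v \<in> M \<Longrightarrow> inner (x - m) v = 0"
proof -
  define d where "d = (INF m\<in>M. (norm (x - m))\<^sup>2)"
  have bdd: "bdd_below ((\<lambda>m. (norm (x - m))\<^sup>2) ` M)" by (intro bdd_belowI2[of _ 0]) auto
  have ne: "M \<noteq> {}" using M(1) subspace_0 by auto
  have d_le: "d \<le> (norm (x - m))\<^sup>2" if "m \<in> M" for m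
    unfolding d_def using cINF_lower[OF bdd that] .
  have "\<exists>m\<in>M. (norm (x - m))\<^sup>2 < d + 1 / (real n + 1)" for n
    using cINF_less_iff[OF ne bdd, of "d + 1 / (real n + 1)"] unfolding d_def by auto
  then obtain s where s: "\<And>n. s n \<in> M" "\<And>n. (norm (x - s n))\<^sup>2 < d + 1 / (real n + 1)" by metis
  \<comment> \<open>the parallelogram law, with \<open>d\<close> as a lower bound at the midpoint\<close>
  have close: "(norm (s i - s j))\<^sup>2 \<le> 2 / (real i + 1) + 2 / (real j + 1)" for i j
  proof -
    have "(1/2) *\<^sub>R (s i + s j) \<in> M" using s(1) M(1) by (simp add: subspace_add subspace_scale)
    from d_le[OF this] have "4 * d \<le> 4 * (norm (x - (1/2) *\<^sub>R (s i + s j)))\<^sup>2" by simp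
    also have "4 * (norm (x - (1/2) *\<^sub>R (s i + s j)))\<^sup>2 = 2 * (norm (x - s i))\<^sup>2 + 2 * (norm (x - s j))\<^sup>2 - (norm (s i - s j))\<^sup>2"
      unfolding power2_norm_eq_inner
      by (simp add: inner_diff_left inner_diff_right inner_add_left inner_add_right inner_commute field_simps)
    finally have "4 * d \<le> 2 * (norm (x - s i))\<^sup>2 + 2 * (norm (x - s j))\<^sup>2 - (norm (s i - s j))\<^sup>2" .
    moreover have "2 / (real k + 1) = 2 * (1 / (real k + 1))" for k by simp
    ultimately show ?thesis using s(2)[of i] s(2)[of j] by linarith
  qed
  have "Cauchy s"
  proof (rule metric_CauchyI)
    fix e :: real assume "e > 0"
    define N where "N = nat \<lceil>4 / e\<^sup>2\<rceil>"
    have "dist (s i) (s j) < e" if "i \<ge> N" "j \<ge> N" for i j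
    proof -
      have *: "2 / (real k + 1) < e\<^sup>2 / 2" if "k \<ge> N" for k
      proof -
        have "4 / e\<^sup>2 \<le> real N" unfolding N_def by linarith
        then have "4 / e\<^sup>2 < real k + 1" using that by linarith
        then show ?thesis using \<open>e > 0\<close> by (simp add: field_simps)
      qed
      have "(norm (s i - s j))\<^sup>2 < e\<^sup>2" using close[of i j] *[OF that(1)] *[OF that(2)] by linarith
      then show ?thesis using \<open>e > 0\<close> by (simp add: dist_norm power2_less_imp_less)
    qed
    then show "\<exists>N. \<forall>i\<ge>N. \<forall>j\<ge>N. dist (s i) (s j) < e" by blast
  qed
  then obtain m where m: "m \<in> M" "s \<longlonglongrightarrow> m"
    using M(2) s(1) unfolding complete_def by blast
  have "(\<lambda>n. (norm (x - s n))\<^sup>2) \<longlonglongrightarrow> (norm (x - m))\<^sup>2" by (intro tendsto_intros m)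
  moreover have "(\<lambda>n. d + 1 / (real n + 1)) \<longlonglongrightarrow> d + 0"
    using LIMSEQ_inverse_real_of_nat by (intro tendsto_intros) (simp add: inverse_eq_divide add.commute)
  ultimately have md: "(norm (x - m))\<^sup>2 \<le> d"
    using s(2) by (intro LIMSEQ_le[of "\<lambda>n. (norm (x - s n))\<^sup>2"]) (auto intro!: exI[of _ 0] less_imp_le)
  have "inner (x - m) v = 0" if "v \<in> M" for v
  proof (cases "v = 0")
    case False
    \<comment> \<open>the multiple of \<open>v\<close> that minimises the quadratic function \<open>t \<mapsto> |x - m - t v|\<^sup>2\<close>\<close>
    define t where "t = inner (x - m) v / inner v v"
    have vv: "inner v v > 0" using False by simp
    have "m + t *\<^sub>R v \<in> M" using m(1) that M(1) by (simp add: subspace_add subspace_scale)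
    from d_le[OF this] md have "(norm (x - m))\<^sup>2 \<le> (norm ((x - m) - t *\<^sub>R v))\<^sup>2"
      unfolding diff_diff_eq by linarith
    also have "\<dots> = (norm (x - m))\<^sup>2 - 2 * t * inner (x - m) v + t\<^sup>2 * inner v v"
      unfolding power2_norm_eq_inner
      by (simp add: inner_diff_left[of _ "t *\<^sub>R v"] inner_diff_right[of _ _ "t *\<^sub>R v"] inner_commute power2_eq_square)
    also have "\<dots> = (norm (x - m))\<^sup>2 - (inner (x - m) v)\<^sup>2 / inner v v"
      using vv by (simp add: t_def power2_eq_square field_simps)
    finally show ?thesis using vv by (simp add: divide_le_0_iff)
  qed simp
  with m(1) show thesis using that by blast
qed

text \<open>The representing vector is a multiple of the component of any vector outside the kernel that is
  orthogonal to the kernel.\<close>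

lemma riesz_representation:
  fixes f :: "'a::real_inner \<Rightarrow> real"
  assumes complete: "complete (UNIV :: 'a set)" and f: "bounded_linear f"
  obtains y where "\<And>x. f x = inner x y"
proof (cases "\<forall>x. f x = 0")
  case True
  then show thesis using that[of 0] by simp
next
  case False
  interpret f: bounded_linear f by fact
  let ?M = "{x. f x = 0}"
  obtain x0 where x0: "f x0 \<noteq> 0" using False by blast
  have "subspace ?M" by (auto simp: subspace_def f.add f.scaleR)
  moreover have "closed ?M"
    by (intro closed_Collect_eq continuous_intros f.continuous_on)
  then have "complete ?M" using complete complete_closed_subset by blast
  ultimately obtain m where m: "f m = 0" "\<And>v. f v = 0 \<Longrightarrow> inner (x0 - m) v = 0"
    using orthogonal_projection_exists[of ?M x0] by auto
  define w where "w = x0 - m"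
  have fw: "f w \<noteq> 0" using x0 m(1) by (simp add: w_def f.diff)
  then have ww: "inner w w \<noteq> 0" by auto
  have "f x = inner x ((f w / inner w w) *\<^sub>R w)" for x
  proof -
    have "f (x - (f x / f w) *\<^sub>R w) = 0" using fw by (simp add: f.diff f.scaleR)
    from m(2)[OF this] have "inner w x = f x / f w * inner w w"
      by (simp add: w_def[symmetric] inner_diff_right)
    then show ?thesis using fw ww by (simp add: inner_commute)
  qed
  then show thesis using that by blast
qed

text \<open>Linear extensions are handled through their graphs, as subspaces of \<^typ>\<open>'a \<times> real\<close> on which the
  second coordinate is at most \<open>N\<close> of the first. Such a subspace is automatically single-valued,
  since \<open>N 0 = 0\<close>, and unions of chains stay in the class. A maximal one, which exists by Zorn's lemma,
  has full domain.\<close>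

lemma hahn_banach_sublinear:
  fixes N f :: "'a::real_vector \<Rightarrow> real"
  assumes N_add: "\<And>x y. N (x + y) \<le> N x + N y"
    and N_scale: "\<And>r x. r \<ge> 0 \<Longrightarrow> N (r *\<^sub>R x) = r * N x"
    and V: "subspace V"
    and f_add: "\<And>x y. x \<in> V \<Longrightarrow> y \<in> V \<Longrightarrow> f (x + y) = f x + f y"
    and f_scale: "\<And>r x. x \<in> V \<Longrightarrow> f (r *\<^sub>R x) = r * f x"
    and f_le: "\<And>x. x \<in> V \<Longrightarrow> f x \<le> N x"
  obtains F where "linear F" "\<And>x. x \<in> V \<Longrightarrow> F x = f x" "\<And>x. F x \<le> N x"
proof -
  define G0 where "G0 = (\<lambda>x. (x, f x)) ` V"
  define \<A> where "\<A> = {G. G0 \<subseteq> G \<and> subspace G \<and> (\<forall>(x, a)\<in>G. a \<le> N x)}"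
  have f0: "f 0 = 0" using f_scale[of 0 0] subspace_0[OF V] by simp
  have "subspace G0"
    unfolding G0_def subspace_def using V f_add f_scale f0
    by (auto simp: zero_prod_def subspace_0 subspace_add subspace_scale image_iff)
  then have G0: "G0 \<in> \<A>" by (auto simp: \<A>_def G0_def f_le)
  have "\<exists>U\<in>\<A>. \<forall>X\<in>c. X \<subseteq> U" if c: "subset.chain \<A> c" for c
  proof (cases "c = {}")
    case True
    then show ?thesis using G0 by auto
  next
    case False
    have cA: "c \<subseteq> \<A>" and tot: "\<And>X Y. X \<in> c \<Longrightarrow> Y \<in> c \<Longrightarrow> X \<subseteq> Y \<or> Y \<subseteq> X"
      using c by (auto simp: subset_chain_def)
    have "subspace (\<Union>c)"
      unfolding subspace_def
    proof (intro conjI ballI allI)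
      show "0 \<in> \<Union>c" using False cA subspace_0 unfolding \<A>_def by blast
      show "x + y \<in> \<Union>c" if xy: "x \<in> \<Union>c" "y \<in> \<Union>c" for x y
      proof -
        obtain X where "X \<in> c" "x \<in> X" "y \<in> X" using xy tot by blast
        then show ?thesis using cA by (auto simp: \<A>_def intro: subspace_add)
      qed
      show "r *\<^sub>R x \<in> \<Union>c" if "x \<in> \<Union>c" for r x
        using that cA by (auto simp: \<A>_def intro: subspace_scale)
    qed
    then have "\<Union>c \<in> \<A>" using False cA by (auto simp: \<A>_def)
    then show ?thesis by blast
  qed
  then obtain G where G: "G \<in> \<A>" and max: "\<And>H. H \<in> \<A> \<Longrightarrow> G \<subseteq> H \<Longrightarrow> H = G"
    using subset_Zorn[of \<A>] by metis
  have Gs: "subspace G" and GN: "\<And>x a. (x, a) \<in> G \<Longrightarrow> a \<le> N x" and G0G: "G0 \<subseteq> G"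
    using G by (auto simp: \<A>_def)
  have N0: "N 0 = 0" using N_scale[of 0 0] by simp
  have single: "a = b" if "(x, a) \<in> G" "(x, b) \<in> G" for x a b
  proof -
    have "(0, a - b) \<in> G" "(0, b - a) \<in> G"
      using subspace_diff[OF Gs that] subspace_diff[OF Gs that(2,1)] by simp_all
    from GN[OF this(1)] GN[OF this(2)] show ?thesis using N0 by linarith
  qed
  have total: "\<exists>a. (x, a) \<in> G" for x
  proof (rule ccontr)
    assume x: "\<nexists>a. (x, a) \<in> G"
    define L where "L = (\<lambda>(y, b). b - N (y - x)) ` G"
    have LU: "b - N (y - x) \<le> N (z + x) - a" if "(y, b) \<in> G" "(z, a) \<in> G" for y b z a
    proof -
      have "(y + z, b + a) \<in> G" using subspace_add[OF Gs that] by simp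
      then have "b + a \<le> N ((y - x) + (z + x))" using GN by simp
      then show ?thesis using N_add[of "y - x" "z + x"] by linarith
    qed
    have z0: "(0, 0) \<in> G" using subspace_0[OF Gs] by (simp add: zero_prod_def)
    then have Lne: "L \<noteq> {}" by (auto simp: L_def)
    have bdd: "bdd_above L" unfolding L_def using LU[OF _ z0] by (intro bdd_aboveI2) auto
    \<comment> \<open>Any value between the two bounds in \<open>LU\<close> is an admissible value at \<open>x\<close>.\<close>
    define c where "c = Sup L"
    have c1: "b + - c \<le> N (y - x)" if "(y, b) \<in> G" for y b
    proof -
      have "b - N (y - x) \<le> c"
        unfolding c_def by (intro cSup_upper bdd) (force simp: L_def that)
      then show ?thesis by simp
    qed
    have c2: "b + c \<le> N (y + x)" if "(y, b) \<in> G" for y b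
    proof -
      have "c \<le> N (y + x) - b"
        unfolding c_def by (intro cSup_least Lne) (auto simp: L_def LU that)
      then show ?thesis by simp
    qed
    define H where "H = {g + t *\<^sub>R (x, c) | g t. g \<in> G}"
    have GH: "G \<subseteq> H" unfolding H_def by (force intro: exI[of _ 0])
    have "subspace H"
      unfolding subspace_def
    proof (intro conjI ballI allI)
      show "0 \<in> H" using GH subspace_0[OF Gs] by blast
      show "p + q \<in> H" if "p \<in> H" "q \<in> H" for p q
      proof -
        obtain g t h s where "g \<in> G" "h \<in> G" "p = g + t *\<^sub>R (x, c)" "q = h + s *\<^sub>R (x, c)"
          using \<open>p \<in> H\<close> \<open>q \<in> H\<close> unfolding H_def by blast
        then have "p + q = (g + h) + (t + s) *\<^sub>R (x, c)" "g + h \<in> G"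
          by (auto simp: algebra_simps subspace_add[OF Gs])
        then show ?thesis unfolding H_def by blast
      qed
      show "r *\<^sub>R p \<in> H" if "p \<in> H" for r p
      proof -
        obtain g t where "g \<in> G" "p = g + t *\<^sub>R (x, c)"
          using \<open>p \<in> H\<close> unfolding H_def by blast
        then have "r *\<^sub>R p = r *\<^sub>R g + (r * t) *\<^sub>R (x, c)" "r *\<^sub>R g \<in> G"
          using subspace_scale[OF Gs] by (simp_all add: scaleR_add_right del: scaleR_Pair)
        then show ?thesis unfolding H_def by blast
      qed
    qed
    moreover have "b \<le> N y" if "(y, b) \<in> H" for y b
    proof -
      obtain y' b' t where g: "(y', b') \<in> G" "y = y' + t *\<^sub>R x" "b = b' + t * c"
        using \<open>(y, b) \<in> H\<close> unfolding H_def by auto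
      show ?thesis
      proof (cases t "0 :: real" rule: linorder_cases)
        case equal
        then show ?thesis using g GN by simp
      next
        case greater
        have "((1/t) *\<^sub>R y', (1/t) * b') \<in> G" using subspace_scale[OF Gs g(1), of "1/t"] by simp
        from c2[OF this] have "t * ((1/t) * b' + c) \<le> t * N ((1/t) *\<^sub>R y' + x)"
          using greater by (intro mult_left_mono) auto
        also have "\<dots> = N (t *\<^sub>R ((1/t) *\<^sub>R y' + x))" using greater by (simp add: N_scale)
        finally show ?thesis using greater g by (simp add: algebra_simps)
      next
        case less
        define s where "s = - t"
        have s: "s > 0" "t = - s" using less by (auto simp: s_def)
        have "((1/s) *\<^sub>R y', (1/s) * b') \<in> G" using subspace_scale[OF Gs g(1), of "1/s"] by simp
        from c1[OF this] have "s * ((1/s) * b' + - c) \<le> s * N ((1/s) *\<^sub>R y' - x)"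
          using s by (intro mult_left_mono) auto
        also have "\<dots> = N (s *\<^sub>R ((1/s) *\<^sub>R y' - x))" using s by (simp add: N_scale)
        also have "s *\<^sub>R ((1/s) *\<^sub>R y' - x) = y" using s g by (simp add: scaleR_diff_right)
        also have "s * ((1/s) * b' + - c) = b" using s g by (simp add: right_diff_distrib)
        finally show ?thesis .
      qed
    qed
    ultimately have "H \<in> \<A>" using GH G0G by (auto simp: \<A>_def)
    with max GH have "H = G" by blast
    moreover have "(0, 0) + 1 *\<^sub>R (x, c) \<in> H" unfolding H_def using z0 by blast
    ultimately show False using x by simp
  qed
  define F where "F x = (THE a. (x, a) \<in> G)" for x
  have FG: "(x, F x) \<in> G" for x
    unfolding F_def by (rule theI') (use total[of x] single in blast)
  have "linear F"
  proof (rule linearI)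
    show "F (x + y) = F x + F y" for x y
      using subspace_add[OF Gs FG[of x] FG[of y]] FG[of "x + y"] single by simp
    show "F (r *\<^sub>R x) = r *\<^sub>R F x" for r x
      using subspace_scale[OF Gs FG[of x], of r] FG[of "r *\<^sub>R x"] single by simp
  qed
  moreover have "F x = f x" if "x \<in> V" for x
    using FG[of x] G0G that single by (auto simp: G0_def)
  moreover have "F x \<le> N x" for x using FG GN by blast
  ultimately show thesis using that by blast
qed


section \<open>Functions on the circle\<close>

interpretation circle: finite_measure circle by (rule finite_measure_circle)

lemma compact_norm_bound:
  fixes f :: "'a::topological_space \<Rightarrow> 'b::real_normed_vector"
  assumes "compact S" "continuous_on S f"
  obtains C where "\<And>z. z \<in> S \<Longrightarrow> norm (f z) \<le> C"
  using compact_imp_bounded[OF compact_continuous_image[OF assms(2,1)]] by (auto simp: bounded_iff)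

lemma measure_circle_UNIV [simp]: "measure circle UNIV = 1"
  by (simp add: measure_def emeasure_circle_UNIV)

lemma powi_measurable [measurable]: "(\<lambda>z::complex. z powi n) \<in> borel_measurable borel"
  by (simp add: power_int_def)

lemma cnj_circle:
  assumes "cmod z = 1" shows "cnj z = inverse z"
proof -
  have "z * cnj z = 1" using assms by (simp add: complex_norm_square[symmetric])
  then show ?thesis by (rule inverse_unique[symmetric])
qed

lemma cnj_powi_circle: "cmod z = 1 \<Longrightarrow> cnj (z powi n) = z powi (- n)"
  by (simp add: complex_cnj_power_int cnj_circle power_int_inverse power_int_minus)

lemma integrable_powi_mult:
  assumes "integrable circle f"
  shows "integrable circle (\<lambda>z. f z * z powi n)"
proof (rule Bochner_Integration.integrable_bound[OF assms])
  have [measurable]: "f \<in> borel_measurable borel"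
    using borel_measurable_integrable[OF assms] by simp
  show "(\<lambda>z. f z * z powi n) \<in> borel_measurable circle" by simp
  show "AE z in circle. cmod (f z * z powi n) \<le> cmod (f z)"
    using AE_circle_norm by eventually_elim (simp add: norm_mult norm_power_int)
qed

lemma LinfI:
  assumes "f \<in> borel_measurable borel" "\<And>z. cmod z = 1 \<Longrightarrow> cmod (f z) \<le> C"
  shows "f \<in> Linf"
  unfolding Linf_def using assms AE_circle_norm by (auto intro!: exI[of _ C])

lemma Linf_mult:
  assumes "f \<in> Linf" "g \<in> Linf"
  shows "(\<lambda>z. f z * g z) \<in> Linf"
proof -
  obtain B C where BC: "AE z in circle. cmod (f z) \<le> B" "AE z in circle. cmod (g z) \<le> C"
    using assms by (auto simp: Linf_def)
  have "AE z in circle. cmod (f z * g z) \<le> B * C"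
    using BC by eventually_elim
      (auto simp: norm_mult intro!: mult_mono order_trans[OF norm_ge_zero])
  then show ?thesis using assms by (auto simp: Linf_def)
qed

lemma Linf_diff:
  assumes "f \<in> Linf" "g \<in> Linf"
  shows "(\<lambda>z. f z - g z) \<in> Linf"
proof -
  obtain B C where BC: "AE z in circle. cmod (f z) \<le> B" "AE z in circle. cmod (g z) \<le> C"
    using assms by (auto simp: Linf_def)
  have "AE z in circle. cmod (f z - g z) \<le> B + C"
    using BC by eventually_elim (meson add_mono norm_triangle_ineq4 order_trans)
  then show ?thesis using assms by (auto simp: Linf_def)
qed

lemma Linf_cnj: "f \<in> Linf \<Longrightarrow> (\<lambda>z. cnj (f z)) \<in> Linf"
  by (auto simp: Linf_def intro: measurable_compose)

lemma powi_Linf: "(\<lambda>z. z powi n) \<in> Linf"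
  by (rule LinfI[where C=1]) (auto simp: norm_power_int)

lemma one_sq_integrable: "(\<lambda>_. 1) \<in> sq_integrable"
  by (simp add: sq_integrable_def)

lemma Linf_sq_integrable: "f \<in> Linf \<Longrightarrow> f \<in> sq_integrable"
  using sq_integrable_Linf_mult[OF _ one_sq_integrable] by simp

lemma Linf_id: "(\<lambda>z. z) \<in> Linf" using powi_Linf[of 1] by simp

lemma Linf_1: "(\<lambda>z. 1) \<in> Linf" using powi_Linf[of 0] by simp

lemma Linf_cnj_id: "cnj \<in> Linf" using Linf_cnj[OF Linf_id] by simp


section \<open>Uniqueness of Fourier coefficients\<close>

definition fourier_null :: "(complex \<Rightarrow> complex) \<Rightarrow> bool" where
  "fourier_null f \<longleftrightarrow> integrable circle f \<and> (\<forall>n. (LINT z|circle. f z * z powi n) = 0)"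

text \<open>On the circle the real coordinates are combinations of \<open>z\<close> and \<open>z\<^sup>-\<^sup>1\<close>, so multiplication by
  a linear function shifts the Fourier coefficients by one place. Stating the property for all \<open>f\<close> with vanishing
  coefficients makes the product case of the induction a mere composition.\<close>

lemma fourier_null_polynomial_mult:
  assumes "real_polynomial_function p" "fourier_null f"
  shows "fourier_null (\<lambda>z. complex_of_real (p z) * f z)"
  using assms
proof (induction p arbitrary: f rule: real_polynomial_function.induct)
  case (linear p)
  interpret p: bounded_linear p by fact
  have f: "integrable circle f" using linear by (simp add: fourier_null_def)
  have [measurable]: "f \<in> borel_measurable borel" using borel_measurable_integrable[OF f] by simp
  have [measurable]: "p \<in> borel_measurable borel"
    by (intro borel_measurable_continuous_onI p.continuous_on continuous_on_id)
  \<comment> \<open>\<open>p z = \<alpha> z + \<beta> cnj z\<close>, and \<open>cnj z = z\<^sup>-\<^sup>1\<close> on the circle\<close>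
  define \<alpha> \<beta> where "\<alpha> = (of_real (p 1) - \<i> * of_real (p \<i>)) / 2"
    and "\<beta> = (of_real (p 1) + \<i> * of_real (p \<i>)) / 2"
  have p: "of_real (p z) = \<alpha> * z + \<beta> * cnj z" for z
  proof -
    have "p z = p (Re z *\<^sub>R 1 + Im z *\<^sub>R \<i>)" by (rule arg_cong[of _ _ p]) (simp add: complex_eq_iff)
    also have "\<dots> = Re z * p 1 + Im z * p \<i>" by (simp add: p.add p.scaleR)
    finally show ?thesis by (simp add: \<alpha>_def \<beta>_def complex_eq_iff field_simps)
  qed
  have eq: "AE z in circle. of_real (p z) * f z * z powi n =
      \<alpha> * (f z * z powi (n + 1)) + \<beta> * (f z * z powi (n - 1))" for n
    using AE_circle_norm
  proof eventually_elim
    case (elim z)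
    then have "z \<noteq> 0" by auto
    then show ?case unfolding p cnj_circle[OF elim]
      by (simp add: power_int_add power_int_diff field_simps)
  qed
  have int: "integrable circle (\<lambda>z. \<alpha> * (f z * z powi (n + 1)) + \<beta> * (f z * z powi (n - 1)))" for n
    using f by (intro Bochner_Integration.integrable_add integrable_mult_right integrable_powi_mult)
  have "(LINT z|circle. of_real (p z) * f z * z powi n) = 0" for n
  proof -
    have "(LINT z|circle. of_real (p z) * f z * z powi n) =
      (LINT z|circle. \<alpha> * (f z * z powi (n + 1)) + \<beta> * (f z * z powi (n - 1)))"
      by (rule integral_cong_AE) (use eq in simp_all)
    also have "\<dots> = 0"
      using linear f by (subst Bochner_Integration.integral_add) (simp_all add: integrable_powi_mult fourier_null_def)
    finally show ?thesis .
  qed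
  moreover have "integrable circle (\<lambda>z. of_real (p z) * f z)"
    by (rule iffD2[OF integrable_cong_AE int[of 0]]) (use eq[of 0] in simp_all)
  ultimately show ?case by (simp add: fourier_null_def)
next
  case (const c)
  then show ?case by (simp add: fourier_null_def mult.assoc)
next
  case (add p q)
  then show ?case
    by (simp add: fourier_null_def distrib_right integrable_powi_mult)
next
  case (mult p q)
  have "fourier_null (\<lambda>z. complex_of_real (p z) * (complex_of_real (q z) * f z))"
    using mult by blast
  then show ?case by (simp add: mult.assoc)
qed

text \<open>The polynomials of the previous lemma are uniformly dense on the circle, by the Stone-Weierstrass
  theorem.\<close>

lemma fourier_null_continuous:
  assumes f: "fourier_null f" and g: "continuous_on UNIV g"
  shows "(LINT z|circle. complex_of_real (g z) * f z) = 0"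
proof -
  have fi: "integrable circle f" using f by (simp add: fourier_null_def)
  have [measurable]: "f \<in> borel_measurable borel" using borel_measurable_integrable[OF fi] by simp
  have [measurable]: "g \<in> borel_measurable borel" using g by (rule borel_measurable_continuous_onI)
  obtain C where "\<And>z. z \<in> sphere 0 1 \<Longrightarrow> norm (g z) \<le> C"
    using compact_norm_bound[of "sphere 0 1" g] continuous_on_subset[OF g] by auto
  then have C: "\<And>z. cmod z = 1 \<Longrightarrow> \<bar>g z\<bar> \<le> C" by simp
  have gf: "integrable circle (\<lambda>z. complex_of_real (g z) * f z)"
  proof (rule Bochner_Integration.integrable_bound[OF integrable_mult_right[OF fi, of "of_real C"]])
    show "AE z in circle. cmod (of_real (g z) * f z) \<le> cmod (of_real C * f z)"
      using AE_circle_norm by eventually_elim (use C in \<open>force simp: norm_mult intro!: mult_right_mono\<close>)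
  qed simp
  have bound: "cmod (LINT z|circle. of_real (g z) * f z) \<le> e * (LINT z|circle. cmod (f z))" if e: "e > 0" for e
  proof -
    have "\<exists>p. polynomial_function p \<and> (\<forall>z\<in>sphere 0 1. norm (g z - p z) < e)"
      using g e by (intro Stone_Weierstrass_polynomial_function) (auto intro: continuous_on_subset)
    then obtain p :: "complex \<Rightarrow> real" where p: "real_polynomial_function p" "\<And>z. cmod z = 1 \<Longrightarrow> \<bar>g z - p z\<bar> < e"
      by (auto simp: real_polynomial_function_eq)
    have [measurable]: "p \<in> borel_measurable borel"
      using p(1) by (intro borel_measurable_continuous_onI continuous_on_polymonial_function) (simp add: real_polynomial_function_eq)
    have pn: "fourier_null (\<lambda>z. of_real (p z) * f z)" by (rule fourier_null_polynomial_mult[OF p(1) f])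
    then have pf: "integrable circle (\<lambda>z. of_real (p z) * f z)" "(LINT z|circle. of_real (p z) * f z) = 0"
      by (auto simp: fourier_null_def dest: spec[of _ 0])
    have "(LINT z|circle. of_real (g z) * f z) = (LINT z|circle. of_real (g z) * f z - of_real (p z) * f z)"
      using pf gf by (subst Bochner_Integration.integral_diff) simp_all
    also have "cmod \<dots> \<le> (LINT z|circle. e * cmod (f z))"
    proof (rule order_trans[OF integral_norm_bound integral_mono_AE])
      show "AE z in circle. cmod (of_real (g z) * f z - of_real (p z) * f z) \<le> e * cmod (f z)"
        using AE_circle_norm
      proof eventually_elim
        case (elim z)
        have "of_real (g z) * f z - of_real (p z) * f z = of_real (g z - p z) * f z"
          by (simp add: left_diff_distrib)
        then show ?case using p(2)[OF elim]
          by (simp only: norm_mult norm_of_real) (intro mult_right_mono; simp)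
      qed
    qed (use gf pf fi in \<open>simp_all\<close>)
    finally show ?thesis by simp
  qed
  have "cmod (LINT z|circle. of_real (g z) * f z) \<le> 0"
  proof (rule field_le_epsilon)
    fix e :: real assume "e > 0"
    define I where "I = (LINT z|circle. cmod (f z))"
    have "I \<ge> 0" by (simp add: I_def)
    have "e / (I + 1) > 0" using \<open>e > 0\<close> \<open>I \<ge> 0\<close> by simp
    from bound[OF this] have "cmod (LINT z|circle. of_real (g z) * f z) \<le> e / (I + 1) * I" by (simp add: I_def)
    also have "\<dots> \<le> 0 + e" using \<open>e > 0\<close> \<open>I \<ge> 0\<close> by (simp add: field_simps)
    finally show "cmod (LINT z|circle. of_real (g z) * f z) \<le> 0 + e" .
  qed
  then show ?thesis by simp
qed

text \<open>The indicator of a closed set is a pointwise limit of bounded continuous functions of the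
  distance to it.\<close>

lemma fourier_null_closed:
  assumes f: "fourier_null f" and K: "closed K"
  shows "(LINT z|circle. indicator K z *\<^sub>R f z) = 0"
proof (cases "K = {}")
  case False
  have fi: "integrable circle f" using f by (simp add: fourier_null_def)
  have [measurable]: "f \<in> borel_measurable borel" using borel_measurable_integrable[OF fi] by simp
  have [measurable]: "K \<in> sets borel" using K by simp
  define g where "g k z = max 0 (1 - real k * infdist z K)" for k :: nat and z :: complex
  have g: "continuous_on UNIV (g k)" for k unfolding g_def by (intro continuous_intros)
  then have [measurable]: "g k \<in> borel_measurable borel" for k by (rule borel_measurable_continuous_onI)
  have "(\<lambda>k. LINT z|circle. complex_of_real (g k z) * f z) \<longlonglongrightarrow> (LINT z|circle. indicator K z *\<^sub>R f z)"
  proof (rule integral_dominated_convergence[where w="\<lambda>z. cmod (f z)"])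
    have lim: "(\<lambda>k. g k z) \<longlonglongrightarrow> indicator K z" for z
    proof (cases "z \<in> K")
      case True
      then show ?thesis by (simp add: g_def)
    next
      case z: False
      have "infdist z K > 0"
        using z K False by (metis in_closed_iff_infdist_zero infdist_nonneg less_eq_real_def)
      then obtain k0 :: nat where k0: "1 < real k0 * infdist z K" using reals_Archimedean3 by blast
      have "\<forall>\<^sub>F k in sequentially. g k z = 0"
        using eventually_ge_at_top[of k0]
      proof eventually_elim
        case (elim k)
        have "real k0 * infdist z K \<le> real k * infdist z K"
          using elim by (intro mult_right_mono) (auto simp: infdist_nonneg)
        then show ?case using k0 by (simp add: g_def)
      qed
      then show ?thesis using z by (simp add: tendsto_eventually)
    qed
    show "AE z in circle. (\<lambda>k. complex_of_real (g k z) * f z) \<longlonglongrightarrow> indicator K z *\<^sub>R f z"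
      unfolding scaleR_conv_of_real by (intro AE_I2 tendsto_mult tendsto_of_real lim tendsto_const)
    show "AE z in circle. cmod (complex_of_real (g k z) * f z) \<le> cmod (f z)" for k
    proof (rule AE_I2)
      fix z
      have "\<bar>g k z\<bar> \<le> 1" unfolding g_def using infdist_nonneg[of z K] by (auto simp: max_def)
      then show "cmod (complex_of_real (g k z) * f z) \<le> cmod (f z)"
        unfolding norm_mult norm_of_real by (intro mult_left_le_one_le) auto
    qed
  qed (use fi in simp_all)
  then show ?thesis unfolding fourier_null_continuous[OF f g] by (simp add: LIMSEQ_const_iff)
qed simp

text \<open>Since \<open>f\<close> is only integrable, Parseval's identity is of no use. Instead the integral of \<open>f\<close> vanishes over
  closed sets, hence over all Borel sets by a Dynkin argument, and then \<open>f = 0\<close>.\<close>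

lemma fourier_null_AE_zero:
  assumes f: "fourier_null f"
  shows "AE z in circle. f z = 0"
proof -
  have fi: "integrable circle f" using f by (simp add: fourier_null_def)
  have total: "(LINT z|circle. f z) = 0" using fourier_null_closed[OF f, of UNIV] by simp
  have si: "set_integrable circle A f" if "A \<in> sets borel" for A
    using fi that by (intro integrable_mult_indicator[where M=circle, folded set_integrable_def]) simp_all
  have "(LINT z:A|circle. f z) = 0" if A: "A \<in> sets borel" for A
  proof -
    have compl: "(LINT z:(UNIV - A)|circle. f z) = 0" if "A \<in> sets borel" "(LINT z:A|circle. f z) = 0" for A
    proof -
      have "(LINT z:(A \<union> (UNIV - A))|circle. f z) = (LINT z:A|circle. f z) + (LINT z:(UNIV - A)|circle. f z)"
        using that(1) by (intro set_integral_Un si) auto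
      then show ?thesis using that(2) total by (simp add: set_lebesgue_integral_def)
    qed
    have closed: "(LINT z:K|circle. f z) = 0" if "closed K" for K
      using fourier_null_closed[OF f that] by (simp add: set_lebesgue_integral_def)
    have "A \<in> sigma_sets UNIV {S. open S}" using A by (simp add: borel_def)
    then show ?thesis
    proof (induction A rule: sigma_sets_induct_disjoint[where \<Omega>=UNIV and G="{S. open S}", consumes 0, case_names int_stable subset gen basic empty compl union])
      show "Int_stable {S :: complex set. open S}" by (auto simp: Int_stable_def)
    next
      case (basic S)
      have "closed (UNIV - S)" using basic by (simp add: closed_def Compl_eq_Diff_UNIV[symmetric])
      from compl[OF _ closed[OF this]] this show ?case by (simp add: double_diff)
    next
      case (compl A)
      then show ?case using \<open>\<And>A. A \<in> sets borel \<Longrightarrow> (LINT z:A|circle. f z) = 0 \<Longrightarrow> (LINT z:(UNIV - A)|circle. f z) = 0\<close>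
        by (simp add: borel_def)
    next
      case (union A)
      have A: "A i \<in> sets borel" for i using union(2) by (auto simp: borel_def)
      have "(LINT z:(\<Union>i. A i)|circle. f z) = (\<Sum>i. LINT z:A i|circle. f z)"
        using union(1) A si by (intro lebesgue_integral_countable_add) (auto simp: disjoint_family_on_def)
      moreover have "(LINT z:A i|circle. f z) = 0" for i using union(2,3) by blast
      ultimately show ?case by simp
    qed (use A in \<open>auto simp: borel_def set_lebesgue_integral_def\<close>)
  qed
  then show ?thesis by (intro circle.density_zero fi) simp
qed


section \<open>The Hilbert space structure of \<open>L\<^sup>2\<close>\<close>

text \<open>Elements of \<^typ>\<open>l2\<close> are compared through representatives: every operation is described
  almost everywhere on the circle by a rule named \<open>rep_\<dots>\<close>.\<close>

lemma rep_l2_sq_integrable [simp]: "rep_l2 f \<in> sq_integrable"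
  using Quotient_rep_reflp[OF Quotient_l2] by (simp add: l2_rel_def)

lemma rep_l2_measurable [measurable]: "rep_l2 f \<in> borel_measurable borel"
  using rep_l2_sq_integrable[of f] by (auto simp: sq_integrable_def)

lemma l2_rel_refl: "f \<in> sq_integrable \<Longrightarrow> l2_rel f f"
  by (simp add: l2_rel_def)

lemma abs_rep_l2 [simp]: "abs_l2 (rep_l2 f) = f"
  by (rule Quotient_abs_rep[OF Quotient_l2])

lemma abs_l2_eqI:
  assumes "f \<in> sq_integrable" "g \<in> sq_integrable" "AE z in circle. f z = g z"
  shows "abs_l2 f = abs_l2 g"
  using assms by (intro Quotient_rel_abs[OF Quotient_l2]) (simp add: l2_rel_def)

lemma rep_abs_l2:
  assumes "f \<in> sq_integrable" shows "AE z in circle. rep_l2 (abs_l2 f) z = f z"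
  using Quotient_rep_abs[OF Quotient_l2, OF l2_rel_refl[OF assms]] by (simp add: l2_rel_def)

lemma l2_eqI: "AE z in circle. rep_l2 f z = rep_l2 g z \<Longrightarrow> f = g"
  using abs_l2_eqI[of "rep_l2 f" "rep_l2 g"] by simp

lemmas abs_l2_eqs = plus_l2.abs_eq[OF l2_rel_refl l2_rel_refl] l2_scaleC.abs_eq[OF l2_rel_refl]
  l2_cinner.abs_eq[OF l2_rel_refl l2_rel_refl] fourier.abs_eq[OF l2_rel_refl]
  flip_op.abs_eq[OF l2_rel_refl] mult_op.abs_eq[OF l2_rel_refl]

lemma l2_cinner_rep: "l2_cinner f g = (LINT z|circle. rep_l2 f z * cnj (rep_l2 g z))"
  using abs_l2_eqs(3)[OF rep_l2_sq_integrable rep_l2_sq_integrable, of f g] by simp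

lemma fourier_rep: "fourier f n = (LINT z|circle. rep_l2 f z * z powi (- n))"
  using abs_l2_eqs(4)[OF rep_l2_sq_integrable, of f] by simp

lemma rep_plus: "AE z in circle. rep_l2 (f + g) z = rep_l2 f z + rep_l2 g z"
  using rep_abs_l2[OF sq_integrable_add[OF rep_l2_sq_integrable rep_l2_sq_integrable], of f g]
    abs_l2_eqs(1)[OF rep_l2_sq_integrable rep_l2_sq_integrable, of f g] by simp

lemma rep_scaleC: "AE z in circle. rep_l2 (l2_scaleC c f) z = c * rep_l2 f z"
  using rep_abs_l2[OF sq_integrable_scale[OF rep_l2_sq_integrable], of c f]
    abs_l2_eqs(2)[OF rep_l2_sq_integrable, of c f] by simp

lemma minus_l2_scaleC: "f - g = f + l2_scaleC (-1) g"
  by (simp add: minus_l2_def uminus_l2_def)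

lemma rep_minus: "AE z in circle. rep_l2 (f - g) z = rep_l2 f z - rep_l2 g z"
  using rep_plus[of f "l2_scaleC (-1) g"] rep_scaleC[of "-1" g]
  unfolding minus_l2_scaleC by eventually_elim simp

lemma rep_mult: "\<phi> \<in> Linf \<Longrightarrow> AE z in circle. rep_l2 (mult_op \<phi> f) z = \<phi> z * rep_l2 f z"
  using rep_abs_l2[OF sq_integrable_Linf_mult[OF _ rep_l2_sq_integrable], of \<phi> f]
    abs_l2_eqs(6)[OF rep_l2_sq_integrable, of \<phi> f] by simp

lemma AE_cnj_circle:
  assumes "AE z in circle. P z" shows "AE z in circle. P (cnj z)"
proof -
  have "AE z in distr circle borel cnj. P z" unfolding distr_cnj_circle by fact
  then show ?thesis by (rule AE_distrD[rotated]) simp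
qed

lemma integral_cnj_circle:
  fixes f :: "complex \<Rightarrow> 'a::{banach, second_countable_topology}"
  assumes [measurable]: "f \<in> borel_measurable borel"
  shows "(LINT z|circle. f (cnj z)) = (LINT z|circle. f z)"
proof -
  have "(LINT z|circle. f z) = (LINT z|distr circle borel cnj. f z)" by (simp only: distr_cnj_circle)
  also have "\<dots> = (LINT z|circle. f (cnj z))" by (intro integral_distr) simp_all
  finally show ?thesis by simp
qed

lemma integrable_cnj_circle:
  fixes f :: "complex \<Rightarrow> 'a::{banach, second_countable_topology}"
  assumes [measurable]: "f \<in> borel_measurable borel"
  shows "integrable circle (\<lambda>z. f (cnj z)) \<longleftrightarrow> integrable circle f"
proof -
  have "integrable circle f \<longleftrightarrow> integrable (distr circle borel cnj) f" by (simp only: distr_cnj_circle)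
  also have "\<dots> \<longleftrightarrow> integrable circle (\<lambda>z. f (cnj z))" by (intro integrable_distr_eq) simp_all
  finally show ?thesis by simp
qed

lemma sq_integrable_flip: "f \<in> sq_integrable \<Longrightarrow> (\<lambda>z. f (cnj z)) \<in> sq_integrable"
  using integrable_cnj_circle[of "\<lambda>z. (cmod (f z))\<^sup>2"] by (auto simp: sq_integrable_def)

lemma Linf_flip: "f \<in> Linf \<Longrightarrow> (\<lambda>z. f (cnj z)) \<in> Linf"
proof -
  assume f: "f \<in> Linf"
  then have [measurable]: "f \<in> borel_measurable borel" by (auto simp: Linf_def)
  obtain C where "AE z in circle. cmod (f z) \<le> C" using f by (auto simp: Linf_def)
  then have "AE z in circle. cmod (f (cnj z)) \<le> C" by (rule AE_cnj_circle)
  then show ?thesis by (auto simp: Linf_def)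
qed

lemma rep_flip: "AE z in circle. rep_l2 (flip_op f) z = rep_l2 f (cnj z)"
  using rep_abs_l2[OF sq_integrable_flip[OF rep_l2_sq_integrable], of f]
    abs_l2_eqs(5)[OF rep_l2_sq_integrable, of f] by simp

lemma l2_cinner_add_right: "l2_cinner f (g + h) = l2_cinner f g + l2_cinner f h"
  by (metis l2_cinner_commute l2_cinner_add_left complex_cnj_add)

lemma l2_cinner_scaleC_right: "l2_cinner f (l2_scaleC c g) = cnj c * l2_cinner f g"
  by (metis l2_cinner_commute l2_cinner_scaleC_left complex_cnj_mult)

lemma l2_cinner_minus_left: "l2_cinner (f - g) h = l2_cinner f h - l2_cinner g h"
  by (simp add: minus_l2_scaleC l2_cinner_add_left l2_cinner_scaleC_left)

lemma l2_cinner_minus_right: "l2_cinner h (f - g) = l2_cinner h f - l2_cinner h g"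
  by (simp add: minus_l2_scaleC l2_cinner_add_right l2_cinner_scaleC_right)

lemma l2_cinner_zero [simp]: "l2_cinner 0 f = 0" "l2_cinner f 0 = 0"
  using l2_cinner_scaleC_left[of 0 0 f] l2_cinner_scaleC_right[of f 0 0] by simp_all

lemma cinner_self: "l2_cinner f f = of_real ((norm f)\<^sup>2)"
proof -
  have "Im (l2_cinner f f) = 0" using arg_cong[OF l2_cinner_commute[of f f], of Im] by simp
  then show ?thesis by (simp add: complex_eq_iff power2_norm_eq_inner inner_l2_def)
qed

lemma norm_rep: "(norm f)\<^sup>2 = (LINT z|circle. (cmod (rep_l2 f z))\<^sup>2)"
  using Re_l2_cinner_self[OF rep_l2_sq_integrable, of f]
  by (simp add: power2_norm_eq_inner[of f] inner_l2_def l2_cinner_rep)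

lemma norm_l2_cong:
  assumes "AE z in circle. cmod (rep_l2 f z) = cmod (rep_l2 g z)"
  shows "norm f = norm g"
proof -
  have "(norm f)\<^sup>2 = (norm g)\<^sup>2" unfolding norm_rep
  proof (rule integral_cong_AE)
    show "AE z in circle. (cmod (rep_l2 f z))\<^sup>2 = (cmod (rep_l2 g z))\<^sup>2" using assms by eventually_elim simp
  qed simp_all
  then show ?thesis by (simp add: power2_eq_iff_nonneg)
qed

lemma norm_abs_l2: "f \<in> sq_integrable \<Longrightarrow> (norm (abs_l2 f))\<^sup>2 = (LINT z|circle. (cmod (f z))\<^sup>2)"
  using Re_l2_cinner_self[of f]
  by (simp add: power2_norm_eq_inner[of "abs_l2 f"] inner_l2_def abs_l2_eqs)

lemma l2_scaleC_zero_left [simp]: "l2_scaleC 0 f = 0"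
  using l2_scaleC_simps(2)[of 0 0 f] by simp

lemma norm_scaleC: "norm (l2_scaleC c f) = cmod c * norm f"
proof -
  have "complex_of_real ((norm (l2_scaleC c f))\<^sup>2) = of_real ((cmod c * norm f)\<^sup>2)"
    unfolding cinner_self[symmetric] l2_cinner_scaleC_left l2_cinner_scaleC_right
    by (simp add: cinner_self power_mult_distrib complex_norm_square[unfolded of_real_power] mult.assoc[symmetric] mult.commute)
  then show ?thesis by (simp only: of_real_eq_iff power2_eq_iff_nonneg norm_ge_zero mult_nonneg_nonneg)
qed

lemma norm_cinner_le: "cmod (l2_cinner f g) \<le> norm f * norm g"
proof (cases "l2_cinner f g = 0")
  case False
  define c where "c = cnj (l2_cinner f g) / cmod (l2_cinner f g)"
  have c: "cmod c = 1" using False by (simp add: c_def norm_divide)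
  have "c * l2_cinner f g = cmod (l2_cinner f g)"
    using False by (simp add: c_def complex_norm_square[symmetric] mult.commute power2_eq_square)
  then have "l2_cinner (l2_scaleC c f) g = cmod (l2_cinner f g)" by (simp add: l2_cinner_scaleC_left)
  then have "cmod (l2_cinner f g) = inner (l2_scaleC c f) g" by (simp add: inner_l2_def)
  also have "\<dots> \<le> norm (l2_scaleC c f) * norm g" by (rule norm_cauchy_schwarz)
  finally show ?thesis by (simp add: norm_scaleC c)
qed simp

lemma scaleR_scaleC: "r *\<^sub>R f = l2_scaleC (of_real r) f" by (rule scaleR_l2_def)

lemma scaleC_minus_right: "l2_scaleC c (f - g) = l2_scaleC c f - l2_scaleC c g"
  by (simp add: minus_l2_scaleC l2_scaleC_simps mult.commute)

lemma bounded_linear_cinner_left: "bounded_linear (\<lambda>f. l2_cinner f g)"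
  by (rule bounded_linear_intro[where K="norm g"])
    (simp_all add: l2_cinner_add_left scaleR_scaleC l2_cinner_scaleC_left scaleR_conv_of_real norm_cinner_le)

lemma bounded_linear_scaleC: "bounded_linear (l2_scaleC c)"
  by (rule bounded_linear_intro[where K="cmod c"])
    (simp_all add: l2_scaleC_simps scaleR_scaleC norm_scaleC mult.commute)

lemma L1_norm_le:
  shows "integrable circle (\<lambda>z. cmod (rep_l2 f z))" "(LINT z|circle. cmod (rep_l2 f z)) \<le> norm f"
proof -
  show 1: "integrable circle (\<lambda>z. cmod (rep_l2 f z))" by (simp add: sq_integrable_integrable)
  define a where "a = (\<lambda>z. complex_of_real (cmod (rep_l2 f z)))"
  have a: "a \<in> sq_integrable" using rep_l2_sq_integrable[of f] by (auto simp: a_def sq_integrable_def)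
  have na: "norm (abs_l2 a) = norm f"
    by (rule power2_eq_imp_eq, unfold norm_abs_l2[OF a] norm_rep[of f]) (simp_all add: a_def)
  have n1: "norm (abs_l2 (\<lambda>_. 1)) = 1"
    by (rule power2_eq_imp_eq) (simp_all add: norm_abs_l2[OF one_sq_integrable])
  have "l2_cinner (abs_l2 a) (abs_l2 (\<lambda>_. 1)) = of_real (LINT z|circle. cmod (rep_l2 f z))"
    unfolding abs_l2_eqs(3)[OF a one_sq_integrable] by (simp add: a_def)
  then have "\<bar>LINT z|circle. cmod (rep_l2 f z)\<bar> \<le> norm f"
    using norm_cinner_le[of "abs_l2 a" "abs_l2 (\<lambda>_. 1)"] by (simp add: na n1)
  then show "(LINT z|circle. cmod (rep_l2 f z)) \<le> norm f" by simp
qed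

lemma nn_integral_norm_l2:
  "f \<in> sq_integrable \<Longrightarrow> (\<integral>\<^sup>+z. ennreal ((cmod (f z))\<^sup>2) \<partial>circle) = ennreal ((norm (abs_l2 f))\<^sup>2)"
  unfolding norm_abs_l2 by (intro nn_integral_eq_integral) (auto simp: sq_integrable_def)

text \<open>The Riesz-Fischer argument: along a rapidly converging subsequence the sum of the successive
  differences is integrable, so the subsequence converges almost everywhere; Fatou's lemma then bounds
  the distance from the pointwise limit to the members of the sequence.\<close>

lemma l2_complete:
  assumes X: "Cauchy (X :: nat \<Rightarrow> l2)"
  shows "convergent X"
proof -
  have "\<forall>k. \<exists>N. \<forall>i\<ge>N. \<forall>j\<ge>N. dist (X i) (X j) < (1/2) ^ k"
    using X by (auto simp: Cauchy_def)
  then obtain N where N: "\<And>k i j. i \<ge> N k \<Longrightarrow> j \<ge> N k \<Longrightarrow> dist (X i) (X j) < (1/2) ^ k" by metis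
  \<comment> \<open>a subsequence with geometrically decreasing steps; summing makes the indices monotone\<close>
  define s where "s k = (\<Sum>i\<le>k. N i)" for k
  have s_mono: "s k \<le> s j" if "k \<le> j" for k j unfolding s_def using that by (intro sum_mono2) auto
  have s_N: "s j \<ge> N k" if "k \<le> j" for k j unfolding s_def using that by (intro member_le_sum) auto
  define f where "f k = rep_l2 (X (s k))" for k
  have f_sq: "f k \<in> sq_integrable" for k by (simp add: f_def)
  have [measurable]: "f k \<in> borel_measurable borel" for k by (simp add: f_def)
  have dist: "(\<integral>\<^sup>+z. ennreal ((cmod (f j z - rep_l2 (X n) z))\<^sup>2) \<partial>circle) = ennreal ((dist (X (s j)) (X n))\<^sup>2)" for j n
  proof -
    have "(\<integral>\<^sup>+z. ennreal ((cmod (f j z - rep_l2 (X n) z))\<^sup>2) \<partial>circle) =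
        (\<integral>\<^sup>+z. ennreal ((cmod (rep_l2 (X (s j) - X n) z))\<^sup>2) \<partial>circle)"
    proof (rule nn_integral_cong_AE)
      show "AE z in circle. ennreal ((cmod (f j z - rep_l2 (X n) z))\<^sup>2) = ennreal ((cmod (rep_l2 (X (s j) - X n) z))\<^sup>2)"
        using rep_minus[of "X (s j)" "X n"] by eventually_elim (simp add: f_def)
    qed
    then show ?thesis by (simp add: nn_integral_norm_l2 dist_norm)
  qed
  have step: "(\<integral>\<^sup>+z. ennreal (cmod (f (Suc k) z - f k z)) \<partial>circle) \<le> ennreal ((1/2) ^ k)" for k
  proof -
    let ?g = "X (s (Suc k)) - X (s k)"
    have "(\<integral>\<^sup>+z. ennreal (cmod (f (Suc k) z - f k z)) \<partial>circle) = (\<integral>\<^sup>+z. ennreal (cmod (rep_l2 ?g z)) \<partial>circle)"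
    proof (rule nn_integral_cong_AE)
      show "AE z in circle. ennreal (cmod (f (Suc k) z - f k z)) = ennreal (cmod (rep_l2 ?g z))"
        using rep_minus[of "X (s (Suc k))" "X (s k)"] by eventually_elim (simp add: f_def)
    qed
    also have "\<dots> = ennreal (LINT z|circle. cmod (rep_l2 ?g z))"
      by (intro nn_integral_eq_integral L1_norm_le) simp
    also have "\<dots> \<le> ennreal ((1/2) ^ k)"
      using L1_norm_le(2)[of ?g] N[of k "s (Suc k)" "s k"] s_N[of k k] s_N[of k "Suc k"]
      by (intro ennreal_leI) (simp add: dist_norm)
    finally show ?thesis .
  qed
  have "(\<integral>\<^sup>+z. (\<Sum>k. ennreal (cmod (f (Suc k) z - f k z))) \<partial>circle) =
      (\<Sum>k. \<integral>\<^sup>+z. ennreal (cmod (f (Suc k) z - f k z)) \<partial>circle)"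
    by (intro nn_integral_suminf) measurable
  also have "\<dots> \<le> (\<Sum>k. ennreal ((1/2) ^ k))" by (intro suminf_le step) auto
  also have "\<dots> = ennreal (\<Sum>k. (1/2) ^ k)" by (intro suminf_ennreal2) (auto simp: summable_geometric)
  also have "\<dots> < \<infinity>" by simp
  finally have "AE z in circle. (\<Sum>k. ennreal (cmod (f (Suc k) z - f k z))) \<noteq> \<infinity>"
    by (intro nn_integral_PInf_AE) auto
  then have conv: "AE z in circle. convergent (\<lambda>k. f k z)"
  proof eventually_elim
    case (elim z)
    then have "summable (\<lambda>k. cmod (f (Suc k) z - f k z))" by (intro summable_suminf_not_top) auto
    then have "summable (\<lambda>k. f (Suc k) z - f k z)" by (rule summable_norm_cancel)
    then have "convergent (\<lambda>n. \<Sum>k<n. f (Suc k) z - f k z)" by (simp add: summable_iff_convergent)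
    then have "convergent (\<lambda>n. f n z - f 0 z)" using sum_lessThan_telescope[of "\<lambda>k. f k z"] by simp
    then show ?case by (simp add: convergent_diff_const_right_iff)
  qed
  define F where "F z = lim (\<lambda>k. f k z)" for z
  have [measurable]: "F \<in> borel_measurable borel" unfolding F_def by measurable
  have bound: "(\<integral>\<^sup>+z. ennreal ((cmod (F z - rep_l2 (X n) z))\<^sup>2) \<partial>circle) \<le> ennreal (((1/2) ^ k)\<^sup>2)" if n: "n \<ge> N k" for n k
  proof -
    have "(\<integral>\<^sup>+z. ennreal ((cmod (F z - rep_l2 (X n) z))\<^sup>2) \<partial>circle) =
        (\<integral>\<^sup>+z. liminf (\<lambda>j. ennreal ((cmod (f j z - rep_l2 (X n) z))\<^sup>2)) \<partial>circle)"
      using conv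
    proof (rule nn_integral_cong_AE[OF eventually_mono])
      fix z assume "convergent (\<lambda>k. f k z)"
      then have "(\<lambda>j. f j z) \<longlonglongrightarrow> F z" by (simp add: F_def convergent_LIMSEQ_iff)
      then have "(\<lambda>j. ennreal ((cmod (f j z - rep_l2 (X n) z))\<^sup>2)) \<longlonglongrightarrow> ennreal ((cmod (F z - rep_l2 (X n) z))\<^sup>2)"
        by (intro tendsto_intros)
      then show "ennreal ((cmod (F z - rep_l2 (X n) z))\<^sup>2) = liminf (\<lambda>j. ennreal ((cmod (f j z - rep_l2 (X n) z))\<^sup>2))"
        by (intro lim_imp_Liminf[symmetric]) simp_all
    qed
    also have "\<dots> \<le> liminf (\<lambda>j. \<integral>\<^sup>+z. ennreal ((cmod (f j z - rep_l2 (X n) z))\<^sup>2) \<partial>circle)"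
      by (intro nn_integral_liminf) measurable
    also have "\<dots> = liminf (\<lambda>j. ennreal ((dist (X (s j)) (X n))\<^sup>2))" by (simp only: dist)
    also have "\<dots> \<le> limsup (\<lambda>j. ennreal ((dist (X (s j)) (X n))\<^sup>2))" by (intro Liminf_le_Limsup) simp
    also have "\<dots> \<le> ennreal (((1/2) ^ k)\<^sup>2)"
    proof (rule Limsup_bounded)
      show "\<forall>\<^sub>F j in sequentially. ennreal ((dist (X (s j)) (X n))\<^sup>2) \<le> ennreal (((1/2) ^ k)\<^sup>2)"
        using eventually_ge_at_top[of k]
      proof eventually_elim
        case (elim j)
        show ?case using N[of k "s j" n] n s_N[OF elim] by (intro ennreal_leI power_mono) simp_all
      qed
    qed
    finally show ?thesis .
  qed
  have diff_sq: "(\<lambda>z. F z - rep_l2 (X n) z) \<in> sq_integrable" if "n \<ge> N k" for n k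
    unfolding sq_integrable_def using bound[OF that]
    by (auto intro!: integrableI_bounded order.strict_trans1[OF bound[OF that]])
  have "(\<lambda>z. (F z - rep_l2 (X (N 0)) z) + rep_l2 (X (N 0)) z) \<in> sq_integrable"
    by (intro sq_integrable_add diff_sq[of 0]) simp_all
  then have F: "F \<in> sq_integrable" by simp
  have "X \<longlonglongrightarrow> abs_l2 F"
  proof (rule metric_LIMSEQ_I)
    fix e :: real assume "e > 0"
    then obtain k where k: "(1/2) ^ k < e" using real_arch_pow_inv[of e "1/2"] by auto
    have "dist (X n) (abs_l2 F) < e" if n: "n \<ge> N k" for n
    proof -
      have "abs_l2 F - X n = abs_l2 (\<lambda>z. F z - rep_l2 (X n) z)"
      proof (rule l2_eqI)
        show "AE z in circle. rep_l2 (abs_l2 F - X n) z = rep_l2 (abs_l2 (\<lambda>z. F z - rep_l2 (X n) z)) z"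
          using rep_minus[of "abs_l2 F" "X n"] rep_abs_l2[OF F] rep_abs_l2[OF diff_sq[OF n]]
          by eventually_elim simp
      qed
      then have "ennreal ((norm (abs_l2 F - X n))\<^sup>2) \<le> ennreal (((1/2) ^ k)\<^sup>2)"
        using bound[OF n] by (simp add: nn_integral_norm_l2[OF diff_sq[OF n]])
      then have "norm (abs_l2 F - X n) \<le> (1/2) ^ k" by (simp add: abs_le_square_iff[symmetric] del: power_one_over)
      then show ?thesis using k by (simp add: dist_norm norm_minus_commute)
    qed
    then show "\<exists>no. \<forall>n\<ge>no. dist (X n) (abs_l2 F) < e" by blast
  qed
  then show ?thesis by (rule convergentI)
qed

instance l2 :: banach
  by standard (rule l2_complete)


section \<open>Trigonometric monomials\<close>

lemma circle_integral_parametrized: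
  fixes f :: "complex \<Rightarrow> 'a::{banach, second_countable_topology}"
  assumes [measurable]: "f \<in> borel_measurable borel"
  shows "(LINT z|circle. f z) = (1 / (2 * pi)) *\<^sub>R (LINT t:{0..2*pi}|lborel. f (cis t))"
proof -
  have d: "uniform_measure lborel {0..2 * pi} =
      density lborel (\<lambda>t::real. ennreal (indicator {0..2*pi} t / (2 * pi)))"
  proof -
    have *: "ennreal 1 / ennreal (2 * pi) = ennreal (1 / (2 * pi))"
      by (rule divide_ennreal) simp_all
    have e: "emeasure lborel {0..2 * pi} = ennreal (2 * pi)" by simp
    show ?thesis unfolding uniform_measure_def
    proof (rule density_cong)
      show "AE t in lborel. indicator {0..2*pi} t / emeasure lborel {0..2 * pi} = ennreal (indicator {0..2*pi} t / (2 * pi))"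
        unfolding e using * by (intro AE_I2) (simp add: indicator_def)
    qed simp_all
  qed
  have "(LINT z|circle. f z) = (LINT t|uniform_measure lborel {0..2 * pi}. f (cis t))"
    unfolding circle_def by (subst integral_distr) simp_all
  also have "\<dots> = (LINT t|lborel. (indicator {0..2*pi} t / (2 * pi)) *\<^sub>R f (cis t))"
    unfolding d by (subst integral_density) simp_all
  also have "\<dots> = (LINT t|lborel. (1 / (2 * pi)) *\<^sub>R (indicator {0..2*pi} t *\<^sub>R f (cis t)))"
    by (intro Bochner_Integration.integral_cong) auto
  also have "\<dots> = (1 / (2 * pi)) *\<^sub>R (LINT t:{0..2*pi}|lborel. f (cis t))"
    unfolding set_lebesgue_integral_def by (rule integral_scaleR_right)
  finally show ?thesis .
qed

lemma circle_integral_powi: "(LINT z|circle. z powi n) = of_bool (n = 0)"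
proof (cases "n = 0")
  case True
  then show ?thesis by simp
next
  case False
  have cont: "continuous_on {0..2*pi} (\<lambda>t. cis t powi n)"
    by (intro continuous_intros) auto
  have "((\<lambda>t. cis t powi n) has_integral (cis (of_int n * (2*pi)) / (\<i> * of_int n) - cis (of_int n * 0) / (\<i> * of_int n))) {0..2*pi}"
  proof (rule fundamental_theorem_of_calculus)
    show "((\<lambda>t. cis (of_int n * t) / (\<i> * of_int n)) has_vector_derivative cis t powi n) (at t within {0..2*pi})" for t
    proof -
      have "((\<lambda>w. exp (\<i> * of_int n * w) / (\<i> * of_int n)) has_field_derivative exp (\<i> * of_int n * of_real t)) (at (of_real t))"
        using False by (auto intro!: derivative_eq_intros)
      from has_vector_derivative_real_field[OF this] show ?thesis
        unfolding cis_power_int by (simp add: cis_conv_exp mult_ac)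
    qed
  qed simp
  moreover have "cis (of_int n * (2*pi)) = 1"
  proof -
    have "cis (2 * pi * of_int n) = 1" by (rule cis_multiple_2pi) (rule Ints_of_int)
    then show ?thesis by (subst mult.commute)
  qed
  ultimately have "((\<lambda>t. cis t powi n) has_integral 0) {0..2*pi}" by simp
  moreover have "set_integrable lborel {0..2*pi} (\<lambda>t. cis t powi n)"
    by (rule borel_integrable_atLeastAtMost'[OF cont])
  ultimately have "(LINT t:{0..2*pi}|lborel. cis t powi n) = 0"
    by (simp add: set_borel_integral_eq_integral(2) integral_unique)
  then show ?thesis using False by (simp add: circle_integral_parametrized)
qed

definition zpow :: "int \<Rightarrow> l2" where
  "zpow n = abs_l2 (\<lambda>z. z powi n)"

lemma rep_zpow: "AE z in circle. rep_l2 (zpow n) z = z powi n"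
  unfolding zpow_def by (intro rep_abs_l2 Linf_sq_integrable powi_Linf)

lemma cinner_zpow_right: "l2_cinner f (zpow n) = fourier f n"
proof -
  have "AE z in circle. cnj (rep_l2 (zpow n) z) = z powi (- n)"
    using rep_zpow[of n] AE_circle_norm by eventually_elim (simp only: cnj_powi_circle)
  then have "AE z in circle. rep_l2 f z * cnj (rep_l2 (zpow n) z) = rep_l2 f z * z powi (- n)"
    by eventually_elim simp
  then show ?thesis unfolding l2_cinner_rep fourier_rep
    by (intro integral_cong_AE) simp_all
qed

lemma fourier_zpow: "fourier (zpow m) n = of_bool (m = n)"
proof -
  have "fourier (zpow m) n = (LINT z|circle. z powi m * z powi (- n))"
    unfolding zpow_def using Linf_sq_integrable[OF powi_Linf] by (simp add: abs_l2_eqs)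
  also have "\<dots> = (LINT z|circle. z powi (m - n))"
  proof (rule integral_cong_AE)
    show "AE z in circle. z powi m * z powi (- n) = z powi (m - n)"
      using AE_circle_norm
    proof eventually_elim
      case (elim z)
      then have "z \<noteq> 0" by auto
      then show ?case using power_int_add[of z m "- n"] by simp
    qed
  qed simp_all
  finally show ?thesis by (simp add: circle_integral_powi)
qed

lemma norm_zpow [simp]: "norm (zpow n) = 1"
proof -
  have "complex_of_real ((norm (zpow n))\<^sup>2) = 1"
    by (simp only: cinner_self[symmetric] cinner_zpow_right fourier_zpow) simp
  then have "(norm (zpow n))\<^sup>2 = 1" by (simp only: of_real_eq_1_iff)
  then show ?thesis by (rule power2_eq_imp_eq[where y=1, simplified]) simp
qed

lemma integrable_mult_powi_eq_zero:
  assumes "integrable circle f" "\<And>n::int. (LINT z|circle. f z * z powi n) = 0"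
  shows "AE z in circle. f z = 0"
  using assms by (intro fourier_null_AE_zero) (auto simp: fourier_null_def)

lemma fourier_minus: "fourier (f - g) n = fourier f n - fourier g n"
  by (simp add: minus_l2_scaleC fourier_add fourier_scaleC)

lemma fourier_zero [simp]: "fourier 0 n = 0"
  using fourier_scaleC[of 0 0] by simp

lemma fourier_eqI:
  assumes "\<And>n. fourier f n = fourier g n" shows "f = g"
proof -
  have "(LINT z|circle. rep_l2 (f - g) z * z powi n) = 0" for n
    using fourier_rep[of "f - g" "- n"] assms[of "- n"] by (simp add: fourier_minus)
  then have "AE z in circle. rep_l2 (f - g) z = 0"
    by (intro integrable_mult_powi_eq_zero) (simp_all add: sq_integrable_integrable)
  then have "AE z in circle. rep_l2 f z = rep_l2 g z" using rep_minus[of f g] by eventually_elim simp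
  then show ?thesis by (rule l2_eqI)
qed

lemma bounded_linear_fourier: "bounded_linear (\<lambda>f. fourier f n)"
  using bounded_linear_cinner_left[of "zpow n"] by (simp add: cinner_zpow_right)

definition csubspace :: "l2 set \<Rightarrow> bool" where
  "csubspace M \<longleftrightarrow> 0 \<in> M \<and> (\<forall>f\<in>M. \<forall>g\<in>M. f + g \<in> M) \<and> (\<forall>c. \<forall>f\<in>M. l2_scaleC c f \<in> M)"

lemma csubspace_subspace: "csubspace M \<Longrightarrow> subspace M"
  by (auto simp: csubspace_def subspace_def scaleR_scaleC)

lemma csubspace_Int: "csubspace M \<Longrightarrow> csubspace N \<Longrightarrow> csubspace (M \<inter> N)"
  by (auto simp: csubspace_def)

lemma csubspace_diff: "csubspace M \<Longrightarrow> f \<in> M \<Longrightarrow> g \<in> M \<Longrightarrow> f - g \<in> M"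
  by (auto simp: csubspace_def minus_l2_scaleC)

text \<open>Real orthogonality to \<open>v\<close> and to \<open>\<i> v\<close> together is complex orthogonality.\<close>

lemma complex_projection:
  assumes M: "csubspace M" "closed M"
  obtains m where "m \<in> M" "\<And>v. v \<in> M \<Longrightarrow> l2_cinner (f - m) v = 0"
proof -
  have "complete M" using M(2) by (simp add: complete_eq_closed)
  from orthogonal_projection_exists[OF csubspace_subspace[OF M(1)] this, of f] obtain m
    where m: "m \<in> M" "\<And>v. v \<in> M \<Longrightarrow> inner (f - m) v = 0" by blast
  have "l2_cinner (f - m) v = 0" if "v \<in> M" for v
  proof -
    have "l2_scaleC \<i> v \<in> M" using that M(1) by (simp add: csubspace_def)
    from m(2)[OF this] m(2)[OF that] show ?thesis
      by (simp add: inner_l2_def l2_cinner_scaleC_right complex_eq_iff)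
  qed
  with m(1) show thesis using that by blast
qed

lemma H2_iff: "f \<in> H2 \<longleftrightarrow> (\<forall>n<0. fourier f n = 0)"
  unfolding H2_def using type_definition.Rep_range[OF type_definition_h2] by auto

lemma to_l2_in_H2 [simp]: "to_l2 f \<in> H2" by (simp add: H2_def)

lemma to_l2_of_l2: "f \<in> H2 \<Longrightarrow> to_l2 (of_l2 f) = f"
  by (simp add: H2_iff of_l2_inverse)

lemma csubspace_H2: "csubspace H2"
  by (simp add: csubspace_def H2_iff fourier_add fourier_scaleC)

lemma closed_H2: "closed H2"
proof -
  have "closed {f. fourier f n = 0}" for n
    by (intro closed_Collect_eq continuous_intros linear_continuous_on bounded_linear_fourier)
  then have "closed (\<Inter>n\<in>{..<0}. {f. fourier f n = 0})" by (intro closed_INT ballI)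
  moreover have "(\<Inter>n\<in>{..<0}. {f. fourier f n = 0}) = H2" by (auto simp: H2_iff)
  ultimately show ?thesis by simp
qed

lemma zpow_in_H2: "n \<ge> 0 \<Longrightarrow> zpow n \<in> H2"
  by (simp add: H2_iff fourier_zpow)

text \<open>The difference of \<open>f\<close> and its projection to \<open>M\<close> is orthogonal to all monomials, so it has vanishing
  Fourier coefficients. This and the next lemma replace explicit approximation by polynomials: an
  identity between continuous linear expressions need only be checked on monomials.\<close>

lemma l2_dense:
  assumes "csubspace M" "closed M" "\<And>n. zpow n \<in> M"
  shows "f \<in> M"
proof -
  obtain m where m: "m \<in> M" "\<And>v. v \<in> M \<Longrightarrow> l2_cinner (f - m) v = 0"
    using complex_projection[OF assms(1,2)] by blast
  have "f = m" using m(2)[OF assms(3)] by (intro fourier_eqI) (simp add: cinner_zpow_right fourier_minus)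
  with m(1) show ?thesis by simp
qed

lemma H2_dense:
  assumes "csubspace M" "closed M" "\<And>n. n \<ge> 0 \<Longrightarrow> zpow n \<in> M" "f \<in> H2"
  shows "f \<in> M"
proof -
  obtain m where m: "m \<in> M \<inter> H2" "\<And>v. v \<in> M \<inter> H2 \<Longrightarrow> l2_cinner (f - m) v = 0"
    using complex_projection[of "M \<inter> H2"] csubspace_Int csubspace_H2 closed_H2 assms(1,2) closed_Int by metis
  have "f = m"
  proof (rule fourier_eqI)
    fix n :: int
    show "fourier f n = fourier m n"
    proof (cases "n \<ge> 0")
      case True
      then show ?thesis using m(2)[of "zpow n"] assms(3) zpow_in_H2[of n] by (simp add: cinner_zpow_right fourier_minus)
    next
      case False
      then show ?thesis using m(1) assms(4) by (simp add: H2_iff)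
    qed
  qed
  with m(1) show ?thesis by simp
qed


section \<open>Multiplication and flip\<close>

lemma mult_op_plus: "mult_op \<phi> (f + g) = mult_op \<phi> f + mult_op \<phi> g"
proof (cases "\<phi> \<in> Linf")
  case True
  show ?thesis
    by (rule l2_eqI, use rep_mult[OF True, of "f + g"] rep_mult[OF True, of f] rep_mult[OF True, of g] rep_plus[of f g] rep_plus[of "mult_op \<phi> f" "mult_op \<phi> g"]
    in \<open>eventually_elim, simp add: algebra_simps\<close>)
next
  case False
  then have "mult_op \<phi> h = 0" for h
    using abs_l2_eqs(6)[OF rep_l2_sq_integrable, of \<phi> h] by (simp add: zero_l2_def)
  then show ?thesis by simp
qed

lemma mult_op_scaleC: "mult_op \<phi> (l2_scaleC c f) = l2_scaleC c (mult_op \<phi> f)"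
proof (cases "\<phi> \<in> Linf")
  case True
  show ?thesis
    by (rule l2_eqI, use rep_mult[OF True, of "l2_scaleC c f"] rep_mult[OF True, of f] rep_scaleC[of c f] rep_scaleC[of c "mult_op \<phi> f"]
    in \<open>eventually_elim, simp add: algebra_simps\<close>)
next
  case False
  then have "mult_op \<phi> h = 0" for h
    using abs_l2_eqs(6)[OF rep_l2_sq_integrable, of \<phi> h] by (simp add: zero_l2_def)
  then show ?thesis by simp
qed

lemma mult_op_minus: "mult_op \<phi> (f - g) = mult_op \<phi> f - mult_op \<phi> g"
  by (simp add: minus_l2_scaleC mult_op_plus mult_op_scaleC)

lemma mult_op_zero [simp]: "mult_op \<phi> 0 = 0"
  using mult_op_scaleC[of \<phi> 0 0] by simp

lemma mult_op_mult:
  assumes "\<phi> \<in> Linf" "\<psi> \<in> Linf"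
  shows "mult_op \<phi> (mult_op \<psi> f) = mult_op (\<lambda>z. \<phi> z * \<psi> z) f"
  by (rule l2_eqI, use rep_mult[OF assms(1), of "mult_op \<psi> f"] rep_mult[OF assms(2), of f] rep_mult[OF Linf_mult[OF assms], of f]
    in \<open>eventually_elim, simp\<close>)

lemma mult_op_cong:
  assumes "\<phi> \<in> Linf" "\<psi> \<in> Linf" "AE z in circle. \<phi> z = \<psi> z"
  shows "mult_op \<phi> f = mult_op \<psi> f"
  by (rule l2_eqI, use rep_mult[OF assms(1), of f] rep_mult[OF assms(2), of f] assms(3)
    in \<open>eventually_elim, simp\<close>)

lemma mult_op_1 [simp]: "mult_op (\<lambda>_. 1) f = f"
proof (rule l2_eqI)
  show "AE z in circle. rep_l2 (mult_op (\<lambda>_. 1) f) z = rep_l2 f z"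
    using rep_mult[OF Linf_1, of f] by simp
qed

lemma mult_op_diff:
  assumes "\<phi> \<in> Linf" "\<psi> \<in> Linf"
  shows "mult_op (\<lambda>z. \<phi> z - \<psi> z) f = mult_op \<phi> f - mult_op \<psi> f"
  by (rule l2_eqI, use rep_mult[OF assms(1), of f] rep_mult[OF assms(2), of f] rep_mult[OF Linf_diff[OF assms], of f] rep_minus[of "mult_op \<phi> f" "mult_op \<psi> f"]
    in \<open>eventually_elim, simp add: left_diff_distrib\<close>)

lemma cinner_mult_left:
  assumes "\<phi> \<in> Linf"
  shows "l2_cinner (mult_op \<phi> f) g = (LINT z|circle. \<phi> z * rep_l2 f z * cnj (rep_l2 g z))"
proof -
  have [measurable]: "\<phi> \<in> borel_measurable borel" using assms by (auto simp: Linf_def)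
  have "AE z in circle. rep_l2 (mult_op \<phi> f) z * cnj (rep_l2 g z) = \<phi> z * rep_l2 f z * cnj (rep_l2 g z)"
    using rep_mult[OF assms, of f] by eventually_elim simp
  then show ?thesis unfolding l2_cinner_rep by (intro integral_cong_AE) simp_all
qed

lemma mult_op_adjoint:
  assumes "\<phi> \<in> Linf"
  shows "l2_cinner (mult_op \<phi> f) g = l2_cinner f (mult_op (\<lambda>z. cnj (\<phi> z)) g)"
proof -
  have "l2_cinner f (mult_op (\<lambda>z. cnj (\<phi> z)) g) = cnj (l2_cinner (mult_op (\<lambda>z. cnj (\<phi> z)) g) f)"
    by (rule l2_cinner_commute)
  also have "\<dots> = l2_cinner (mult_op \<phi> f) g"
    unfolding cinner_mult_left[OF assms] cinner_mult_left[OF Linf_cnj[OF assms]]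
    by (subst Bochner_Integration.integral_cnj[symmetric]) (simp add: mult_ac)
  finally show ?thesis by simp
qed

text \<open>The bound \<open>C\<close> is nonnegative because the circle has positive measure.\<close>

lemma norm_mult_op_le:
  assumes "\<phi> \<in> Linf" "AE z in circle. cmod (\<phi> z) \<le> C"
  shows "norm (mult_op \<phi> f) \<le> C * norm f"
proof -
  have "\<exists>z. cmod (\<phi> z) \<le> C"
  proof (rule ccontr)
    assume "\<nexists>z. cmod (\<phi> z) \<le> C"
    with assms(2) have "AE z in circle. False" by simp
    then have "emeasure circle (space circle) = 0"
      unfolding eventually_False ae_filter_eq_bot_iff .
    then show False using emeasure_circle_UNIV by simp
  qed
  then have C: "C \<ge> 0" by (meson norm_ge_zero order_trans)
  have [measurable]: "\<phi> \<in> borel_measurable borel" using assms by (auto simp: Linf_def)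
  have "(norm (mult_op \<phi> f))\<^sup>2 = (LINT z|circle. (cmod (rep_l2 (mult_op \<phi> f) z))\<^sup>2)" by (rule norm_rep)
  also have "\<dots> \<le> (LINT z|circle. C\<^sup>2 * (cmod (rep_l2 f z))\<^sup>2)"
  proof (rule integral_mono_AE)
    show "AE z in circle. (cmod (rep_l2 (mult_op \<phi> f) z))\<^sup>2 \<le> C\<^sup>2 * (cmod (rep_l2 f z))\<^sup>2"
      using rep_mult[OF assms(1), of f] assms(2)
    proof eventually_elim
      case (elim z)
      then have "(cmod (\<phi> z))\<^sup>2 \<le> C\<^sup>2" by (intro power_mono) simp_all
      then show ?case unfolding elim(1) norm_mult power_mult_distrib by (rule mult_right_mono) simp
    qed
  next
    show "integrable circle (\<lambda>z. (cmod (rep_l2 (mult_op \<phi> f) z))\<^sup>2)" "integrable circle (\<lambda>z. C\<^sup>2 * (cmod (rep_l2 f z))\<^sup>2)"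
      using rep_l2_sq_integrable[of "mult_op \<phi> f"] rep_l2_sq_integrable[of f] unfolding sq_integrable_def by simp_all
  qed
  also have "\<dots> = (C * norm f)\<^sup>2" by (simp add: norm_rep power_mult_distrib)
  finally show ?thesis by (rule power2_le_imp_le) (simp add: C)
qed

lemma bounded_linear_mult_op: "\<phi> \<in> Linf \<Longrightarrow> bounded_linear (mult_op \<phi>)"
proof -
  assume \<phi>: "\<phi> \<in> Linf"
  then obtain C where "AE z in circle. cmod (\<phi> z) \<le> C" by (auto simp: Linf_def)
  then have "norm (mult_op \<phi> f) \<le> norm f * C" for f
    by (subst mult.commute) (rule norm_mult_op_le[OF \<phi>])
  then show ?thesis
    by (intro bounded_linear_intro[where K=C]) (simp_all add: mult_op_plus scaleR_scaleC mult_op_scaleC)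
qed

lemma flip_op_plus: "flip_op (f + g) = flip_op f + flip_op g"
proof (rule l2_eqI)
  have "AE z in circle. rep_l2 (f + g) (cnj z) = rep_l2 f (cnj z) + rep_l2 g (cnj z)"
    by (rule AE_cnj_circle[OF rep_plus])
  then show "AE z in circle. rep_l2 (flip_op (f + g)) z = rep_l2 (flip_op f + flip_op g) z"
    using rep_flip[of "f + g"] rep_flip[of f] rep_flip[of g] rep_plus[of "flip_op f" "flip_op g"]
    by eventually_elim simp
qed

lemma flip_op_scaleC: "flip_op (l2_scaleC c f) = l2_scaleC c (flip_op f)"
proof (rule l2_eqI)
  have "AE z in circle. rep_l2 (l2_scaleC c f) (cnj z) = c * rep_l2 f (cnj z)"
    by (rule AE_cnj_circle[OF rep_scaleC])
  then show "AE z in circle. rep_l2 (flip_op (l2_scaleC c f)) z = rep_l2 (l2_scaleC c (flip_op f)) z"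
    using rep_flip[of "l2_scaleC c f"] rep_flip[of f] rep_scaleC[of c "flip_op f"]
    by eventually_elim simp
qed

lemma norm_flip [simp]: "norm (flip_op f) = norm f"
proof -
  have "(norm (flip_op f))\<^sup>2 = (LINT z|circle. (cmod (rep_l2 (flip_op f) z))\<^sup>2)" by (rule norm_rep)
  also have "\<dots> = (LINT z|circle. (cmod (rep_l2 f (cnj z)))\<^sup>2)"
  proof (rule integral_cong_AE)
    show "AE z in circle. (cmod (rep_l2 (flip_op f) z))\<^sup>2 = (cmod (rep_l2 f (cnj z)))\<^sup>2"
      using rep_flip[of f] by eventually_elim simp
  qed simp_all
  also have "\<dots> = (norm f)\<^sup>2" unfolding norm_rep by (rule integral_cnj_circle[of "\<lambda>z. (cmod (rep_l2 f z))\<^sup>2"]) measurable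
  finally show ?thesis by (simp add: power2_eq_iff_nonneg)
qed

lemma bounded_linear_flip: "bounded_linear flip_op"
  by (rule bounded_linear_intro[where K=1]) (simp_all add: flip_op_plus scaleR_scaleC flip_op_scaleC)

lemma flip_mult_op:
  assumes "\<phi> \<in> Linf"
  shows "flip_op (mult_op \<phi> f) = mult_op (\<lambda>z. \<phi> (cnj z)) (flip_op f)"
proof (rule l2_eqI)
  have [measurable]: "\<phi> \<in> borel_measurable borel" using assms by (auto simp: Linf_def)
  have "AE z in circle. rep_l2 (mult_op \<phi> f) (cnj z) = \<phi> (cnj z) * rep_l2 f (cnj z)"
    by (rule AE_cnj_circle[OF rep_mult[OF assms]])
  then show "AE z in circle. rep_l2 (flip_op (mult_op \<phi> f)) z = rep_l2 (mult_op (\<lambda>z. \<phi> (cnj z)) (flip_op f)) z"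
    using rep_flip[of "mult_op \<phi> f"] rep_flip[of f] rep_mult[OF Linf_flip[OF assms], of "flip_op f"]
    by eventually_elim simp
qed

lemma mult_op_powi_zpow: "mult_op (\<lambda>z. z powi m) (zpow n) = zpow (m + n)"
proof (rule l2_eqI)
  show "AE z in circle. rep_l2 (mult_op (\<lambda>z. z powi m) (zpow n)) z = rep_l2 (zpow (m + n)) z"
    using rep_mult[OF powi_Linf, of m "zpow n"] rep_zpow[of n] rep_zpow[of "m + n"] AE_circle_norm
  proof eventually_elim
    case (elim z)
    then have "z \<noteq> 0" by auto
    with elim show ?case by (simp add: power_int_add)
  qed
qed

lemma cnj_powi_mult_op: "mult_op (\<lambda>z. cnj (z powi m)) f = mult_op (\<lambda>z. z powi (- m)) f"
  by (rule mult_op_cong[OF Linf_cnj[OF powi_Linf] powi_Linf])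
    (use AE_circle_norm in \<open>eventually_elim, simp only: cnj_powi_circle\<close>)

text \<open>Multiplication by \<open>z\<^sup>m\<close> shifts the coefficients; most identities between operators below are checked
  on coefficients with this rule.\<close>

lemma fourier_mult_powi: "fourier (mult_op (\<lambda>z. z powi m) f) n = fourier f (n - m)"
  unfolding cinner_zpow_right[symmetric] mult_op_adjoint[OF powi_Linf]
  by (simp only: cnj_powi_mult_op mult_op_powi_zpow) (simp add: algebra_simps)

lemma mult_op_powi_powi: "mult_op (\<lambda>z. z powi m) (mult_op (\<lambda>z. z powi n) f) = mult_op (\<lambda>z. z powi (m + n)) f"
  by (rule fourier_eqI) (simp add: fourier_mult_powi algebra_simps)

lemma norm_mult_unimodular:
  assumes "\<phi> \<in> Linf" "AE z in circle. cmod (\<phi> z) = 1"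
  shows "norm (mult_op \<phi> f) = norm f"
  by (rule norm_l2_cong, use rep_mult[OF assms(1), of f] assms(2) in \<open>eventually_elim, simp add: norm_mult\<close>)

lemma norm_mult_powi [simp]: "norm (mult_op (\<lambda>z. z powi m) f) = norm f"
  by (rule norm_mult_unimodular[OF powi_Linf]) (use AE_circle_norm in \<open>eventually_elim, simp add: norm_power_int\<close>)

lemma fourier_flip: "fourier (flip_op f) n = fourier f (- n)"
proof -
  have "fourier (flip_op f) n = (LINT z|circle. rep_l2 f (cnj z) * (cnj z) powi n)"
    unfolding fourier_rep
  proof (rule integral_cong_AE)
    show "AE z in circle. rep_l2 (flip_op f) z * z powi - n = rep_l2 f (cnj z) * cnj z powi n"
      using rep_flip[of f] AE_circle_norm
      by eventually_elim (simp only: complex_cnj_power_int[symmetric] cnj_powi_circle)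
  qed simp_all
  also have "\<dots> = (LINT z|circle. rep_l2 f z * z powi n)" by (rule integral_cnj_circle[of "\<lambda>z. rep_l2 f z * z powi n"]) measurable
  finally show ?thesis by (simp add: fourier_rep)
qed


section \<open>The Hardy space and its projection\<close>

lemmas to_l2_simps = plus_h2.rep_eq minus_h2.rep_eq zero_h2.rep_eq h2_scaleC.rep_eq scaleR_h2.rep_eq

lemma norm_to_l2: "norm (to_l2 f) = norm f" by (simp add: norm_h2.rep_eq)

lemma to_l2_eq_iff: "to_l2 f = to_l2 g \<longleftrightarrow> f = g" by (rule to_l2_inject)

lemma fourier_to_l2_neg: "n < 0 \<Longrightarrow> fourier (to_l2 f) n = 0"
  using to_l2_in_H2[of f] by (simp add: H2_iff del: to_l2_in_H2)

lemma h2_eqI: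
  assumes "\<And>n. n \<ge> 0 \<Longrightarrow> fourier (to_l2 f) n = fourier (to_l2 g) n" shows "f = g"
proof -
  have "fourier (to_l2 f) n = fourier (to_l2 g) n" for n
    using assms[of n] fourier_to_l2_neg[of n] by (cases "n \<ge> 0") auto
  then show ?thesis using fourier_eqI to_l2_eq_iff by blast
qed

lemma scaleR_h2_scaleC: "r *\<^sub>R f = h2_scaleC (of_real r) f"
  unfolding to_l2_eq_iff[symmetric] to_l2_simps by (rule scaleR_scaleC)

text \<open>The definite description in the definition of \<^const>\<open>proj_H2\<close> denotes the orthogonal projection to
  the closed subspace \<^const>\<open>H2\<close>.\<close>

lemma cinner_proj_H2: "l2_cinner (to_l2 (proj_H2 f)) (to_l2 h) = l2_cinner f (to_l2 h)"
proof -
  obtain m where m: "m \<in> H2" "\<And>v. v \<in> H2 \<Longrightarrow> l2_cinner (f - m) v = 0"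
    using complex_projection[OF csubspace_H2 closed_H2] by blast
  have "\<exists>!g. \<forall>h. l2_cinner (f - to_l2 g) (to_l2 h) = 0"
  proof
    show "\<forall>h. l2_cinner (f - to_l2 (of_l2 m)) (to_l2 h) = 0" using m by (simp add: to_l2_of_l2)
  next
    fix g assume g: "\<forall>h. l2_cinner (f - to_l2 g) (to_l2 h) = 0"
    define d where "d = g - of_l2 m"
    have "l2_cinner (to_l2 d) (to_l2 d) = l2_cinner (f - m) (to_l2 d) - l2_cinner (f - to_l2 g) (to_l2 d)"
      by (simp add: d_def to_l2_simps to_l2_of_l2 m l2_cinner_minus_left)
    also have "\<dots> = 0" using g m by simp
    finally have "norm d = 0" by (simp add: cinner_self norm_to_l2)
    then show "g = of_l2 m" by (simp add: d_def)
  qed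
  from theI'[OF this] have "l2_cinner (f - to_l2 (proj_H2 f)) (to_l2 h) = 0"
    unfolding proj_H2_def by blast
  then show ?thesis by (simp add: l2_cinner_minus_left)
qed

lemma fourier_proj_H2: "n \<ge> 0 \<Longrightarrow> fourier (to_l2 (proj_H2 f)) n = fourier f n"
  using cinner_proj_H2[of f "of_l2 (zpow n)"] by (simp add: to_l2_of_l2 zpow_in_H2 cinner_zpow_right)

lemma proj_H2_eqI: "(\<And>n. n \<ge> 0 \<Longrightarrow> fourier f n = fourier (to_l2 g) n) \<Longrightarrow> proj_H2 f = g"
  by (rule h2_eqI) (simp add: fourier_proj_H2)

lemma proj_H2_to_l2 [simp]: "proj_H2 (to_l2 f) = f"
  by (rule proj_H2_eqI) simp

lemma to_l2_proj_H2: "f \<in> H2 \<Longrightarrow> to_l2 (proj_H2 f) = f"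
  by (auto simp: H2_def)

lemma proj_H2_plus: "proj_H2 (f + g) = proj_H2 f + proj_H2 g"
  by (rule proj_H2_eqI) (simp add: to_l2_simps fourier_add fourier_proj_H2)

lemma proj_H2_minus: "proj_H2 (f - g) = proj_H2 f - proj_H2 g"
  by (rule proj_H2_eqI) (simp add: to_l2_simps fourier_minus fourier_proj_H2)

lemma proj_H2_scaleC: "proj_H2 (l2_scaleC c f) = h2_scaleC c (proj_H2 f)"
  by (rule proj_H2_eqI) (simp add: to_l2_simps fourier_scaleC fourier_proj_H2)

lemma norm_proj_H2_le: "norm (proj_H2 f) \<le> norm f"
proof -
  have "complex_of_real ((norm (proj_H2 f))\<^sup>2) = l2_cinner f (to_l2 (proj_H2 f))"
    unfolding cinner_proj_H2[symmetric] cinner_self norm_to_l2 ..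
  then have "(norm (proj_H2 f))\<^sup>2 = cmod (l2_cinner f (to_l2 (proj_H2 f)))"
    by (metis norm_of_real abs_power2)
  also have "\<dots> \<le> norm f * norm (proj_H2 f)" using norm_cinner_le[of f "to_l2 (proj_H2 f)"] by (simp add: norm_to_l2)
  finally show ?thesis by (cases "norm (proj_H2 f) = 0") (auto simp: power2_eq_square)
qed

lemma bounded_linear_proj_H2: "bounded_linear proj_H2"
  by (rule bounded_linear_intro[where K=1])
    (simp_all add: proj_H2_plus scaleR_scaleC proj_H2_scaleC scaleR_h2_scaleC norm_proj_H2_le)

lemma bounded_linear_to_l2: "bounded_linear to_l2"
  by (rule bounded_linear_intro[where K=1]) (simp_all add: to_l2_simps norm_to_l2)


section \<open>Bounded operators on the Hardy space\<close>

abbreviation hpow :: "int \<Rightarrow> h2" where "hpow n \<equiv> of_l2 (zpow n)"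

lemma to_l2_hpow [simp]: "n \<ge> 0 \<Longrightarrow> to_l2 (hpow n) = zpow n"
  by (simp add: to_l2_of_l2 zpow_in_H2)

lemma norm_hpow: "n \<ge> 0 \<Longrightarrow> norm (hpow n) = 1"
  by (simp add: norm_to_l2[symmetric])

lemma bounded_clinear_H2I:
  assumes "\<And>f g. A (f + g) = A f + A g" "\<And>c f. A (h2_scaleC c f) = h2_scaleC c (A f)" "\<And>f. norm (A f) \<le> K * norm f"
  shows "bounded_clinear_H2 A"
  unfolding bounded_clinear_H2_def using assms
  by (auto intro!: bounded_linear_intro[where K=K] simp: scaleR_h2_scaleC mult.commute)

lemma bounded_clinear_H2D:
  assumes "bounded_clinear_H2 A"
  shows "A (f + g) = A f + A g" "A (h2_scaleC c f) = h2_scaleC c (A f)" "A (f - g) = A f - A g" "A 0 = 0"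
    "bounded_linear A"
  using assms unfolding bounded_clinear_H2_def
  by (auto simp: linear_simps bounded_linear.linear linear_add linear_diff linear_0)

lemma bounded_clinear_H2_diff:
  assumes "bounded_clinear_H2 A" "bounded_clinear_H2 B"
  shows "bounded_clinear_H2 (\<lambda>f. A f - B f)"
proof -
  have "h2_scaleC c (f - g) = h2_scaleC c f - h2_scaleC c g" for c f g
    unfolding to_l2_eq_iff[symmetric] to_l2_simps by (rule scaleC_minus_right)
  then show ?thesis using assms by (auto simp: bounded_clinear_H2_def bounded_linear_sub)
qed

lemma bounded_clinear_H2_comp:
  assumes "bounded_clinear_H2 A" "bounded_clinear_H2 B"
  shows "bounded_clinear_H2 (\<lambda>f. A (B f))"
  using assms by (auto simp: bounded_clinear_H2_def intro: bounded_linear_compose)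

lemma bounded_clinear_H2_eqI:
  assumes A: "bounded_clinear_H2 A" and B: "bounded_clinear_H2 B"
    and eq: "\<And>n. n \<ge> 0 \<Longrightarrow> A (hpow n) = B (hpow n)"
  shows "A = B"
proof
  fix f
  define M where "M = {f. A (proj_H2 f) = B (proj_H2 f)}"
  have "csubspace M"
    using bounded_clinear_H2D[OF A] bounded_clinear_H2D[OF B] bounded_linear_proj_H2
    by (auto simp: csubspace_def M_def proj_H2_plus proj_H2_scaleC linear_simps)
  moreover have "closed M"
    unfolding M_def using bounded_clinear_H2D(5)[OF A] bounded_clinear_H2D(5)[OF B] bounded_linear_proj_H2
    by (intro closed_Collect_eq) (auto intro: linear_continuous_on bounded_linear_compose)
  moreover have "zpow n \<in> M" if "n \<ge> 0" for n
    using proj_H2_to_l2[of "hpow n"] eq[OF that] that by (simp add: M_def)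
  ultimately have "to_l2 f \<in> M" by (rule H2_dense) simp_all
  then show "A f = B f" by (simp add: M_def)
qed


section \<open>Toeplitz and Hankel operators\<close>

lemma mult_op_commute: "\<phi> \<in> Linf \<Longrightarrow> \<psi> \<in> Linf \<Longrightarrow> mult_op \<phi> (mult_op \<psi> f) = mult_op \<psi> (mult_op \<phi> f)"
  by (simp add: mult_op_mult mult.commute)

lemma fourier_mult_id: "fourier (mult_op (\<lambda>z. z) f) n = fourier f (n - 1)"
  using fourier_mult_powi[of 1 f n] by simp

lemma fourier_mult_cnj: "fourier (mult_op cnj f) n = fourier f (n + 1)"
  using fourier_mult_powi[of "-1" f n] cnj_powi_mult_op[of 1 f] by simp

lemma fourier_toeplitz: "n \<ge> 0 \<Longrightarrow> fourier (to_l2 (toeplitz \<phi> f)) n = fourier (mult_op \<phi> (to_l2 f)) n"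
  by (simp add: toeplitz_def fourier_proj_H2)

lemma fourier_hankel: "n \<ge> 0 \<Longrightarrow> fourier (to_l2 (hankel \<phi> f)) n = fourier (mult_op \<phi> (flip_op (to_l2 f))) n"
  by (simp add: hankel_def fourier_proj_H2)

lemma bounded_clinear_toeplitz:
  assumes "\<phi> \<in> Linf" shows "bounded_clinear_H2 (toeplitz \<phi>)"
proof -
  obtain C where "AE z in circle. cmod (\<phi> z) \<le> C" using assms by (auto simp: Linf_def)
  then have "norm (toeplitz \<phi> f) \<le> C * norm f" for f
    unfolding toeplitz_def by (metis norm_proj_H2_le norm_mult_op_le[OF assms] norm_to_l2 order_trans)
  then show ?thesis
    by (intro bounded_clinear_H2I[where K=C])
      (simp_all add: toeplitz_def to_l2_simps mult_op_plus mult_op_scaleC proj_H2_plus proj_H2_scaleC)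
qed

lemma bounded_clinear_hankel:
  assumes "\<phi> \<in> Linf" shows "bounded_clinear_H2 (hankel \<phi>)"
proof -
  obtain C where "AE z in circle. cmod (\<phi> z) \<le> C" using assms by (auto simp: Linf_def)
  then have "norm (hankel \<phi> f) \<le> C * norm f" for f
    unfolding hankel_def by (metis norm_proj_H2_le norm_mult_op_le[OF assms] norm_flip norm_to_l2 order_trans)
  then show ?thesis
    by (intro bounded_clinear_H2I[where K=C])
      (simp_all add: hankel_def to_l2_simps flip_op_plus flip_op_scaleC mult_op_plus mult_op_scaleC proj_H2_plus proj_H2_scaleC)
qed

lemma to_l2_toeplitz_analytic: "mult_op \<phi> (to_l2 f) \<in> H2 \<Longrightarrow> to_l2 (toeplitz \<phi> f) = mult_op \<phi> (to_l2 f)"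
  by (simp add: toeplitz_def to_l2_proj_H2)

lemma mult_id_H2: "f \<in> H2 \<Longrightarrow> mult_op (\<lambda>z. z) f \<in> H2"
  by (simp add: H2_iff fourier_mult_id)

lemma to_l2_T_z: "to_l2 (T_z f) = mult_op (\<lambda>z. z) (to_l2 f)"
  by (intro to_l2_toeplitz_analytic mult_id_H2) simp

text \<open>The adjoint of the shift is the Toeplitz operator with the conjugate symbol, which on coefficients is
  the shift to the left.\<close>

lemma adjoint_T_z: "adjoint_H2 T_z = toeplitz cnj"
proof -
  have adj: "h2_cinner (T_z f) g = h2_cinner f (toeplitz cnj g)" for f g
  proof -
    have "h2_cinner (T_z f) g = l2_cinner (to_l2 f) (mult_op cnj (to_l2 g))"
      unfolding h2_cinner_def to_l2_T_z by (subst mult_op_adjoint[OF Linf_id]) simp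
    also have "\<dots> = cnj (l2_cinner (mult_op cnj (to_l2 g)) (to_l2 f))" by (rule l2_cinner_commute)
    also have "\<dots> = cnj (l2_cinner (to_l2 (toeplitz cnj g)) (to_l2 f))" by (simp add: toeplitz_def cinner_proj_H2)
    also have "\<dots> = h2_cinner f (toeplitz cnj g)" unfolding h2_cinner_def by (rule l2_cinner_commute[symmetric])
    finally show ?thesis .
  qed
  show ?thesis unfolding adjoint_H2_def
  proof (rule the_equality)
    show "\<forall>f g. h2_cinner (T_z f) g = h2_cinner f (toeplitz cnj g)" using adj by blast
  next
    fix B assume B: "\<forall>f g. h2_cinner (T_z f) g = h2_cinner f (B g)"
    show "B = toeplitz cnj"
    proof
      fix g
      define d where "d = B g - toeplitz cnj g"
      have "h2_cinner d d = h2_cinner d (B g) - h2_cinner d (toeplitz cnj g)"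
        by (simp add: h2_cinner_def to_l2_simps d_def l2_cinner_minus_right)
      also have "\<dots> = 0" using B adj by simp
      finally have "norm d = 0" by (simp add: h2_cinner_def cinner_self norm_to_l2)
      then show "B g = toeplitz cnj g" by (simp add: d_def)
    qed
  qed
qed

lemma fourier_T_z: "fourier (to_l2 (T_z f)) n = fourier (to_l2 f) (n - 1)"
  by (simp add: to_l2_T_z fourier_mult_id)

lemma fourier_adjoint_T_z: "n \<ge> 0 \<Longrightarrow> fourier (to_l2 (toeplitz cnj f)) n = fourier (to_l2 f) (n + 1)"
  by (simp add: fourier_toeplitz fourier_mult_cnj)

lemma toeplitz_shift_invariant:
  assumes "\<phi> \<in> Linf" shows "toeplitz cnj (toeplitz \<phi> (T_z f)) = toeplitz \<phi> f"
  by (rule h2_eqI, subst fourier_adjoint_T_z)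
    (simp_all add: fourier_toeplitz to_l2_T_z mult_op_commute[OF assms Linf_id] fourier_mult_id)

lemma hankel_intertwines:
  assumes "\<phi> \<in> Linf" shows "toeplitz cnj (hankel \<phi> f) = hankel \<phi> (T_z f)"
  by (rule h2_eqI)
    (simp add: fourier_adjoint_T_z fourier_hankel to_l2_T_z flip_mult_op[OF Linf_id]
      mult_op_commute[OF assms Linf_cnj_id] fourier_mult_cnj)

lemma hankel_diff:
  assumes "\<phi> \<in> Linf" "\<psi> \<in> Linf"
  shows "hankel (\<lambda>z. \<phi> z - \<psi> z) f = hankel \<phi> f - hankel \<psi> f"
  by (simp add: hankel_def mult_op_diff[OF assms] proj_H2_minus)

lemma hankel_cnj_mult:
  assumes "\<phi> \<in> Linf"
  shows "hankel (\<lambda>z. cnj z * \<phi> z) f = toeplitz cnj (hankel \<phi> f)"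
  by (rule h2_eqI)
    (simp add: fourier_adjoint_T_z fourier_hankel mult_op_mult[OF Linf_cnj_id assms, symmetric] fourier_mult_cnj)

lemma T_z_hpow: "n \<ge> 0 \<Longrightarrow> T_z (hpow n) = hpow (n + 1)"
  by (rule h2_eqI) (simp add: fourier_T_z fourier_zpow)

lemma bounded_clinear_T_z: "bounded_clinear_H2 T_z" by (rule bounded_clinear_toeplitz[OF Linf_id])
lemma bounded_clinear_adjoint_T_z: "bounded_clinear_H2 (toeplitz cnj)" by (rule bounded_clinear_toeplitz[OF Linf_cnj_id])

text \<open>The matrix of a Toeplitz operator contains every Fourier coefficient of its symbol: the coefficient
  of index \<open>n\<close> sits in the column \<open>max 0 (- n)\<close>.\<close>

lemma toeplitz_symbol_unique:
  assumes "\<phi> \<in> Linf" "\<And>f. toeplitz \<phi> f = 0"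
  shows "AE z in circle. \<phi> z = 0"
proof -
  have "fourier (mult_op \<phi> (zpow 0)) n = 0" for n
  proof -
    define m where "m = max 0 (- n)"
    have "fourier (mult_op \<phi> (zpow 0)) n = fourier (mult_op (\<lambda>z. z powi m) (mult_op \<phi> (zpow 0))) (n + m)"
      by (simp add: fourier_mult_powi)
    also have "\<dots> = fourier (mult_op \<phi> (to_l2 (hpow m))) (n + m)"
      by (simp add: mult_op_commute[OF powi_Linf assms(1)] mult_op_powi_zpow m_def)
    also have "\<dots> = fourier (to_l2 (toeplitz \<phi> (hpow m))) (n + m)" by (subst fourier_toeplitz) (auto simp: m_def)
    finally show ?thesis by (simp add: assms(2) to_l2_simps)
  qed
  then have "mult_op \<phi> (zpow 0) = 0" by (intro fourier_eqI) simp
  then have "AE z in circle. rep_l2 (mult_op \<phi> (zpow 0)) z = 0"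
    using rep_scaleC[of 0 0] by simp
  then show ?thesis using rep_mult[OF assms(1), of "zpow 0"] rep_zpow[of 0] by eventually_elim simp
qed

text \<open>The hypothesis says that \<open>b\<close> itself belongs to \<^const>\<open>H2\<close>, as \<^term>\<open>zpow 0\<close> is the constant 1.\<close>

lemma bounded_analytic_mult_H2:
  assumes b: "b \<in> Linf" "\<And>n. n < 0 \<Longrightarrow> fourier (mult_op b (zpow 0)) n = 0" and f: "f \<in> H2"
  shows "mult_op b f \<in> H2"
proof -
  define M where "M = {f. mult_op b f \<in> H2}"
  have "csubspace M" using csubspace_H2 by (auto simp: M_def csubspace_def mult_op_plus mult_op_scaleC)
  moreover have "closed M"
    unfolding M_def using closed_H2 linear_continuous_on[OF bounded_linear_mult_op[OF b(1)], of UNIV]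
    by (auto intro: closed_vimage simp: vimage_def[symmetric] continuous_on_eq_continuous_at)
  moreover have "zpow n \<in> M" if "n \<ge> 0" for n
  proof -
    have "mult_op b (zpow n) = mult_op (\<lambda>z. z powi n) (mult_op b (zpow 0))"
      by (simp add: mult_op_commute[OF powi_Linf b(1)] mult_op_powi_zpow)
    then show ?thesis using b(2) that by (simp add: M_def H2_iff fourier_mult_powi)
  qed
  ultimately have "f \<in> M" using f by (rule H2_dense)
  then show ?thesis by (simp add: M_def)
qed


section \<open>The Brown-Halmos theorem\<close>

text \<open>Shifts by natural numbers stay integer powers here, to match the rules about \<open>z powi n\<close>.\<close>

declare power_int_of_nat [simp del]

text \<open>Testing on the set where the bound fails shows that this set is null.\<close>

lemma AE_norm_le_if_averages_le:
  fixes f :: "complex \<Rightarrow> complex"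
  assumes f: "integrable circle f"
    and avg: "\<And>E. E \<in> sets borel \<Longrightarrow> (LINT z|circle. indicator E z * cmod (f z)) \<le> M * measure circle E"
  shows "AE z in circle. cmod (f z) \<le> M"
proof -
  have [measurable]: "f \<in> borel_measurable borel" using borel_measurable_integrable[OF f] by simp
  define E where "E = {z. cmod (f z) > M}"
  have E[measurable]: "E \<in> sets borel" unfolding E_def by measurable
  have i1: "integrable circle (\<lambda>z. indicator E z * cmod (f z))"
    using integrable_mult_indicator[of E circle "\<lambda>z. cmod (f z)"] f by simp
  have i2: "integrable circle (\<lambda>z. indicator E z * M)"
    using integrable_mult_indicator[of E circle "\<lambda>z. M"] by simp
  define g where "g z = indicator E z * cmod (f z) - indicator E z * M" for z
  have g: "integrable circle g" unfolding g_def by (intro Bochner_Integration.integrable_diff i1 i2)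
  have g0: "g z \<ge> 0" for z by (simp add: g_def E_def indicator_def)
  have "(LINT z|circle. g z) = (LINT z|circle. indicator E z * cmod (f z)) - M * measure circle E"
    unfolding g_def by (subst Bochner_Integration.integral_diff[OF i1 i2]) (simp add: mult.commute)
  also have "\<dots> \<le> 0" using avg[OF E] by simp
  finally have "(LINT z|circle. g z) = 0"
    using Bochner_Integration.integral_nonneg[of circle g] g0 by (simp add: order_antisym)
  then have "AE z in circle. g z = 0" using integral_nonneg_eq_0_iff_AE[OF g] g0 by simp
  then show ?thesis by eventually_elim (auto simp: g_def E_def indicator_def split: if_splits)
qed

definition conj_l2 :: "l2 \<Rightarrow> l2" where
  "conj_l2 f = abs_l2 (\<lambda>z. cnj (rep_l2 f z))"

lemma rep_conj_l2: "AE z in circle. rep_l2 (conj_l2 f) z = cnj (rep_l2 f z)"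
  unfolding conj_l2_def by (intro rep_abs_l2 sq_integrable_cnj) simp

lemma norm_conj_l2 [simp]: "norm (conj_l2 f) = norm f"
  by (rule norm_l2_cong, use rep_conj_l2[of f] in \<open>eventually_elim, simp\<close>)

lemma fourier_conj_l2: "fourier (conj_l2 f) n = cnj (fourier f (- n))"
proof -
  have "fourier (conj_l2 f) n = (LINT z|circle. cnj (rep_l2 f z * z powi n))"
    unfolding fourier_rep
  proof (rule integral_cong_AE)
    show "AE z in circle. rep_l2 (conj_l2 f) z * z powi - n = cnj (rep_l2 f z * z powi n)"
      using rep_conj_l2[of f] AE_circle_norm
      by eventually_elim (simp only: complex_cnj_mult cnj_powi_circle)
  qed simp_all
  then show ?thesis by (simp only: fourier_rep Bochner_Integration.integral_cnj minus_minus)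
qed

text \<open>The operator agrees with multiplication by the symbol on monomials, hence on bounded functions;
  for other functions the product with the symbol is not yet known to be square integrable.
  Applied to an indicator function, the operator bound controls the average of \<open>|\<phi>|\<^sup>2\<close> over the set.\<close>

lemma multiplier_symbol_bounded:
  assumes plus: "\<And>f g. L (f + g) = L f + L g" and scaleC: "\<And>c f. L (l2_scaleC c f) = l2_scaleC c (L f)"
    and bound: "\<And>f. norm (L f) \<le> K * norm f"
    and zpow: "\<And>j. L (zpow j) = mult_op (\<lambda>z. z powi j) \<phi>"
  shows "AE z in circle. cmod (rep_l2 \<phi> z) \<le> K"
proof -
  have L: "bounded_linear L"
    by (rule bounded_linear_intro[where K=K]) (use bound in \<open>simp_all add: plus scaleC scaleR_scaleC mult.commute\<close>)
  have "norm (L (zpow 0)) \<le> K" using bound[of "zpow 0"] by simp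
  then have K: "K \<ge> 0" using norm_ge_zero order_trans by blast
  have mult: "L (abs_l2 g) = mult_op g \<phi>" if g: "g \<in> Linf" for g
  proof (rule fourier_eqI)
    fix k
    define M where "M = {f. fourier (L f) k = l2_cinner f (mult_op (\<lambda>z. z powi k) (conj_l2 \<phi>))}"
    have "abs_l2 g \<in> M"
    proof (rule l2_dense)
      have "L 0 = 0" using scaleC[of 0 0] by simp
      then show "csubspace M"
        by (auto simp: csubspace_def M_def plus scaleC fourier_add fourier_scaleC l2_cinner_add_left l2_cinner_scaleC_left)
      show "closed M" unfolding M_def
        by (intro closed_Collect_eq linear_continuous_on bounded_linear_cinner_left
            bounded_linear_compose[OF bounded_linear_fourier L])
      show "zpow j \<in> M" for j
        unfolding M_def mem_Collect_eq zpow
        by (subst l2_cinner_commute) (simp add: cinner_zpow_right fourier_mult_powi fourier_conj_l2)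
    qed
    then have "fourier (L (abs_l2 g)) k = l2_cinner (abs_l2 g) (mult_op (\<lambda>z. z powi k) (conj_l2 \<phi>))"
      by (simp add: M_def)
    also have "\<dots> = fourier (mult_op g \<phi>) k"
      unfolding l2_cinner_rep fourier_rep
    proof (rule integral_cong_AE)
      show "AE z in circle. rep_l2 (abs_l2 g) z * cnj (rep_l2 (mult_op (\<lambda>z. z powi k) (conj_l2 \<phi>)) z) =
          rep_l2 (mult_op g \<phi>) z * z powi - k"
        using rep_abs_l2[OF Linf_sq_integrable[OF g]] rep_mult[OF powi_Linf, of k "conj_l2 \<phi>"]
          rep_conj_l2[of \<phi>] rep_mult[OF g, of \<phi>] AE_circle_norm
        by eventually_elim (simp only: complex_cnj_mult cnj_powi_circle complex_cnj_cnj mult_ac)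
    qed simp_all
    finally show "fourier (L (abs_l2 g)) k = fourier (mult_op g \<phi>) k" .
  qed
  have sq: "integrable circle (\<lambda>z. complex_of_real ((cmod (rep_l2 \<phi> z))\<^sup>2))"
    using rep_l2_sq_integrable[of \<phi>] unfolding sq_integrable_def by (intro integrable_of_real) auto
  have "AE z in circle. cmod (complex_of_real ((cmod (rep_l2 \<phi> z))\<^sup>2)) \<le> K\<^sup>2"
  proof (rule AE_norm_le_if_averages_le[OF sq])
    fix E :: "complex set" assume E[measurable]: "E \<in> sets borel"
    have e: "(\<lambda>z. indicator E z :: complex) \<in> Linf" by (rule LinfI[where C=1]) (auto simp: indicator_def)
    have "(LINT z|circle. indicator E z * cmod (complex_of_real ((cmod (rep_l2 \<phi> z))\<^sup>2))) = (norm (mult_op (\<lambda>z. indicator E z) \<phi>))\<^sup>2"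
      unfolding norm_rep
    proof (rule integral_cong_AE)
      show "AE z in circle. indicator E z * cmod (complex_of_real ((cmod (rep_l2 \<phi> z))\<^sup>2)) =
          (cmod (rep_l2 (mult_op (\<lambda>z. indicator E z) \<phi>) z))\<^sup>2"
        using rep_mult[OF e, of \<phi>] by eventually_elim (simp add: indicator_def norm_power)
    qed simp_all
    also have "\<dots> \<le> (K * norm (abs_l2 (\<lambda>z. indicator E z)))\<^sup>2"
      unfolding mult[OF e, symmetric] by (intro power_mono bound) simp
    also have "\<dots> = K\<^sup>2 * (LINT z|circle. indicator E z)"
      unfolding power_mult_distrib norm_abs_l2[OF Linf_sq_integrable[OF e]]
      by (intro arg_cong[of _ _ "(*) _"] Bochner_Integration.integral_cong) (auto simp: indicator_def)
    finally show "(LINT z|circle. indicator E z * cmod (complex_of_real ((cmod (rep_l2 \<phi> z))\<^sup>2))) \<le> K\<^sup>2 * measure circle E"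
      by simp
  qed
  then show ?thesis
    by eventually_elim (use K in \<open>simp add: norm_power abs_le_square_iff[symmetric]\<close>)
qed

text \<open>An \<open>\<epsilon>/3\<close> argument. It reduces strong convergence of bounded operators to convergence on monomials.\<close>

lemma uniformly_bounded_convergent_closed:
  fixes L :: "nat \<Rightarrow> 'a::real_normed_vector \<Rightarrow> 'b::banach"
  assumes lin: "\<And>n f g. L n (f - g) = L n f - L n g" and bd: "\<And>n f. norm (L n f) \<le> K * norm f"
  shows "closed {f. convergent (\<lambda>n. L n f)}"
proof (rule iffD2[OF closed_sequential_limits], intro allI impI, elim conjE)
  fix s f assume s: "\<forall>k. s k \<in> {f. convergent (\<lambda>n. L n f)}" and lim: "s \<longlonglongrightarrow> f"
  have "Cauchy (\<lambda>n. L n f)"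
  proof (rule metric_CauchyI)
    fix e :: real assume "e > 0"
    define \<delta> where "\<delta> = e / (3 * (\<bar>K\<bar> + 1))"
    have "\<delta> > 0" using \<open>e > 0\<close> by (simp add: \<delta>_def)
    then obtain k where k: "dist (s k) f < \<delta>" using metric_LIMSEQ_D[OF lim] by blast
    have near: "dist (L n f) (L n (s k)) \<le> e / 3" for n
    proof -
      have "dist (L n f) (L n (s k)) = norm (L n (f - s k))" by (simp add: dist_norm lin)
      also have "\<dots> \<le> K * norm (f - s k)" by (rule bd)
      also have "\<dots> \<le> (\<bar>K\<bar> + 1) * \<delta>"
        using k by (intro mult_mono) (auto simp: dist_norm norm_minus_commute)
      also have "\<dots> = e / 3" by (simp add: \<delta>_def field_simps add_nonneg_eq_0_iff)
      finally show ?thesis .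
    qed
    have "Cauchy (\<lambda>n. L n (s k))" using s by (intro convergent_Cauchy) simp
    then obtain N where N: "\<And>i j. i \<ge> N \<Longrightarrow> j \<ge> N \<Longrightarrow> dist (L i (s k)) (L j (s k)) < e / 3"
      using metric_CauchyD[of "\<lambda>n. L n (s k)" "e / 3"] \<open>e > 0\<close> by auto
    have "dist (L i f) (L j f) < e" if "i \<ge> N" "j \<ge> N" for i j
      using near[of i] near[of j] N[OF that] dist_triangle[of "L i f" "L j f" "L i (s k)"]
        dist_triangle[of "L i (s k)" "L j f" "L j (s k)"] dist_commute[of "L j f" "L j (s k)"] by linarith
    then show "\<exists>N. \<forall>i\<ge>N. \<forall>j\<ge>N. dist (L i f) (L j f) < e" by blast
  qed
  then show "f \<in> {f. convergent (\<lambda>n. L n f)}" by (simp add: Cauchy_convergent_iff)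
qed

lemma cinner_eq_zero_if_proj_zero: "proj_H2 f = 0 \<Longrightarrow> g \<in> H2 \<Longrightarrow> l2_cinner f g = 0"
  using cinner_proj_H2[of f] by (auto simp: H2_def to_l2_simps)

text \<open>By hypothesis the matrix of \<open>B\<close> is constant along diagonals. Its columns, moved back by \<open>n\<close> places, are
  the vectors \<open>b n\<close>: each is a truncation of the next, and their norms are bounded, so they converge to
  a function with the diagonal entries as Fourier coefficients. Similarly the operators \<open>z\<^sup>-\<^sup>n B P z\<^sup>n\<close> on all of
  \<^typ>\<open>l2\<close> converge strongly to multiplication by that function, which is therefore bounded.\<close>

theorem brown_halmos:
  assumes B: "bounded_clinear_H2 B" and inv: "\<And>f. toeplitz cnj (B (T_z f)) = B f"
  shows "is_toeplitz B"
proof -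
  note Bs = bounded_clinear_H2D[OF B]
  obtain K where K: "K \<ge> 0" "\<And>f. norm (B f) \<le> K * norm f"
    using bounded_linear.nonneg_bounded[OF Bs(5)] by (metis mult.commute)
  have step: "fourier (to_l2 (B (hpow (j + int m)))) (n + int m) = fourier (to_l2 (B (hpow j))) n"
    if "n \<ge> 0" "j \<ge> 0" for n j m
  proof (induction m)
    case (Suc m)
    have "fourier (to_l2 (B (hpow (j + int m)))) (n + int m) =
        fourier (to_l2 (toeplitz cnj (B (T_z (hpow (j + int m)))))) (n + int m)" by (simp add: inv)
    also have "\<dots> = fourier (to_l2 (B (hpow (j + int (Suc m))))) (n + int (Suc m))"
      using that by (subst fourier_adjoint_T_z) (simp_all add: T_z_hpow add_ac)
    finally show ?case using Suc by simp
  qed simp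
  define b where "b n = mult_op (\<lambda>z. z powi (- int n)) (to_l2 (B (hpow (int n))))" for n
  have fb: "fourier (b n) k = fourier (to_l2 (B (hpow (int n)))) (k + int n)" for n k
    by (simp add: b_def fourier_mult_powi)
  have fb_neg: "fourier (b n) k = 0" if "k < - int n" for n k using that by (simp add: fb fourier_to_l2_neg)
  have fb_eq: "fourier (b m) k = fourier (b n) k" if "n \<le> m" "k \<ge> - int n" for m n k
    using step[of "k + int n" "int n" "m - n"] that by (simp add: fb of_nat_diff)
  have b_le: "norm (b n) \<le> K" for n
    using K(2)[of "hpow (int n)"] by (simp add: b_def norm_to_l2 norm_hpow)
  \<comment> \<open>\<open>b m - b n\<close> only has coefficients of index below \<open>- n\<close>, and \<open>b n\<close> has none of these\<close>
  have b_diff: "(norm (b m))\<^sup>2 = (norm (b n))\<^sup>2 + (norm (b m - b n))\<^sup>2" if "n \<le> m" for m n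
  proof -
    let ?d = "mult_op (\<lambda>z. z powi (int n)) (b m - b n)"
    have "proj_H2 ?d = 0"
      by (rule proj_H2_eqI) (use fb_eq[OF that] in \<open>simp add: fourier_mult_powi fourier_minus to_l2_simps\<close>)
    moreover have "mult_op (\<lambda>z. z powi (int n)) (b n) \<in> H2"
      by (simp add: b_def mult_op_powi_powi)
    ultimately have "l2_cinner ?d (mult_op (\<lambda>z. z powi (int n)) (b n)) = 0" by (rule cinner_eq_zero_if_proj_zero)
    then have "l2_cinner (b m - b n) (b n) = 0"
      by (simp add: mult_op_adjoint[OF powi_Linf] mult_op_powi_powi cnj_powi_mult_op del: complex_cnj_power_int)
    then have "inner (b m - b n) (b n) = 0" by (simp add: inner_l2_def)
    moreover have "b m = b n + (b m - b n)" by simp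
    ultimately show ?thesis
      by (smt (verit) power2_norm_eq_inner inner_add_left inner_add_right inner_commute)
  qed
  have "convergent b"
  proof (rule l2_complete)
    have "incseq (\<lambda>n. (norm (b n))\<^sup>2)" using b_diff by (simp add: incseq_def)
    moreover have "(norm (b n))\<^sup>2 \<le> K\<^sup>2" for n using b_le by (intro power_mono) simp_all
    ultimately obtain l where l: "(\<lambda>n. (norm (b n))\<^sup>2) \<longlonglongrightarrow> l"
      using incseq_convergent[of "\<lambda>n. (norm (b n))\<^sup>2" "K\<^sup>2"] by blast
    show "Cauchy b"
    proof (rule metric_CauchyI)
      fix e :: real assume "e > 0"
      have "Cauchy (\<lambda>n. (norm (b n))\<^sup>2)" using l by (rule LIMSEQ_imp_Cauchy)
      then obtain N where N: "\<And>m n. m \<ge> N \<Longrightarrow> n \<ge> N \<Longrightarrow> dist ((norm (b m))\<^sup>2) ((norm (b n))\<^sup>2) < e\<^sup>2"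
        using metric_CauchyD[of _ "e\<^sup>2"] \<open>e > 0\<close> by (metis zero_less_power)
      have "dist (b m) (b n) < e" if "m \<ge> N" "n \<ge> N" for m n
      proof -
        have "(dist (b m) (b n))\<^sup>2 < e\<^sup>2"
          using N[OF that] b_diff[of m n] b_diff[of n m] linear[of m n]
          by (auto simp: dist_real_def dist_norm norm_minus_commute)
        then show ?thesis using \<open>e > 0\<close> by (simp add: power_less_imp_less_base)
      qed
      then show "\<exists>M. \<forall>m\<ge>M. \<forall>n\<ge>M. dist (b m) (b n) < e" by blast
    qed
  qed
  then obtain \<phi>0 where \<phi>0: "b \<longlonglongrightarrow> \<phi>0" by (auto simp: convergent_def)
  have f\<phi>0: "fourier \<phi>0 k = fourier (b n) k" if "k \<ge> - int n" for n k
  proof -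
    have "(\<lambda>m. fourier (b m) k) \<longlonglongrightarrow> fourier \<phi>0 k"
      by (rule bounded_linear.tendsto[OF bounded_linear_fourier \<phi>0])
    moreover have "(\<lambda>m. fourier (b m) k) \<longlonglongrightarrow> fourier (b n) k"
      by (rule tendsto_eventually, use eventually_ge_at_top[of n] in eventually_elim) (use fb_eq that in simp)
    ultimately show ?thesis by (rule LIMSEQ_unique)
  qed
  \<comment> \<open>The operators \<open>L n\<close> converge strongly to multiplication by the symbol.\<close>
  define L where "L n f = mult_op (\<lambda>z. z powi (- int n)) (to_l2 (B (proj_H2 (mult_op (\<lambda>z. z powi (int n)) f))))" for n f
  have L_plus: "L n (f + g) = L n f + L n g" for n f g
    by (simp add: L_def mult_op_plus proj_H2_plus Bs to_l2_simps)
  have L_scaleC: "L n (l2_scaleC c f) = l2_scaleC c (L n f)" for n c f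
    by (simp add: L_def mult_op_scaleC proj_H2_scaleC Bs to_l2_simps)
  have L_minus: "L n (f - g) = L n f - L n g" for n f g
    by (simp add: L_def mult_op_minus proj_H2_minus Bs to_l2_simps)
  have L_norm: "norm (L n f) \<le> K * norm f" for n f
  proof -
    have "norm (L n f) \<le> K * norm (proj_H2 (mult_op (\<lambda>z. z powi (int n)) f))" by (simp add: L_def norm_to_l2 K)
    also have "\<dots> \<le> K * norm f"
      using norm_proj_H2_le[of "mult_op (\<lambda>z. z powi (int n)) f"] K by (intro mult_left_mono) simp_all
    finally show ?thesis .
  qed
  have L_zpow: "(\<lambda>n. L n (zpow j)) \<longlonglongrightarrow> mult_op (\<lambda>z. z powi j) \<phi>0" for j
  proof -
    have "L (n + nat (- j)) (zpow j) = mult_op (\<lambda>z. z powi j) (b (n + nat j))" for n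
    proof -
      define p q where "p = n + nat (- j)" and "q = n + nat j"
      have pq: "int p + j = int q" "- int p = j + - int q" by (simp_all add: p_def q_def)
      have "proj_H2 (zpow (int q)) = hpow (int q)" using proj_H2_to_l2[of "hpow (int q)"] by simp
      then have "L p (zpow j) = mult_op (\<lambda>z. z powi j) (b q)"
        unfolding L_def b_def mult_op_powi_zpow mult_op_powi_powi pq by simp
      then show ?thesis by (simp only: p_def q_def)
    qed
    then have "(\<lambda>n. L (n + nat (- j)) (zpow j)) = (\<lambda>n. mult_op (\<lambda>z. z powi j) (b (n + nat j)))" by blast
    moreover have "(\<lambda>n. mult_op (\<lambda>z. z powi j) (b (n + nat j))) \<longlonglongrightarrow> mult_op (\<lambda>z. z powi j) \<phi>0"
      by (intro bounded_linear.tendsto[OF bounded_linear_mult_op[OF powi_Linf]] LIMSEQ_ignore_initial_segment \<phi>0)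
    ultimately have "(\<lambda>n. L (n + nat (- j)) (zpow j)) \<longlonglongrightarrow> mult_op (\<lambda>z. z powi j) \<phi>0" by (simp only:)
    then show ?thesis by (rule LIMSEQ_offset)
  qed
  have "f \<in> {f. convergent (\<lambda>n. L n f)}" for f
  proof (rule l2_dense)
    show "csubspace {f. convergent (\<lambda>n. L n f)}"
      using L_scaleC[of _ 0 0]
      by (auto simp: csubspace_def L_plus L_scaleC intro: convergent_add)
        (auto simp: convergent_def intro: bounded_linear.tendsto[OF bounded_linear_scaleC])
    show "closed {f. convergent (\<lambda>n. L n f)}" using L_minus L_norm by (rule uniformly_bounded_convergent_closed)
    show "zpow j \<in> {f. convergent (\<lambda>n. L n f)}" for j using L_zpow by (auto simp: convergent_def)
  qed
  then have "\<forall>f. \<exists>g. (\<lambda>n. L n f) \<longlonglongrightarrow> g" by (auto simp: convergent_def)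
  then obtain L' where L': "\<And>f. (\<lambda>n. L n f) \<longlonglongrightarrow> L' f" by metis
  have L'_plus: "L' (f + g) = L' f + L' g" for f g
    using tendsto_add[OF L'[of f] L'[of g]] L'[of "f + g"] by (simp add: L_plus LIMSEQ_unique)
  have L'_scaleC: "L' (l2_scaleC c f) = l2_scaleC c (L' f)" for c f
    using bounded_linear.tendsto[OF bounded_linear_scaleC[of c] L'[of f]] L'[of "l2_scaleC c f"] by (simp add: L_scaleC LIMSEQ_unique)
  have L'_norm: "norm (L' f) \<le> K * norm f" for f
    by (rule LIMSEQ_le_const2[OF tendsto_norm[OF L']]) (use L_norm in auto)
  have L'_zpow: "L' (zpow j) = mult_op (\<lambda>z. z powi j) \<phi>0" for j
    using L'[of "zpow j"] L_zpow[of j] by (rule LIMSEQ_unique)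
  have "AE z in circle. cmod (rep_l2 \<phi>0 z) \<le> K"
    using L'_plus L'_scaleC L'_norm L'_zpow by (rule multiplier_symbol_bounded)
  then have \<phi>: "rep_l2 \<phi>0 \<in> Linf" by (auto simp: Linf_def)
  have "B = toeplitz (rep_l2 \<phi>0)"
  proof (rule bounded_clinear_H2_eqI[OF B bounded_clinear_toeplitz[OF \<phi>]], rule h2_eqI)
    fix n k :: int assume n: "n \<ge> 0" and k: "k \<ge> 0"
    have "mult_op (rep_l2 \<phi>0) (zpow n) = mult_op (\<lambda>z. z powi n) \<phi>0"
      by (rule l2_eqI, use rep_mult[OF \<phi>, of "zpow n"] rep_mult[OF powi_Linf, of n \<phi>0] rep_zpow[of n]
          in \<open>eventually_elim, simp add: mult.commute\<close>)
    then have "fourier (to_l2 (toeplitz (rep_l2 \<phi>0) (hpow n))) k = fourier \<phi>0 (k - n)"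
      using n k by (simp add: fourier_toeplitz fourier_mult_powi)
    also have "\<dots> = fourier (to_l2 (B (hpow n))) k" using f\<phi>0[of "nat n" "k - n"] n k by (simp add: fb)
    finally show "fourier (to_l2 (B (hpow n))) k = fourier (to_l2 (toeplitz (rep_l2 \<phi>0) (hpow n))) k" by simp
  qed
  with \<phi> show ?thesis by (auto simp: is_toeplitz_def)
qed

declare power_int_of_nat [simp]


section \<open>The disc algebra\<close>

lemma contour_integral_circle:
  assumes g: "continuous_on (sphere 0 1) g" and [measurable]: "f \<in> borel_measurable borel"
    and eq: "\<And>z. cmod z = 1 \<Longrightarrow> f z = g z * z"
  shows "contour_integral (circlepath 0 1) g = 2 * of_real pi * \<i> * (LINT z|circle. f z)"
proof -
  have cont: "continuous_on {0..2*pi} (\<lambda>t. g (cis t) * cis t)"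
    by (intro continuous_intros continuous_on_compose2[OF g]) auto
  have "contour_integral (circlepath 0 1) g = integral {0..2*pi} (\<lambda>t. \<i> * (g (cis t) * cis t))"
    unfolding circlepath_def by (subst contour_integral_part_circlepath_eq) (simp_all add: mult_ac)
  also have "\<dots> = \<i> * integral {0..2*pi} (\<lambda>t. g (cis t) * cis t)" by (rule integral_mult_right)
  also have "integral {0..2*pi} (\<lambda>t. g (cis t) * cis t) = (LINT t:{0..2*pi}|lborel. g (cis t) * cis t)"
    by (rule set_borel_integral_eq_integral(2)[OF borel_integrable_atLeastAtMost'[OF cont], symmetric])
  also have "\<dots> = (LINT t:{0..2*pi}|lborel. f (cis t))" by (simp add: eq)
  also have "\<dots> = 2 * of_real pi * (LINT z|circle. f z)"
    by (simp add: circle_integral_parametrized scaleR_conv_of_real)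
  finally show ?thesis by simp
qed

definition disc_algebra :: "(complex \<Rightarrow> complex) \<Rightarrow> bool" where
  "disc_algebra f \<longleftrightarrow> continuous_on (cball 0 1) f \<and> f holomorphic_on ball 0 1"

text \<open>A function of the disc algebra may be arbitrary outside the closed disc; it is replaced by zero there to obtain
  a Borel function on the whole plane.\<close>

definition disc_restrict :: "(complex \<Rightarrow> complex) \<Rightarrow> complex \<Rightarrow> complex" where
  "disc_restrict f z = (if cmod z \<le> 1 then f z else 0)"

lemma disc_restrict_measurable:
  assumes "disc_algebra f" shows "disc_restrict f \<in> borel_measurable borel"
proof -
  have "(\<lambda>z. if z \<in> cball 0 1 then f z else 0) \<in> borel_measurable borel"
    using assms by (intro borel_measurable_continuous_on_if) (auto simp: disc_algebra_def)
  then show ?thesis by (simp add: disc_restrict_def[abs_def])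
qed

lemma disc_restrict_Linf:
  assumes "disc_algebra f" shows "disc_restrict f \<in> Linf"
proof -
  obtain C where "\<And>z. z \<in> cball 0 1 \<Longrightarrow> cmod (f z) \<le> C"
    using compact_norm_bound[of "cball 0 1" f] assms by (auto simp: disc_algebra_def)
  then show ?thesis using disc_restrict_measurable[OF assms]
    by (intro LinfI[where C=C]) (auto simp: disc_restrict_def)
qed

text \<open>A negative coefficient is, up to a constant, the contour integral of \<open>f\<close> times a nonnegative power
  of \<open>z\<close>, which vanishes by Cauchy's theorem.\<close>

lemma disc_algebra_fourier_neg:
  assumes f: "disc_algebra f" and n: "n < 0"
  shows "fourier (mult_op (disc_restrict f) (zpow 0)) n = 0"
proof -
  define m where "m = nat (- n) - 1"
  have m: "- n = int (Suc m)" using n by (simp add: m_def)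
  have [measurable]: "disc_restrict f \<in> borel_measurable borel" using f by (rule disc_restrict_measurable)
  have "fourier (mult_op (disc_restrict f) (zpow 0)) n = (LINT z|circle. disc_restrict f z * z ^ Suc m)"
    unfolding fourier_rep m power_int_of_nat
  proof (rule integral_cong_AE)
    show "AE z in circle. rep_l2 (mult_op (disc_restrict f) (zpow 0)) z * z ^ Suc m = disc_restrict f z * z ^ Suc m"
      using rep_mult[OF disc_restrict_Linf[OF f], of "zpow 0"] rep_zpow[of 0] by eventually_elim simp
  qed simp_all
  also have "2 * of_real pi * \<i> * \<dots> = contour_integral (circlepath 0 1) (\<lambda>z. f z * z ^ m)"
  proof (rule contour_integral_circle[symmetric])
    show "continuous_on (sphere 0 1) (\<lambda>z. f z * z ^ m)"
      using f by (auto simp: disc_algebra_def intro!: continuous_intros elim: continuous_on_subset)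
    show "(\<lambda>z. disc_restrict f z * z ^ Suc m) \<in> borel_measurable borel" by measurable
  qed (simp add: disc_restrict_def)
  also have "\<dots> = 0"
  proof (rule contour_integral_unique, rule Cauchy_theorem_disc[where K="{}" and a=0 and e=1])
    show "continuous_on (cball 0 1) (\<lambda>z. f z * z ^ m)" using f by (auto simp: disc_algebra_def intro!: continuous_intros)
    have "(\<lambda>z. f z * z ^ m) holomorphic_on ball 0 1" using f by (auto simp: disc_algebra_def intro!: holomorphic_intros)
    then show "(\<lambda>z. f z * z ^ m) field_differentiable at x" if "x \<in> ball 0 1 - {}" for x
      using that holomorphic_on_imp_differentiable_at by auto
  qed auto
  finally show ?thesis by simp
qed

lemma disc_algebra_const: "disc_algebra (\<lambda>_. c)"
  by (simp add: disc_algebra_def)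

lemma disc_algebra_mult: "disc_algebra f \<Longrightarrow> disc_algebra g \<Longrightarrow> disc_algebra (\<lambda>z. f z * g z)"
  by (auto simp: disc_algebra_def intro!: continuous_intros holomorphic_intros)


section \<open>Balanced factorisation of polynomials\<close>

lemma continuous_on_csqrt_right_half_plane: "continuous_on {z. Re z \<ge> 0} csqrt"
proof (rule continuous_at_imp_continuous_on, rule)
  fix z :: complex assume z: "z \<in> {z. Re z \<ge> 0}"
  show "isCont csqrt z"
  proof (cases "z = 0")
    case False
    then have "z \<notin> \<real>\<^sub>\<le>\<^sub>0" using z by (auto simp: complex_nonpos_Reals_iff complex_eq_iff)
    then show ?thesis by (rule continuous_at_csqrt)
  next
    case True
    have "((\<lambda>w. sqrt (cmod w)) \<longlongrightarrow> sqrt (cmod 0)) (at 0)" by (intro tendsto_intros)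
    then have "((\<lambda>w. cmod (csqrt w)) \<longlongrightarrow> 0) (at 0)" by (simp add: norm_csqrt)
    then have "(csqrt \<longlongrightarrow> 0) (at 0)" by (rule tendsto_norm_zero_cancel)
    then show ?thesis using True by (simp add: isCont_def)
  qed
qed

lemma disc_algebra_csqrt_linear:
  assumes "cmod c \<le> 1" shows "disc_algebra (\<lambda>z. csqrt (1 - c * z))"
proof -
  have le: "Re (1 - c * z) \<ge> 0" if "cmod z \<le> 1" for z
  proof -
    have "cmod (c * z) \<le> 1 * 1" unfolding norm_mult using assms that by (intro mult_mono) auto
    then show ?thesis using complex_Re_le_cmod[of "c * z"] by simp
  qed
  have less: "Re (1 - c * z) > 0" if "cmod z < 1" for z
  proof -
    have "cmod (c * z) \<le> 1 * cmod z" unfolding norm_mult using assms by (intro mult_right_mono) auto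
    then show ?thesis using complex_Re_le_cmod[of "c * z"] that by simp
  qed
  have "continuous_on (cball 0 1) (\<lambda>z. csqrt (1 - c * z))"
    by (rule continuous_on_compose2[OF continuous_on_csqrt_right_half_plane]) (use le in \<open>auto intro!: continuous_intros\<close>)
  moreover have "(\<lambda>z. csqrt (1 - c * z)) holomorphic_on ball 0 1"
  proof (rule holomorphic_on_csqrt')
    show "1 - c * z \<notin> \<real>\<^sub>\<le>\<^sub>0" if "z \<in> ball 0 1" for z
      using less[of z] that by (auto simp: complex_nonpos_Reals_iff)
  qed (intro holomorphic_intros)
  ultimately show ?thesis by (simp add: disc_algebra_def)
qed

text \<open>For \<open>f\<close> in the Hardy space \<open>H\<^sup>1\<close> this is the factorisation of Riesz into two functions of
  \<open>H\<^sup>2\<close> of equal modulus on the circle.\<close>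

definition balanced_factorisation :: "(complex \<Rightarrow> complex) \<Rightarrow> (complex \<Rightarrow> complex) \<Rightarrow> (complex \<Rightarrow> complex) \<Rightarrow> bool" where
  "balanced_factorisation f a b \<longleftrightarrow> disc_algebra a \<and> disc_algebra b \<and>
     (\<forall>z. cmod z = 1 \<longrightarrow> f z = a z * b z \<and> cmod (a z) = cmod (b z))"

lemma balanced_factorisation_const: "\<exists>a b. balanced_factorisation (\<lambda>_. c) a b"
proof (intro exI)
  have "csqrt c * csqrt c = c" using power2_csqrt[of c] by (simp add: power2_eq_square)
  then show "balanced_factorisation (\<lambda>_. c) (\<lambda>_. csqrt c) (\<lambda>_. csqrt c)"
    by (simp add: balanced_factorisation_def disc_algebra_const)
qed

lemma balanced_factorisation_mult:
  assumes "\<exists>a b. balanced_factorisation f a b" "\<exists>a b. balanced_factorisation g a b"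
  shows "\<exists>a b. balanced_factorisation (\<lambda>z. f z * g z) a b"
proof -
  obtain a b c d where "balanced_factorisation f a b" "balanced_factorisation g c d" using assms by blast
  then have "balanced_factorisation (\<lambda>z. f z * g z) (\<lambda>z. a z * c z) (\<lambda>z. b z * d z)"
    by (auto simp: balanced_factorisation_def disc_algebra_mult norm_mult)
  then show ?thesis by blast
qed

text \<open>A root outside the open disc leaves the factor free of zeros in it, and its square root serves for
  both functions. For a root \<open>r\<close> inside, \<open>|z - r| = |1 - cnj r * z|\<close> on the circle; the second expression has no
  zeros in the disc, and its square root is used instead.\<close>

lemma balanced_factorisation_linear: "\<exists>a b. balanced_factorisation (\<lambda>z. z - r) a b"
proof (cases "cmod r \<ge> 1")
  case True
  then have "r \<noteq> 0" by auto
  have "\<exists>a b. balanced_factorisation (\<lambda>z. (- r) * (1 - inverse r * z)) a b"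
  proof (rule balanced_factorisation_mult[OF balanced_factorisation_const], intro exI)
    have "csqrt w * csqrt w = w" for w using power2_csqrt[of w] by (simp add: power2_eq_square)
    then show "balanced_factorisation (\<lambda>z. 1 - inverse r * z) (\<lambda>z. csqrt (1 - inverse r * z)) (\<lambda>z. csqrt (1 - inverse r * z))"
      using True disc_algebra_csqrt_linear[of "inverse r"]
      by (simp add: balanced_factorisation_def norm_inverse inverse_le_1_iff)
  qed
  moreover have "(\<lambda>z. (- r) * (1 - inverse r * z)) = (\<lambda>z. z - r)"
    using \<open>r \<noteq> 0\<close> by (auto simp: field_simps)
  ultimately show ?thesis by simp
next
  case False
  define s where "s z = csqrt (1 - cnj r * z)" for z
  have s: "disc_algebra s" unfolding s_def[abs_def] using False by (intro disc_algebra_csqrt_linear) simp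
  have ss: "s z * s z = 1 - cnj r * z" for z
    using power2_csqrt[of "1 - cnj r * z"] by (simp add: s_def power2_eq_square)
  have s0: "s z \<noteq> 0" if "cmod z \<le> 1" for z
  proof
    assume "s z = 0"
    then have "cnj r * z = 1" using ss[of z] by simp
    then have "cmod r * cmod z = 1" by (metis complex_mod_cnj norm_mult norm_one)
    moreover have "cmod r * cmod z \<le> cmod r * 1" using that by (intro mult_left_mono) auto
    ultimately show False using False by simp
  qed
  have "balanced_factorisation (\<lambda>z. z - r) (\<lambda>z. (z - r) / s z) s"
    unfolding balanced_factorisation_def
  proof (intro conjI allI impI s)
    show "disc_algebra (\<lambda>z. (z - r) / s z)"
      using s s0 by (auto simp: disc_algebra_def intro!: continuous_intros holomorphic_intros)
    fix z :: complex assume z: "cmod z = 1"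
    show "z - r = (z - r) / s z * s z" using s0 z by simp
    have "cmod (z - r) = cmod (cnj (z - r) * z)" using z by (simp add: norm_mult del: complex_cnj_diff)
    also have "cnj (z - r) * z = 1 - cnj r * z"
      using z by (simp add: left_diff_distrib mult.commute[of "cnj z"] complex_norm_square[symmetric])
    finally have "cmod (z - r) = cmod (s z) * cmod (s z)" by (simp add: ss[symmetric] norm_mult)
    then show "cmod ((z - r) / s z) = cmod (s z)" using s0[of z] z by (simp add: norm_divide)
  qed
  then show ?thesis by blast
qed

text \<open>The factorisation is multiplicative, so it is enough to split off one root at a time.\<close>

lemma balanced_factorisation_poly: "\<exists>a b. balanced_factorisation (poly p) a b"
proof (induction "degree p" arbitrary: p)
  case 0
  then obtain c where "p = [:c:]" by (metis degree_eq_zeroE)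
  then show ?case using balanced_factorisation_const[of c] by simp
next
  case (Suc n)
  then have "\<not> constant (poly p)" by (simp add: constant_degree)
  then obtain r where "poly p r = 0" using fundamental_theorem_of_algebra by blast
  then obtain q where q: "p = [:-r, 1:] * q" by (auto simp: poly_eq_0_iff_dvd elim: dvdE)
  then have "q \<noteq> 0" using Suc(2) by auto
  then have "degree q = n" using Suc(2) q by (simp add: degree_mult_eq del: mult_pCons_left)
  then have "\<exists>a b. balanced_factorisation (poly q) a b" using Suc(1) by blast
  from balanced_factorisation_mult[OF balanced_factorisation_linear[of r] this]
  have "\<exists>a b. balanced_factorisation (\<lambda>z. (z - r) * poly q z) a b" .
  moreover have "poly p = (\<lambda>z. (z - r) * poly q z)" by (rule ext) (simp add: q algebra_simps)
  ultimately show ?case by (simp only:)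
qed


section \<open>Nehari's theorem\<close>

text \<open>The intertwining relation moves powers of \<open>z\<close> from one argument of the form \<open>\<langle>G f, g\<rangle>\<close> to the other, so
  that only the functional \<open>f \<mapsto> \<langle>G f, 1\<rangle>\<close> matters.\<close>

lemma intertwiner_coefficients:
  assumes inter: "\<And>f. toeplitz cnj (G f) = G (T_z f)"
  shows "fourier (to_l2 (G f)) (int k) = fourier (to_l2 (G (proj_H2 (mult_op (\<lambda>z. z powi int k) (to_l2 f))))) 0"
proof (induction k arbitrary: f)
  case (Suc k)
  have "fourier (to_l2 (G f)) (int (Suc k)) = fourier (to_l2 (toeplitz cnj (G f))) (int k)"
    by (simp add: fourier_adjoint_T_z add.commute)
  also have "\<dots> = fourier (to_l2 (G (proj_H2 (mult_op (\<lambda>z. z powi int k) (to_l2 (T_z f)))))) 0"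
    unfolding inter by (rule Suc)
  also have "mult_op (\<lambda>z. z powi int k) (to_l2 (T_z f)) = mult_op (\<lambda>z. z powi int (Suc k)) (to_l2 f)"
    using mult_op_powi_powi[of "int k" 1 "to_l2 f"] by (simp add: to_l2_T_z add.commute)
  finally show ?case .
qed simp

text \<open>Moving the powers of \<open>z\<close> in the expansion of \<open>a\<close> to the other side gives \<open>\<langle>G (a b), 1\<rangle> = \<langle>G b, a'\<rangle>\<close>, where \<open>a'\<close>
  has the conjugate coefficients of \<open>a\<close> and therefore the same norm.\<close>

lemma intertwiner_product_bound:
  assumes G: "bounded_clinear_H2 G" and inter: "\<And>f. toeplitz cnj (G f) = G (T_z f)"
    and M: "M \<ge> 0" "\<And>f. norm (G f) \<le> M * norm f"
    and a: "a \<in> H2" and b: "disc_algebra b"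
  shows "cmod (fourier (to_l2 (G (proj_H2 (mult_op (disc_restrict b) a)))) 0)
    \<le> M * norm a * norm (mult_op (disc_restrict b) (zpow 0))"
proof -
  let ?b = "mult_op (disc_restrict b)"
  note bL = disc_restrict_Linf[OF b]
  note Gs = bounded_clinear_H2D[OF G]
  have b1: "?b (zpow 0) \<in> H2"
    by (intro bounded_analytic_mult_H2 bL disc_algebra_fourier_neg b) (simp_all add: zpow_in_H2)
  define g where "g = G (proj_H2 (?b (zpow 0)))"
  define A where "A = {a. fourier (to_l2 (G (proj_H2 (?b a)))) 0 = l2_cinner (flip_op a) (conj_l2 (to_l2 g))}"
  have "a \<in> A"
  proof (rule H2_dense[OF _ _ _ a])
    show "csubspace A"
      using bounded_linear_flip bounded_linear_proj_H2
      by (auto simp: A_def csubspace_def mult_op_plus mult_op_scaleC proj_H2_plus proj_H2_scaleC Gs to_l2_simps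
          fourier_add fourier_scaleC flip_op_plus flip_op_scaleC l2_cinner_add_left l2_cinner_scaleC_left linear_simps)
    show "closed A" unfolding A_def
      by (intro closed_Collect_eq linear_continuous_on bounded_linear_compose[OF bounded_linear_fourier]
          bounded_linear_compose[OF bounded_linear_to_l2] bounded_linear_compose[OF Gs(5)]
          bounded_linear_compose[OF bounded_linear_proj_H2] bounded_linear_mult_op bL
          bounded_linear_compose[OF bounded_linear_cinner_left bounded_linear_flip])
    show "zpow n \<in> A" if "n \<ge> 0" for n
    proof -
      obtain k where n: "n = int k" using \<open>n \<ge> 0\<close> nonneg_int_cases by blast
      have "?b (zpow n) = mult_op (\<lambda>z. z powi n) (?b (zpow 0))"
        by (simp add: mult_op_commute[OF powi_Linf bL] mult_op_powi_zpow)
      then have "fourier (to_l2 (G (proj_H2 (?b (zpow n))))) 0 = fourier (to_l2 g) n"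
        using intertwiner_coefficients[of G "proj_H2 (?b (zpow 0))" k, OF inter]
        by (simp add: n g_def to_l2_proj_H2[OF b1])
      moreover have "flip_op (zpow n) = zpow (- n)"
        by (rule fourier_eqI) (auto simp: fourier_flip fourier_zpow)
      then have "l2_cinner (flip_op (zpow n)) (conj_l2 (to_l2 g)) = fourier (to_l2 g) n"
        by (subst l2_cinner_commute) (simp add: cinner_zpow_right fourier_conj_l2)
      ultimately show ?thesis by (simp add: A_def)
    qed
  qed
  then have "cmod (fourier (to_l2 (G (proj_H2 (?b a)))) 0) = cmod (l2_cinner (flip_op a) (conj_l2 (to_l2 g)))"
    by (simp add: A_def)
  also have "\<dots> \<le> norm a * norm g" using norm_cinner_le[of "flip_op a" "conj_l2 (to_l2 g)"] by (simp add: norm_to_l2)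
  also have "norm g \<le> M * norm (?b (zpow 0))"
    unfolding g_def using M norm_proj_H2_le[of "?b (zpow 0)"] by (meson mult_left_mono order_trans)
  then have "norm a * norm g \<le> norm a * (M * norm (?b (zpow 0)))" by (intro mult_left_mono) simp_all
  finally show ?thesis by (simp add: mult_ac)
qed

definition polyl2 :: "complex poly \<Rightarrow> l2" where
  "polyl2 p = abs_l2 (poly p)"

lemma poly_Linf: "poly p \<in> Linf"
proof -
  have c: "continuous_on S (poly p)" for S :: "complex set" by (intro continuous_intros)
  obtain C where "\<And>z. z \<in> sphere 0 1 \<Longrightarrow> cmod (poly p z) \<le> C"
    using compact_norm_bound[OF _ c, of "sphere 0 1"] by auto
  then show ?thesis by (intro LinfI[where C=C] borel_measurable_continuous_onI c) auto
qed

lemma rep_polyl2: "AE z in circle. rep_l2 (polyl2 p) z = poly p z"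
  unfolding polyl2_def by (intro rep_abs_l2 Linf_sq_integrable poly_Linf)

lemma polyl2_add: "polyl2 (p + q) = polyl2 p + polyl2 q"
proof -
  have "poly (p + q) = (\<lambda>z. poly p z + poly q z)" by (rule ext) simp
  then show ?thesis unfolding polyl2_def using Linf_sq_integrable[OF poly_Linf] by (simp add: abs_l2_eqs)
qed

lemma polyl2_smult: "polyl2 (smult c p) = l2_scaleC c (polyl2 p)"
proof -
  have "poly (smult c p) = (\<lambda>z. c * poly p z)" by (rule ext) simp
  then show ?thesis unfolding polyl2_def using Linf_sq_integrable[OF poly_Linf] by (simp add: abs_l2_eqs)
qed

lemma polyl2_monom: "polyl2 (monom 1 n) = zpow (int n)"
proof -
  have "poly (monom 1 n) = (\<lambda>z::complex. z powi int n)" by (rule ext) (simp add: poly_monom power_int_of_nat)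
  then show ?thesis by (simp add: polyl2_def zpow_def)
qed

text \<open>For a balanced factorisation \<open>p = a b\<close> both \<open>L\<^sup>2\<close> norms in the product bound are the square root of the
  \<open>L\<^sup>1\<close> norm of \<open>p\<close>.\<close>

lemma intertwiner_poly_bound:
  assumes G: "bounded_clinear_H2 G" and inter: "\<And>f. toeplitz cnj (G f) = G (T_z f)"
    and M: "M \<ge> 0" "\<And>f. norm (G f) \<le> M * norm f"
  shows "cmod (fourier (to_l2 (G (proj_H2 (polyl2 p)))) 0) \<le> M * (LINT z|circle. cmod (rep_l2 (polyl2 p) z))"
proof -
  obtain a b where ab: "disc_algebra a" "disc_algebra b"
      "\<And>z. cmod z = 1 \<Longrightarrow> poly p z = a z * b z" "\<And>z. cmod z = 1 \<Longrightarrow> cmod (a z) = cmod (b z)"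
    using balanced_factorisation_poly[of p] by (auto simp: balanced_factorisation_def)
  let ?a = "mult_op (disc_restrict a) (zpow 0)" and ?b = "mult_op (disc_restrict b) (zpow 0)"
  have rep: "AE z in circle. rep_l2 (mult_op (disc_restrict f) (zpow 0)) z = f z" if "disc_algebra f" for f
    using rep_mult[OF disc_restrict_Linf[OF that], of "zpow 0"] rep_zpow[of 0] AE_circle_norm
    by eventually_elim (simp add: disc_restrict_def)
  have aH: "?a \<in> H2" by (intro bounded_analytic_mult_H2 disc_restrict_Linf disc_algebra_fourier_neg ab) (simp_all add: zpow_in_H2)
  have p: "polyl2 p = mult_op (disc_restrict b) ?a"
    by (rule l2_eqI, use rep_polyl2[of p] rep_mult[OF disc_restrict_Linf[OF ab(2)], of ?a] rep[OF ab(1)] AE_circle_norm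
        in \<open>eventually_elim, simp add: ab(3) disc_restrict_def\<close>)
  have na: "(norm ?a)\<^sup>2 = (LINT z|circle. cmod (rep_l2 (polyl2 p) z))" unfolding norm_rep
  proof (rule integral_cong_AE)
    show "AE z in circle. (cmod (rep_l2 ?a z))\<^sup>2 = cmod (rep_l2 (polyl2 p) z)"
      using rep[OF ab(1)] rep_polyl2[of p] AE_circle_norm
      by eventually_elim (simp add: ab(3,4) norm_mult power2_eq_square)
  qed simp_all
  have nb: "norm ?b = norm ?a"
    by (rule norm_l2_cong, use rep[OF ab(1)] rep[OF ab(2)] AE_circle_norm in \<open>eventually_elim, simp add: ab(4)\<close>)
  show ?thesis
    using intertwiner_product_bound[OF G inter M aH ab(2)] unfolding p[symmetric] nb na[symmetric]
    by (simp add: power2_eq_square mult.assoc)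
qed


lemma cnj_sgn_mult: "cnj (sgn w) * w = of_real (cmod w)"
proof (cases "w = 0")
  case False
  have "cnj w * w = (of_real (cmod w))\<^sup>2"
    using complex_norm_square[of w] by (simp add: mult.commute)
  then show ?thesis using False by (simp add: sgn_eq power2_eq_square field_simps)
qed simp

lemma indicator_sgn_Linf:
  assumes "f \<in> borel_measurable borel" "E \<in> sets borel"
  shows "(\<lambda>z. indicator E z * sgn (f z) :: complex) \<in> Linf"
proof (rule LinfI[where C=1])
  have [measurable]: "f \<in> borel_measurable borel" "E \<in> sets borel" by fact+
  show "(\<lambda>z. indicator E z * sgn (f z) :: complex) \<in> borel_measurable borel"
    unfolding sgn_div_norm by measurable
  show "cmod (indicator E z * sgn (f z)) \<le> 1" for z
    by (auto simp: indicator_def norm_sgn)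
qed

text \<open>The extension \<open>F\<close> of the functional \<open>f \<mapsto> Re \<langle>G f, 1\<rangle>\<close> is bounded in the \<open>L\<^sup>1\<close> norm and a fortiori in the
  \<open>L\<^sup>2\<close> norm. So it is represented by some \<open>\<phi>\<close> in \<^typ>\<open>l2\<close>, and testing with \<open>sgn \<phi>\<close> on Borel sets gives
  \<open>|\<phi>| \<le> M\<close>. The symbol is \<open>\<phi>\<close> after the reflection that is built into the definition of \<^const>\<open>hankel\<close>.\<close>

theorem nehari:
  assumes G: "bounded_clinear_H2 G" and inter: "\<And>f. toeplitz cnj (G f) = G (T_z f)"
  shows "is_hankel G"
proof -
  note Gs = bounded_clinear_H2D[OF G]
  obtain M where M: "M \<ge> 0" "\<And>f. norm (G f) \<le> M * norm f"
    using bounded_linear.nonneg_bounded[OF Gs(5)] by (metis mult.commute)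
  define L where "L f = fourier (to_l2 (G (proj_H2 f))) 0" for f
  have L_add: "L (f + g) = L f + L g" for f g by (simp add: L_def proj_H2_plus Gs to_l2_simps fourier_add)
  have L_scaleC: "L (l2_scaleC c f) = c * L f" for c f by (simp add: L_def proj_H2_scaleC Gs to_l2_simps fourier_scaleC)
  define N where "N f = M * (LINT z|circle. cmod (rep_l2 f z))" for f
  define V where "V = range polyl2"
  have N_le: "N f \<le> M * norm f" for f
    unfolding N_def using M L1_norm_le(2)[of f] by (intro mult_left_mono) simp_all
  obtain F where F: "linear F" "\<And>f. f \<in> V \<Longrightarrow> F f = Re (L f)" "\<And>f. F f \<le> N f"
  proof (rule hahn_banach_sublinear[of N V "\<lambda>f. Re (L f)"])
    fix f g :: l2
    have "(LINT z|circle. cmod (rep_l2 (f + g) z)) \<le> (LINT z|circle. cmod (rep_l2 f z) + cmod (rep_l2 g z))"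
    proof (rule integral_mono_AE)
      show "AE z in circle. cmod (rep_l2 (f + g) z) \<le> cmod (rep_l2 f z) + cmod (rep_l2 g z)"
        using rep_plus[of f g] by eventually_elim (simp add: norm_triangle_ineq)
    qed (simp_all add: L1_norm_le)
    also have "\<dots> = (LINT z|circle. cmod (rep_l2 f z)) + (LINT z|circle. cmod (rep_l2 g z))"
      by (intro Bochner_Integration.integral_add L1_norm_le)
    finally show "N (f + g) \<le> N f + N g"
      unfolding N_def using M(1) by (simp add: distrib_left[symmetric] mult_left_mono)
  next
    fix r :: real and f :: l2 assume "r \<ge> 0"
    have "(LINT z|circle. cmod (rep_l2 (r *\<^sub>R f) z)) = (LINT z|circle. r * cmod (rep_l2 f z))"
    proof (rule integral_cong_AE)
      show "AE z in circle. cmod (rep_l2 (r *\<^sub>R f) z) = r * cmod (rep_l2 f z)"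
        using rep_scaleC[of "of_real r" f] unfolding scaleR_scaleC
        by eventually_elim (simp add: norm_mult \<open>r \<ge> 0\<close>)
    qed simp_all
    then show "N (r *\<^sub>R f) = r * N f" by (simp add: N_def)
  next
    have "polyl2 0 = 0" using polyl2_smult[of 0 0] by simp
    then show "subspace V"
      by (auto simp: V_def subspace_def scaleR_scaleC polyl2_add[symmetric] polyl2_smult[symmetric] intro: range_eqI)
  next
    fix f assume "f \<in> V"
    then obtain p where "f = polyl2 p" by (auto simp: V_def)
    then have "cmod (L f) \<le> N f"
      using intertwiner_poly_bound[OF G inter M, of p] by (simp add: L_def N_def)
    then show "Re (L f) \<le> N f" using complex_Re_le_cmod[of "L f"] by linarith
  qed (use that in \<open>simp_all add: L_add L_scaleC scaleR_scaleC\<close>)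
  have "bounded_linear F"
  proof (rule bounded_linear_intro[where K=M])
    fix f :: l2
    have "F f \<le> M * norm f" "F (- f) \<le> M * norm (- f)" using F(3) N_le order_trans by blast+
    then show "norm (F f) \<le> norm f * M" using linear_neg[OF F(1), of f] by (simp add: mult.commute abs_le_iff)
  qed (simp_all add: linear_add[OF F(1)] linear_scale[OF F(1)])
  moreover have "complete (UNIV :: l2 set)" by (rule complete_UNIV)
  ultimately obtain \<phi> where \<phi>: "\<And>f. F f = inner f \<phi>" using riesz_representation by blast
  have L_poly: "L (polyl2 p) = l2_cinner (polyl2 p) \<phi>" for p
  proof (rule complex_eqI)
    \<comment> \<open>the real parts agree by construction; the imaginary parts follow by applying this to \<open>\<i> p\<close>\<close>
    have re: "Re (L (polyl2 p)) = Re (l2_cinner (polyl2 p) \<phi>)" for p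
      using F(2)[of "polyl2 p"] \<phi>[of "polyl2 p"] by (simp add: V_def inner_l2_def)
    show "Re (L (polyl2 p)) = Re (l2_cinner (polyl2 p) \<phi>)" by (rule re)
    show "Im (L (polyl2 p)) = Im (l2_cinner (polyl2 p) \<phi>)"
      using re[of "smult \<i> p"] by (simp add: polyl2_smult L_scaleC l2_cinner_scaleC_left)
  qed
  have bdd: "AE z in circle. cmod (rep_l2 \<phi> z) \<le> M"
  proof (rule AE_norm_le_if_averages_le)
    show "integrable circle (rep_l2 \<phi>)" by (simp add: sq_integrable_integrable)
    fix E :: "complex set" assume E[measurable]: "E \<in> sets borel"
    define h where "h z = indicator E z * sgn (rep_l2 \<phi> z)" for z
    have h: "h \<in> Linf" unfolding h_def by (rule indicator_sgn_Linf) simp_all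
    note rep_h = rep_abs_l2[OF Linf_sq_integrable[OF h]]
    have "l2_cinner \<phi> (abs_l2 h) = (LINT z|circle. complex_of_real (indicator E z * cmod (rep_l2 \<phi> z)))"
      unfolding l2_cinner_rep
    proof (rule integral_cong_AE)
      show "AE z in circle. rep_l2 \<phi> z * cnj (rep_l2 (abs_l2 h) z) = complex_of_real (indicator E z * cmod (rep_l2 \<phi> z))"
        using rep_h by eventually_elim (simp add: h_def indicator_def cnj_sgn_mult[unfolded mult.commute[of "cnj _"]])
    qed simp_all
    then have "(LINT z|circle. indicator E z * cmod (rep_l2 \<phi> z)) = Re (l2_cinner \<phi> (abs_l2 h))"
      by (simp only: integral_complex_of_real Re_complex_of_real)
    also have "\<dots> = F (abs_l2 h)" by (simp only: \<phi> inner_commute[of _ \<phi>]) (simp add: inner_l2_def)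
    also have "\<dots> \<le> N (abs_l2 h)" by (rule F(3))
    also have "\<dots> \<le> M * measure circle E"
    proof -
      have "(LINT z|circle. cmod (rep_l2 (abs_l2 h) z)) \<le> (LINT z|circle. indicator E z)"
      proof (rule integral_mono_AE)
        show "integrable circle (\<lambda>z. cmod (rep_l2 (abs_l2 h) z))" by (rule L1_norm_le)
        show "integrable circle (\<lambda>z. indicator E z :: real)" by (simp add: less_top[symmetric])
        show "AE z in circle. cmod (rep_l2 (abs_l2 h) z) \<le> indicator E z"
          using rep_h by eventually_elim (auto simp: h_def indicator_def norm_sgn)
      qed
      then show ?thesis unfolding N_def using M(1) by (intro mult_left_mono) simp_all
    qed
    finally show "(LINT z|circle. indicator E z * cmod (rep_l2 \<phi> z)) \<le> M * measure circle E" .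
  qed
  define \<psi> where "\<psi> z = cnj (rep_l2 \<phi> (cnj z))" for z
  have "rep_l2 \<phi> \<in> Linf" using bdd by (auto simp: Linf_def)
  then have \<psi>: "\<psi> \<in> Linf" unfolding \<psi>_def by (intro Linf_cnj Linf_flip)
  have "G = hankel \<psi>"
  proof (rule bounded_clinear_H2_eqI[OF G bounded_clinear_hankel[OF \<psi>]], rule h2_eqI)
    fix n k :: int assume n: "n \<ge> 0" and k: "k \<ge> 0"
    have "fourier (to_l2 (G (hpow n))) k = L (mult_op (\<lambda>z. z powi k) (zpow n))"
      using intertwiner_coefficients[of G "hpow n" "nat k", OF inter] n k by (simp add: L_def)
    also have "\<dots> = L (polyl2 (monom 1 (nat (k + n))))" using n k by (simp add: mult_op_powi_zpow polyl2_monom)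
    also have "\<dots> = cnj (fourier \<phi> (k + n))"
      unfolding L_poly using n k by (subst l2_cinner_commute) (simp add: polyl2_monom cinner_zpow_right)
    finally have 1: "fourier (to_l2 (G (hpow n))) k = cnj (fourier \<phi> (k + n))" .
    have fz: "flip_op (zpow n) = zpow (- n)" by (rule fourier_eqI) (auto simp: fourier_flip fourier_zpow)
    have "mult_op \<psi> (zpow (- n)) = mult_op (\<lambda>z. z powi (- n)) (conj_l2 (flip_op \<phi>))"
      by (rule l2_eqI, use rep_mult[OF \<psi>, of "zpow (- n)"] rep_mult[OF powi_Linf, of "- n" "conj_l2 (flip_op \<phi>)"]
          rep_zpow[of "- n"] rep_conj_l2[of "flip_op \<phi>"] rep_flip[of \<phi>]
          in \<open>eventually_elim, simp add: mult.commute \<psi>_def\<close>)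
    then have "fourier (to_l2 (hankel \<psi> (hpow n))) k = cnj (fourier \<phi> (k + n))"
      using n k by (simp add: fourier_hankel fz fourier_mult_powi fourier_conj_l2 fourier_flip add.commute)
    with 1 show "fourier (to_l2 (G (hpow n))) k = fourier (to_l2 (hankel \<psi> (hpow n))) k" by simp
  qed
  with \<psi> show ?thesis by (auto simp: is_hankel_def)
qed


section \<open>Beurling's theorem\<close>

text \<open>The hypotheses say that \<open>|w|\<^sup>2\<close> has the Fourier coefficients of the constant 1. This function is
  only integrable, so uniqueness of coefficients is needed beyond \<open>L\<^sup>2\<close>.\<close>

lemma unimodular_if_orthogonal_shifts:
  assumes norm: "norm w = 1" and orth: "\<And>n. n > 0 \<Longrightarrow> l2_cinner (mult_op (\<lambda>z. z powi n) w) w = 0"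
  shows "AE z in circle. cmod (rep_l2 w z) = 1"
proof -
  define f where "f z = complex_of_real ((cmod (rep_l2 w z))\<^sup>2) - 1" for z
  have i: "integrable circle (\<lambda>z. complex_of_real ((cmod (rep_l2 w z))\<^sup>2))"
    using rep_l2_sq_integrable[of w] unfolding sq_integrable_def by (intro integrable_of_real) auto
  have coef: "(LINT z|circle. complex_of_real ((cmod (rep_l2 w z))\<^sup>2) * z powi n) = l2_cinner (mult_op (\<lambda>z. z powi n) w) w" for n
    unfolding cinner_mult_left[OF powi_Linf] by (simp only: complex_norm_square mult_ac)
  have "(LINT z|circle. complex_of_real ((cmod (rep_l2 w z))\<^sup>2) * z powi n) = of_bool (n = 0)" for n
  proof (cases n "0 :: int" rule: linorder_cases)
    case equal
    then show ?thesis unfolding coef using cinner_self[of w] norm by simp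
  next
    case greater
    then show ?thesis unfolding coef using orth by simp
  next
    case less
    have "l2_cinner (mult_op (\<lambda>z. z powi n) w) w = l2_cinner w (mult_op (\<lambda>z. z powi (- n)) w)"
      unfolding mult_op_adjoint[OF powi_Linf] cnj_powi_mult_op ..
    also have "\<dots> = cnj (l2_cinner (mult_op (\<lambda>z. z powi (- n)) w) w)" by (rule l2_cinner_commute)
    finally show ?thesis unfolding coef using orth[of "- n"] less by simp
  qed
  then have "(LINT z|circle. f z * z powi n) = 0" for n
    unfolding f_def left_diff_distrib
    by (subst Bochner_Integration.integral_diff)
      (simp_all add: integrable_powi_mult[OF i] integrable_powi_mult[of "\<lambda>_. 1", simplified] circle_integral_powi del: of_real_power)
  moreover have "integrable circle f" unfolding f_def by (intro Bochner_Integration.integrable_diff i) simp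
  ultimately have "AE z in circle. f z = 0" by (intro integrable_mult_powi_eq_zero)
  then show ?thesis
  proof eventually_elim
    case (elim z)
    then have "complex_of_real ((cmod (rep_l2 w z))\<^sup>2) = of_real 1" by (simp add: f_def)
    then have "(cmod (rep_l2 w z))\<^sup>2 = 1" by (simp only: of_real_eq_iff)
    then show ?case using power2_eq_imp_eq[of "cmod (rep_l2 w z)" 1] by simp
  qed
qed

text \<open>A unit vector \<open>w\<close> in \<open>M\<close> orthogonal to \<open>N = z M\<close> is orthogonal to all \<open>z\<^sup>n w\<close> with \<open>n > 0\<close>, hence unimodular.
  If \<open>g\<close> lies in \<open>M\<close>, then \<open>cnj w * g\<close> has no negative coefficients, since these are the inner products of \<open>z\<^sup>n g\<close> with
  \<open>w\<close>; so \<open>g\<close> is \<open>w\<close> times an element of \<^const>\<open>H2\<close>.\<close>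

theorem beurling:
  assumes M: "csubspace M" "closed M" "M \<subseteq> H2" "M \<noteq> {0}"
    and inv: "\<And>f. f \<in> M \<Longrightarrow> mult_op (\<lambda>z. z) f \<in> M"
  obtains u where "u \<in> Linf" "AE z in circle. cmod (u z) = 1" "mult_op u (zpow 0) \<in> H2" "M = mult_op u ` H2"
proof -
  let ?z = "\<lambda>n. mult_op (\<lambda>z. z powi n)"
  have inv1: "?z 1 f \<in> M" if "f \<in> M" for f using inv[OF that] by simp
  have inv_pow: "?z (int n) f \<in> M" if "f \<in> M" for n f
  proof (induction n)
    case (Suc n)
    from inv1[OF this] show ?case by (simp only: mult_op_powi_powi of_nat_Suc)
  qed (use that in simp)
  define N where "N = {f. ?z (-1) f \<in> M}"
  have N_cs: "csubspace N" using M(1) by (auto simp: N_def csubspace_def mult_op_plus mult_op_scaleC)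
  have "continuous_on UNIV (?z (-1))"
    by (intro linear_continuous_on bounded_linear_mult_op powi_Linf)
  then have "closed (?z (-1) -` M)" by (intro closed_vimage M(2))
  then have N_cl: "closed N" by (simp add: N_def vimage_def)
  have N_sub: "N \<subseteq> M"
  proof
    fix f assume "f \<in> N"
    then have "?z 1 (?z (-1) f) \<in> M" by (intro inv1) (simp add: N_def)
    then show "f \<in> M" by (simp only: mult_op_powi_powi) simp
  qed
  have shift_N: "?z n f \<in> N" if "f \<in> M" "n > 0" for f n
    using inv_pow[OF that(1), of "nat (n - 1)"] that(2) unfolding N_def mem_Collect_eq mult_op_powi_powi by simp
  \<comment> \<open>An element of least vanishing order at the origin is not divisible by \<open>z\<close> in \<open>M\<close>.\<close>
  obtain f where f: "f \<in> M" "f \<notin> N"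
  proof -
    have "0 \<in> M" using M(1) by (simp add: csubspace_def)
    then obtain f0 where "f0 \<in> M" "f0 \<noteq> 0" using M(4) by blast
    then obtain n where n: "fourier f0 n \<noteq> 0" using fourier_eqI[of f0 0] by auto
    then have "n \<ge> 0" using \<open>f0 \<in> M\<close> M(3) by (force simp: H2_iff)
    define P where "P k \<longleftrightarrow> (\<exists>f\<in>M. fourier f (int k) \<noteq> 0)" for k
    have "P (nat n)" using \<open>f0 \<in> M\<close> n \<open>n \<ge> 0\<close> by (auto simp: P_def)
    define k where "k = (LEAST k. P k)"
    have "P k" unfolding k_def using \<open>P (nat n)\<close> by (rule LeastI)
    then obtain f where f: "f \<in> M" "fourier f (int k) \<noteq> 0" by (auto simp: P_def)
    have "f \<notin> N"
    proof
      assume "f \<in> N"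
      then have g: "?z (-1) f \<in> M" by (simp add: N_def)
      have c: "fourier (?z (-1) f) (int k - 1) \<noteq> 0" using f(2) unfolding fourier_mult_powi by simp
      show False
      proof (cases k)
        case 0
        then show False using c g M(3) by (force simp: H2_iff)
      next
        case (Suc j)
        then have "P j" using c g by (auto simp: P_def)
        then have "k \<le> j" unfolding k_def by (rule Least_le)
        then show False using Suc by simp
      qed
    qed
    with f show thesis using that by blast
  qed
  obtain m where m: "m \<in> N" "\<And>v. v \<in> N \<Longrightarrow> l2_cinner (f - m) v = 0"
    using complex_projection[OF N_cs N_cl] by blast
  have "f - m \<noteq> 0" using m(1) f(2) by auto
  define w where "w = l2_scaleC (of_real (1 / norm (f - m))) (f - m)"
  have w_norm: "norm w = 1" using \<open>f - m \<noteq> 0\<close> by (simp add: w_def norm_scaleC norm_divide)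
  have "f - m \<in> M" using M(1) f(1) m(1) N_sub by (intro csubspace_diff) auto
  then have wM: "w \<in> M" using M(1) by (simp add: w_def csubspace_def)
  have w_orth: "l2_cinner v w = 0" if "v \<in> N" for v
    using m(2)[OF that] by (subst l2_cinner_commute) (simp add: w_def l2_cinner_scaleC_left)
  have uni: "AE z in circle. cmod (rep_l2 w z) = 1"
    by (intro unimodular_if_orthogonal_shifts w_norm w_orth shift_N wM)
  define u where "u = rep_l2 w"
  have u: "u \<in> Linf"
    using uni by (auto simp: u_def Linf_def intro!: exI[of _ 1] elim: eventually_mono)
  have u_inv: "mult_op u (mult_op (\<lambda>z. cnj (u z)) g) = g" for g
    unfolding mult_op_mult[OF u Linf_cnj[OF u]]
  proof (rule trans[OF mult_op_cong mult_op_1])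
    show "AE z in circle. u z * cnj (u z) = 1"
      using uni unfolding u_def by eventually_elim (simp add: complex_norm_square[symmetric])
  qed (intro Linf_mult u Linf_cnj Linf_1)+
  have u_w: "mult_op u (zpow n) = ?z n w" for n
    by (rule l2_eqI, use rep_mult[OF u, of "zpow n"] rep_mult[OF powi_Linf, of n w] rep_zpow[of n]
        in \<open>eventually_elim, simp add: u_def mult.commute\<close>)
  have u0: "mult_op u (zpow 0) = w" unfolding u_w by simp
  have "mult_op u h \<in> M" if "h \<in> H2" for h
  proof -
    have "h \<in> {h. mult_op u h \<in> M}"
    proof (rule H2_dense[OF _ _ _ that])
      show "csubspace {h. mult_op u h \<in> M}" using M(1) by (auto simp: csubspace_def mult_op_plus mult_op_scaleC)
      have "continuous_on UNIV (mult_op u)" by (intro linear_continuous_on bounded_linear_mult_op u)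
      then have "closed (mult_op u -` M)" by (intro closed_vimage M(2))
      then show "closed {h. mult_op u h \<in> M}" by (simp add: vimage_def)
      show "zpow n \<in> {h. mult_op u h \<in> M}" if "n \<ge> 0" for n
        using inv_pow[OF wM, of "nat n"] that by (simp add: u_w)
    qed
    then show ?thesis by simp
  qed
  moreover have "g \<in> mult_op u ` H2" if g: "g \<in> M" for g
  proof -
    have "mult_op (\<lambda>z. cnj (u z)) g \<in> H2"
      unfolding H2_iff
    proof (intro allI impI)
      fix n :: int assume "n < 0"
      have "fourier (mult_op (\<lambda>z. cnj (u z)) g) n = l2_cinner g (mult_op u (zpow n))"
        unfolding cinner_zpow_right[symmetric] mult_op_adjoint[OF Linf_cnj[OF u]] by simp
      also have "\<dots> = l2_cinner (?z (- n) g) w"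
        unfolding u_w mult_op_adjoint[OF powi_Linf] cnj_powi_mult_op by simp
      also have "\<dots> = 0" using \<open>n < 0\<close> by (intro w_orth shift_N g) simp
      finally show "fourier (mult_op (\<lambda>z. cnj (u z)) g) n = 0" .
    qed
    then show ?thesis using u_inv[of g] by (metis imageI)
  qed
  ultimately have "M = mult_op u ` H2" by blast
  moreover have "mult_op u (zpow 0) \<in> H2" using wM M(3) by (auto simp: u0)
  moreover have "AE z in circle. cmod (u z) = 1" using uni by (simp add: u_def)
  ultimately show thesis using that u by blast
qed


section \<open>Taylor polynomials in the Hardy space\<close>

definition taylor_sum :: "nat \<Rightarrow> l2 \<Rightarrow> l2" where
  "taylor_sum N f = (\<Sum>n<N. l2_scaleC (fourier f (int n)) (zpow (int n)))"

lemma fourier_sum: "fourier (sum f A) n = (\<Sum>x\<in>A. fourier (f x) n)"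
  by (induction A rule: infinite_finite_induct) (simp_all add: fourier_add)

lemma fourier_taylor_sum: "fourier (taylor_sum N f) k = (if 0 \<le> k \<and> k < int N then fourier f k else 0)"
proof -
  have "fourier (taylor_sum N f) k = (\<Sum>n<N. if n = nat k \<and> k \<ge> 0 then fourier f k else 0)"
    unfolding taylor_sum_def fourier_sum
    by (intro sum.cong) (auto simp: fourier_scaleC fourier_zpow)
  also have "\<dots> = (if 0 \<le> k \<and> k < int N then fourier f k else 0)"
    by (cases "k \<ge> 0") auto
  finally show ?thesis .
qed

lemma cinner_taylor_sum:
  "l2_cinner g (taylor_sum N f) = (\<Sum>n<N. cnj (fourier f (int n)) * fourier g (int n))"
  unfolding taylor_sum_def
  by (induction N) (simp_all add: l2_cinner_add_right l2_cinner_scaleC_right cinner_zpow_right)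

lemma norm_taylor_sum: "(norm (taylor_sum N f))\<^sup>2 = (\<Sum>n<N. (cmod (fourier f (int n)))\<^sup>2)"
proof -
  have "complex_of_real ((norm (taylor_sum N f))\<^sup>2) = (\<Sum>n<N. complex_of_real ((cmod (fourier f (int n)))\<^sup>2))"
    unfolding cinner_self[symmetric] cinner_taylor_sum
    by (intro sum.cong) (simp_all only: fourier_taylor_sum complex_norm_square mult.commute, simp)
  then show ?thesis by (simp only: of_real_sum[symmetric] of_real_eq_iff)
qed

lemma norm_taylor_sum_le: "norm (taylor_sum N f) \<le> norm f"
proof -
  have "l2_cinner f (taylor_sum N f) = l2_cinner (taylor_sum N f) (taylor_sum N f)"
    unfolding cinner_taylor_sum by (intro sum.cong) (simp_all add: fourier_taylor_sum)
  then have "(norm (taylor_sum N f))\<^sup>2 = cmod (l2_cinner f (taylor_sum N f))"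
    by (simp only: cinner_self norm_of_real abs_power2)
  also have "\<dots> \<le> norm f * norm (taylor_sum N f)" by (rule norm_cinner_le)
  finally show ?thesis by (cases "norm (taylor_sum N f) = 0") (auto simp: power2_eq_square)
qed

lemma bessel: "(\<Sum>n<N. (cmod (fourier f (int n)))\<^sup>2) \<le> (norm f)\<^sup>2"
  unfolding norm_taylor_sum[symmetric] by (intro power_mono norm_taylor_sum_le) simp

lemma taylor_sum_minus: "taylor_sum N (f - g) = taylor_sum N f - taylor_sum N g"
  by (rule fourier_eqI) (simp add: fourier_taylor_sum fourier_minus)

lemma taylor_sum_tendsto:
  assumes "f \<in> H2" shows "(\<lambda>N. taylor_sum N f) \<longlonglongrightarrow> f"
proof -
  let ?C = "{f. convergent (\<lambda>N. taylor_sum N f)}"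
  have "f \<in> ?C"
  proof (rule H2_dense[OF _ _ _ assms])
    have "taylor_sum N 0 = 0" "taylor_sum N (f + g) = taylor_sum N f + taylor_sum N g"
      "taylor_sum N (l2_scaleC c f) = l2_scaleC c (taylor_sum N f)" for N f g c
      by (rule fourier_eqI, simp add: fourier_taylor_sum fourier_add fourier_scaleC)+
    then show "csubspace ?C"
      by (auto simp: csubspace_def intro: convergent_add)
        (auto simp: convergent_def intro: bounded_linear.tendsto[OF bounded_linear_scaleC])
    show "closed ?C"
      by (rule uniformly_bounded_convergent_closed[where K=1]) (simp_all add: taylor_sum_minus norm_taylor_sum_le)
    show "zpow n \<in> ?C" if "n \<ge> 0" for n
    proof -
      have "taylor_sum (N + nat (n + 1)) (zpow n) = zpow n" for N
        by (rule fourier_eqI) (use that in \<open>auto simp: fourier_taylor_sum fourier_zpow\<close>)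
      then have "(\<lambda>N. taylor_sum (N + nat (n + 1)) (zpow n)) \<longlonglongrightarrow> zpow n" by simp
      then have "(\<lambda>N. taylor_sum N (zpow n)) \<longlonglongrightarrow> zpow n" by (rule LIMSEQ_offset)
      then show ?thesis by (auto simp: convergent_def)
    qed
  qed
  then obtain g where g: "(\<lambda>N. taylor_sum N f) \<longlonglongrightarrow> g" by (auto simp: convergent_def)
  have "f = g"
  proof (rule fourier_eqI)
    fix k
    have "(\<lambda>N. fourier (taylor_sum N f) k) \<longlonglongrightarrow> fourier g k"
      by (rule bounded_linear.tendsto[OF bounded_linear_fourier g])
    moreover have "(\<lambda>N. fourier (taylor_sum N f) k) \<longlonglongrightarrow> fourier f k"
      by (rule tendsto_eventually, use eventually_gt_at_top[of "nat k"] in eventually_elim)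
        (use assms in \<open>auto simp: fourier_taylor_sum H2_iff\<close>)
    ultimately show "fourier f k = fourier g k" by (rule LIMSEQ_unique[rotated])
  qed
  with g show ?thesis by simp
qed


section \<open>Radial derivatives of disc algebra functions\<close>

text \<open>On the circle the Poisson kernel equals \<open>h w * w / (w - a)\<close> with the analytic function
  \<open>h w = (1 - |a|\<^sup>2) / (1 - cnj a * w)\<close>, and \<open>h a = 1\<close>; Cauchy's formula gives the integral.\<close>

lemma poisson_integral:
  assumes a: "cmod a < 1"
  shows "integrable circle (\<lambda>w. (1 - (cmod a)\<^sup>2) / (cmod (w - a))\<^sup>2)"
    and "(LINT w|circle. (1 - (cmod a)\<^sup>2) / (cmod (w - a))\<^sup>2) = 1"
proof -
  have far: "cmod (w - a) \<ge> 1 - cmod a" if "cmod w = 1" for w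
    using norm_triangle_ineq2[of w a] that by simp
  have sq: "(cmod a)\<^sup>2 < 1" using a by (simp add: power_less_one_iff abs_square_less_1)
  show "integrable circle (\<lambda>w. (1 - (cmod a)\<^sup>2) / (cmod (w - a))\<^sup>2)"
  proof (rule circle.integrable_const_bound[where B="(1 - (cmod a)\<^sup>2) / (1 - cmod a)\<^sup>2"])
    show "AE w in circle. norm ((1 - (cmod a)\<^sup>2) / (cmod (w - a))\<^sup>2) \<le> (1 - (cmod a)\<^sup>2) / (1 - cmod a)\<^sup>2"
      using AE_circle_norm
    proof eventually_elim
      case (elim w)
      have "norm ((1 - (cmod a)\<^sup>2) / (cmod (w - a))\<^sup>2) = (1 - (cmod a)\<^sup>2) / (cmod (w - a))\<^sup>2"
        using sq by simp
      also have "\<dots> \<le> (1 - (cmod a)\<^sup>2) / (1 - cmod a)\<^sup>2"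
        using a sq far[OF elim] by (intro divide_left_mono power_mono mult_pos_pos zero_less_power) auto
      finally show ?case .
    qed
  qed measurable
  define h where "h w = complex_of_real (1 - (cmod a)\<^sup>2) / (1 - cnj a * w)" for w
  \<comment> \<open>the pole of \<open>h\<close> is the reflection of \<open>a\<close> in the circle\<close>
  have nz: "1 - cnj a * w \<noteq> 0" if "cmod w \<le> 1" for w
  proof
    assume "1 - cnj a * w = 0"
    then have "cnj a * w = 1" by simp
    then have "cmod a * cmod w = 1" by (metis complex_mod_cnj norm_mult norm_one)
    moreover have "cmod a * cmod w \<le> cmod a * 1" using that by (intro mult_left_mono) auto
    ultimately show False using a by simp
  qed
  have h: "h holomorphic_on cball 0 1" unfolding h_def using nz by (intro holomorphic_intros) auto
  have ha: "h a = 1"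
  proof -
    have "1 - cnj a * a = complex_of_real (1 - (cmod a)\<^sup>2)"
      by (simp add: complex_norm_square[unfolded of_real_power] mult.commute)
    then show ?thesis using nz[of a] a by (simp add: h_def)
  qed
  have "contour_integral (circlepath 0 1) (\<lambda>w. h w / (w - a)) = 2 * of_real pi * \<i> * h a"
    by (rule contour_integral_unique, rule Cauchy_integral_circlepath_simple[OF h]) (use a in simp)
  moreover have "contour_integral (circlepath 0 1) (\<lambda>w. h w / (w - a)) =
      2 * of_real pi * \<i> * (LINT w|circle. complex_of_real ((1 - (cmod a)\<^sup>2) / (cmod (w - a))\<^sup>2))"
  proof (rule contour_integral_circle)
    show "continuous_on (sphere 0 1) (\<lambda>w. h w / (w - a))"
      using a by (intro continuous_intros continuous_on_subset[OF holomorphic_on_imp_continuous_on[OF h]]) auto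
    fix w :: complex assume w: "cmod w = 1"
    have "(of_real (cmod (w - a)))\<^sup>2 = (w - a) * cnj (w - a)" by (simp add: complex_norm_square[unfolded of_real_power])
    also have "\<dots> * w = (w - a) * (cnj w * w - cnj a * w)" by (simp add: algebra_simps)
    also have "cnj w * w = 1" using w by (simp add: mult.commute complex_norm_square[symmetric])
    finally have e: "(complex_of_real (cmod (w - a)))\<^sup>2 * w = (w - a) * (1 - cnj a * w)" .
    have w0: "w \<noteq> 0" "w - a \<noteq> 0" using w a by auto
    show "complex_of_real ((1 - (cmod a)\<^sup>2) / (cmod (w - a))\<^sup>2) = h w / (w - a) * w"
      using e w0 nz[of w] w by (simp add: h_def frac_eq_eq mult_ac)
  qed measurable
  ultimately have "(LINT w|circle. complex_of_real ((1 - (cmod a)\<^sup>2) / (cmod (w - a))\<^sup>2)) = 1" by (simp add: ha)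
  then show "(LINT w|circle. (1 - (cmod a)\<^sup>2) / (cmod (w - a))\<^sup>2) = 1"
    by (simp only: integral_complex_of_real of_real_eq_1_iff)
qed

text \<open>Cauchy's formula for the derivative has the kernel \<open>1 / (w - a)\<^sup>2\<close>, whose product with \<open>|w - w0|\<close> is not bounded in
  \<open>L\<^sup>1\<close> as \<open>a\<close> approaches \<open>w0\<close>. Subtracting the kernel of the reflected point \<open>b\<close>, which lies outside the disc and
  contributes nothing, leaves the kernel \<open>K\<close> of size \<open>(1 - r\<^sup>2) / |w - a|\<^sup>3\<close>; its product with
  \<open>|w - w0|\<close> is dominated by the Poisson kernel.\<close>

lemma deriv_bound_from_boundary_modulus:
  assumes R: "disc_algebra R" and w0: "cmod w0 = 1" and r: "0 < r" "r < 1"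
    and bound: "\<And>w. cmod w = 1 \<Longrightarrow> cmod (R w) \<le> \<epsilon> * cmod (w - w0) + D * cmod (w - w0) ^ 3"
    and pos: "\<epsilon> \<ge> 0" "D \<ge> 0"
  shows "cmod (deriv R (of_real r * w0)) \<le> 4 * \<epsilon> + 16 * D * (1 - r\<^sup>2)"
proof -
  define a b where "a = of_real r * w0" and "b = w0 / of_real r"
  have a: "cmod a = r" "a \<in> ball 0 1" and b: "cmod b > 1" using w0 r by (auto simp: a_def b_def norm_mult norm_divide)
  have Rc: "continuous_on (cball 0 1) R" and Rh: "R holomorphic_on ball 0 1" using R by (auto simp: disc_algebra_def)
  have r2: "1 - r\<^sup>2 \<ge> 0" "r\<^sup>2 < 1" using r by (auto simp: abs_square_less_1 power_le_one_iff)
  define K where "K w = 1 / (w - a)\<^sup>2 - 1 / (w - b)\<^sup>2" for w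
  have K_bound: "cmod (K w) \<le> 2 * (1 - r\<^sup>2) / cmod (w - a) ^ 3"
    and dist_bound: "cmod (w - w0) \<le> 2 * cmod (w - a)" and wa: "cmod (w - a) > 0" if w: "cmod w = 1" for w
  proof -
    define x where "x = cmod (w - a)"
    have x: "x \<ge> 1 - r" using norm_triangle_ineq2[of w a] w a by (simp add: x_def)
    then have x0: "x > 0" using r by simp
    then show "cmod (w - a) > 0" by (simp add: x_def)
    have nz: "w - a \<noteq> 0" "w - b \<noteq> 0" using x0 w b by (auto simp: x_def)
    have "cnj w * w = 1" "cnj w0 * w0 = 1" using w w0 by (simp_all add: mult.commute complex_norm_square[symmetric])
    moreover have "cnj w * cnj w0 * (of_real r * w - w0) = of_real r * cnj w0 * (cnj w * w) - cnj w * (cnj w0 * w0)"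
      by (simp add: right_diff_distrib mult_ac)
    ultimately have "cnj w * cnj w0 * (of_real r * w - w0) = - cnj (w - a)" by (simp add: a_def)
    then have "cmod (cnj w * cnj w0 * (of_real r * w - w0)) = x" unfolding x_def by (simp only: norm_minus_cancel complex_mod_cnj)
    then have "cmod (of_real r * w - w0) = x" using w w0 by (simp add: norm_mult)
    moreover have "of_real r * (w - b) = of_real r * w - w0" using r by (simp add: b_def right_diff_distrib)
    ultimately have "cmod (of_real r * (w - b)) = x" by simp
    then have "r * cmod (w - b) = x" unfolding norm_mult norm_of_real using r by simp
    then have xb: "cmod (w - b) = x / r" using r by (simp add: field_simps)
    have ab: "cmod (a - b) = (1 - r\<^sup>2) / r"
    proof -
      have "a - b = of_real (r - 1 / r) * w0" using r by (simp add: a_def b_def field_simps)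
      then have "cmod (a - b) = \<bar>r - 1 / r\<bar>" by (simp only: norm_mult w0 norm_of_real mult_1_right)
      also have "r - 1 / r = - ((1 - r\<^sup>2) / r)" using r by (simp add: field_simps power2_eq_square)
      finally show ?thesis using r r2 by simp
    qed
    have "cmod (2 * w - a - b) \<le> x + x / r"
      using norm_triangle_ineq[of "w - a" "w - b"] xb by (simp add: x_def algebra_simps)
    have "K w = ((w - b)\<^sup>2 - (w - a)\<^sup>2) / ((w - a)\<^sup>2 * (w - b)\<^sup>2)"
      using nz by (simp add: K_def diff_frac_eq)
    also have "(w - b)\<^sup>2 - (w - a)\<^sup>2 = (a - b) * (2 * w - a - b)" by (simp add: power2_eq_square algebra_simps)
    finally have "cmod (K w) = cmod (a - b) * cmod (2 * w - a - b) / (x\<^sup>2 * (x / r)\<^sup>2)"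
      by (simp add: norm_mult norm_divide norm_power xb x_def)
    also have "\<dots> \<le> ((1 - r\<^sup>2) / r) * (x + x / r) / (x\<^sup>2 * (x / r)\<^sup>2)"
      unfolding ab using \<open>cmod (2 * w - a - b) \<le> x + x / r\<close> r r2 by (intro divide_right_mono mult_left_mono) auto
    also have "\<dots> = (1 - r\<^sup>2) * (1 + r) / x ^ 3"
    proof -
      have "((1 - r\<^sup>2) / r) * (x + x / r) = (1 - r\<^sup>2) * (1 + r) * x / r\<^sup>2" using r by (simp add: field_simps power2_eq_square)
      moreover have "x\<^sup>2 * (x / r)\<^sup>2 = x ^ 3 * x / r\<^sup>2" by (simp add: field_simps power2_eq_square power3_eq_cube)
      ultimately show ?thesis using x0 r by simp
    qed
    also have "\<dots> \<le> 2 * (1 - r\<^sup>2) / x ^ 3"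
    proof -
      have "(1 - r\<^sup>2) * (1 + r) \<le> (1 - r\<^sup>2) * 2" using r r2 by (intro mult_left_mono) auto
      then show ?thesis using x0 by (intro divide_right_mono) (auto simp: mult.commute)
    qed
    finally show "cmod (K w) \<le> 2 * (1 - r\<^sup>2) / cmod (w - a) ^ 3" by (simp add: x_def)
    have "a - w0 = of_real (r - 1) * w0" by (simp add: a_def algebra_simps)
    then have "cmod (a - w0) = \<bar>r - 1\<bar>" by (simp only: norm_mult w0 norm_of_real mult_1_right)
    then have "cmod (a - w0) = 1 - r" using r by simp
    then show "cmod (w - w0) \<le> 2 * cmod (w - a)"
      using norm_triangle_ineq[of "w - a" "a - w0"] x by (simp add: x_def)
  qed
  define P where "P w = (1 - r\<^sup>2) / (cmod (w - a))\<^sup>2" for w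
  have P: "integrable circle P" "(LINT w|circle. P w) = 1"
    using poisson_integral[of a] a r by (simp_all add: P_def[abs_def])
  define f where "f w = disc_restrict R w * K w * w" for w
  have [measurable]: "disc_restrict R \<in> borel_measurable borel" using R by (rule disc_restrict_measurable)
  have [measurable]: "f \<in> borel_measurable borel" unfolding f_def K_def by measurable
  have cont_a: "continuous_on (sphere 0 1) (\<lambda>w. R w / (w - a)\<^sup>2)"
    using a by (intro continuous_intros continuous_on_subset[OF Rc]) auto
  \<comment> \<open>the reflected pole lies outside the disc\<close>
  have int_b: "((\<lambda>w. R w / (w - b)\<^sup>2) has_contour_integral 0) (circlepath 0 1)"
  proof (rule Cauchy_theorem_disc[where K="{}" and a=0 and e=1])
    show "continuous_on (cball 0 1) (\<lambda>w. R w / (w - b)\<^sup>2)" using b by (intro continuous_intros Rc) auto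
    have "(\<lambda>w. R w / (w - b)\<^sup>2) holomorphic_on ball 0 1" using b by (intro holomorphic_intros Rh) auto
    then show "(\<lambda>w. R w / (w - b)\<^sup>2) field_differentiable at x" if "x \<in> ball 0 1 - {}" for x
      using that holomorphic_on_imp_differentiable_at by auto
  qed auto
  have "deriv R a = 1 / (2 * of_real pi * \<i>) * contour_integral (circlepath 0 1) (\<lambda>w. R w / (w - a)\<^sup>2)"
    by (rule DERIV_imp_deriv, rule Cauchy_derivative_integral_circlepath(2)[OF Rc Rh a(2)])
  also have "contour_integral (circlepath 0 1) (\<lambda>w. R w / (w - a)\<^sup>2) =
      contour_integral (circlepath 0 1) (\<lambda>w. R w / (w - a)\<^sup>2 - R w / (w - b)\<^sup>2)"
    using contour_integral_diff[OF Cauchy_derivative_integral_circlepath(1)[OF Rc Rh a(2)] has_contour_integral_integrable[OF int_b]]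
      contour_integral_unique[OF int_b] by simp
  also have "\<dots> = 2 * of_real pi * \<i> * (LINT w|circle. f w)"
  proof (rule contour_integral_circle)
    show "continuous_on (sphere 0 1) (\<lambda>w. R w / (w - a)\<^sup>2 - R w / (w - b)\<^sup>2)"
      using a b by (intro continuous_intros continuous_on_subset[OF Rc]) auto
    show "f w = (R w / (w - a)\<^sup>2 - R w / (w - b)\<^sup>2) * w" if "cmod w = 1" for w
      using that by (simp add: f_def K_def disc_restrict_def right_diff_distrib)
  qed measurable
  finally have "deriv R a = (LINT w|circle. f w)" by simp
  moreover have "cmod (LINT w|circle. f w) \<le> (LINT w|circle. 4 * \<epsilon> * P w + 16 * D * (1 - r\<^sup>2))"
  proof -
    have ae: "AE w in circle. cmod (f w) \<le> 4 * \<epsilon> * P w + 16 * D * (1 - r\<^sup>2)"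
      using AE_circle_norm
    proof eventually_elim
      case (elim w)
      define x where "x = cmod (w - a)"
      have x: "x > 0" using wa[OF elim] by (simp add: x_def)
      have d: "cmod (w - w0) \<le> 2 * x" using dist_bound[OF elim] by (simp add: x_def)
      have "cmod (f w) = cmod (R w) * cmod (K w)" using elim by (simp add: f_def disc_restrict_def norm_mult)
      also have "\<dots> \<le> (\<epsilon> * (2 * x) + D * (2 * x) ^ 3) * (2 * (1 - r\<^sup>2) / x ^ 3)"
      proof (rule mult_mono)
        have "\<epsilon> * cmod (w - w0) + D * cmod (w - w0) ^ 3 \<le> \<epsilon> * (2 * x) + D * (2 * x) ^ 3"
          using d pos by (intro add_mono mult_left_mono power_mono) auto
        then show "cmod (R w) \<le> \<epsilon> * (2 * x) + D * (2 * x) ^ 3" using bound[OF elim] by linarith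
        show "cmod (K w) \<le> 2 * (1 - r\<^sup>2) / x ^ 3" using K_bound[OF elim] by (simp add: x_def)
      qed (use pos x in auto)
      also have "\<dots> = 4 * \<epsilon> * P w + 16 * D * (1 - r\<^sup>2)"
        using x by (simp add: P_def x_def[symmetric] field_simps power2_eq_square power3_eq_cube)
      finally show ?case .
    qed
    have i: "integrable circle (\<lambda>w. 4 * \<epsilon> * P w + 16 * D * (1 - r\<^sup>2))" using P by simp
    have "integrable circle f"
      by (rule Bochner_Integration.integrable_bound[OF i], simp, use ae in eventually_elim) simp
    then show ?thesis using ae i
      by (intro order_trans[OF integral_norm_bound integral_mono_AE]) simp_all
  qed
  moreover have "(LINT w|circle. 4 * \<epsilon> * P w + 16 * D * (1 - r\<^sup>2)) = 4 * \<epsilon> + 16 * D * (1 - r\<^sup>2)"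
    using P by simp
  ultimately show ?thesis by (simp add: a_def)
qed

text \<open>Near \<open>w0\<close> the remainder is small compared with \<open>|w - w0|\<close>, and away from \<open>w0\<close> it is bounded by a constant times the
  cube, whose contribution disappears as the radius tends to 1.\<close>

lemma radial_limit_of_derivative:
  assumes T: "disc_algebra T" and w0: "cmod w0 = 1"
    and der: "\<And>\<epsilon>. \<epsilon> > 0 \<Longrightarrow> \<exists>\<delta>>0. \<forall>w. cmod w = 1 \<and> cmod (w - w0) < \<delta> \<longrightarrow>
      cmod (T w - T w0 - c * (w - w0)) \<le> \<epsilon> * cmod (w - w0)"
  shows "((\<lambda>r. deriv T (of_real r * w0)) \<longlongrightarrow> c) (at_left 1)"
proof (rule tendstoI)
  fix e :: real assume e: "e > 0"
  define R where "R w = T w - T w0 - c * (w - w0)" for w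
  have R: "disc_algebra R"
    using T unfolding disc_algebra_def R_def by (auto intro!: continuous_intros holomorphic_intros)
  obtain \<delta> where \<delta>: "\<delta> > 0" "\<And>w. cmod w = 1 \<Longrightarrow> cmod (w - w0) < \<delta> \<Longrightarrow> cmod (R w) \<le> (e / 8) * cmod (w - w0)"
    using der[of "e / 8"] e unfolding R_def by auto
  obtain B where B: "\<And>w. cmod w = 1 \<Longrightarrow> cmod (R w) \<le> B" "B \<ge> 0"
  proof -
    obtain B where "\<And>z. z \<in> cball 0 1 \<Longrightarrow> cmod (R z) \<le> B"
      using compact_norm_bound[of "cball 0 1" R] R by (auto simp: disc_algebra_def)
    then have "cmod (R w) \<le> max B 0" if "cmod w = 1" for w
      using that by (simp add: le_max_iff_disj)
    then show thesis using that[of "max B 0"] by simp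
  qed
  \<comment> \<open>beyond distance \<open>\<delta>\<close> the cubic term alone dominates the bound \<open>B\<close>\<close>
  define D where "D = B / \<delta> ^ 3"
  have D: "D \<ge> 0" using B \<delta> by (simp add: D_def)
  have bound: "cmod (R w) \<le> (e / 8) * cmod (w - w0) + D * cmod (w - w0) ^ 3" if w: "cmod w = 1" for w
  proof (cases "cmod (w - w0) < \<delta>")
    case True
    then show ?thesis using \<delta>(2)[OF w True] D by (simp add: add_increasing2)
  next
    case False
    have "B = D * \<delta> ^ 3" using \<delta> by (simp add: D_def)
    also have "\<dots> \<le> D * cmod (w - w0) ^ 3" using False \<delta> D by (intro mult_left_mono power_mono) auto
    finally show ?thesis using B(1)[OF w] e by (simp add: add_increasing)
  qed
  have deriv: "deriv R a = deriv T a - c" if "a \<in> ball 0 1" for a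
  proof -
    have "T field_differentiable at a" using T that holomorphic_on_imp_differentiable_at[of T "ball 0 1"] by (auto simp: disc_algebra_def)
    then have "(T has_field_derivative deriv T a) (at a)" by (simp add: DERIV_deriv_iff_field_differentiable)
    then have "(R has_field_derivative deriv T a - c) (at a)" unfolding R_def by (auto intro!: derivative_eq_intros)
    then show ?thesis by (rule DERIV_imp_deriv)
  qed
  have "((\<lambda>r::real. 16 * D * (1 - r\<^sup>2)) \<longlongrightarrow> 16 * D * (1 - 1\<^sup>2)) (at_left 1)" by (intro tendsto_intros)
  then have "\<forall>\<^sub>F r in at_left (1::real). 16 * D * (1 - r\<^sup>2) < e / 2"
    using e by (intro order_tendstoD(2)[where y="16 * D * (1 - 1\<^sup>2)"]) auto
  moreover have "\<forall>\<^sub>F r in at_left (1::real). r \<in> {0<..<1}" by (rule eventually_at_leftI[of 0]) auto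
  ultimately show "\<forall>\<^sub>F r in at_left 1. dist (deriv T (of_real r * w0)) c < e"
  proof eventually_elim
    case (elim r)
    have "cmod (deriv R (of_real r * w0)) \<le> 4 * (e / 8) + 16 * D * (1 - r\<^sup>2)"
      using elim e D by (intro deriv_bound_from_boundary_modulus[OF R w0 _ _ bound]) auto
    also have "deriv R (of_real r * w0) = deriv T (of_real r * w0) - c"
      using elim w0 by (intro deriv) (simp add: norm_mult)
    finally show ?case using elim by (simp add: dist_norm)
  qed
qed


section \<open>Bounded measurable functions on the line\<close>

lemma bounded_measurable_set_integrable:
  fixes f :: "real \<Rightarrow> 'a::{banach, second_countable_topology}"
  assumes [measurable]: "f \<in> borel_measurable borel" and "\<And>x. norm (f x) \<le> B"
  shows "set_integrable lborel {s..t} f"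
  unfolding set_integrable_def
proof (rule integrableI_bounded_set[where A="{s..t}" and B=B])
  show "AE x in lborel. x \<in> {s..t} \<longrightarrow> norm (indicator {s..t} x *\<^sub>R f x) \<le> B"
    using assms(2) by (auto simp: indicator_def)
  show "emeasure lborel {s..t} < \<infinity>" by (cases "s \<le> t") auto
qed auto

text \<open>Lebesgue's differentiation theorem gives the derivative from the right; the derivative from the left
  is obtained by reflecting the line.\<close>

lemma bounded_measurable_integral_differentiable:
  fixes f :: "real \<Rightarrow> complex"
  assumes f: "f \<in> borel_measurable borel" "\<And>x. norm (f x) \<le> B"
  obtains N where "negligible N"
    "\<And>t e. t \<notin> N \<Longrightarrow> e > 0 \<Longrightarrow> \<exists>d>0. \<forall>s. \<bar>s - t\<bar> < d \<longrightarrow>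
       cmod (integral {min s t..max s t} f - of_real \<bar>s - t\<bar> * f t) \<le> e * \<bar>s - t\<bar>"
proof -
  have one_sided: "\<exists>N. negligible N \<and> (\<forall>t e. t \<notin> N \<longrightarrow> e > 0 \<longrightarrow>
      (\<exists>d>0. \<forall>h. 0 \<le> h \<and> h < d \<longrightarrow> cmod (integral {t..t + h} g - of_real h * g t) \<le> e * h))"
    if g: "g \<in> borel_measurable borel" "\<And>x. norm (g x) \<le> B" for g :: "real \<Rightarrow> complex"
  proof -
    have "g integrable_on cbox a b" for a b
      using set_borel_integral_eq_integral(1)[OF bounded_measurable_set_integrable[OF g]] by simp
    then obtain N where N: "negligible N" "\<And>x e. x \<notin> N \<Longrightarrow> 0 < e \<Longrightarrow>
        \<exists>d>0. \<forall>h. 0 < h \<and> h < d \<longrightarrow> norm (integral (cbox x (x + h *\<^sub>R One)) g /\<^sub>R h ^ DIM(real) - g x) < e"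
      using integrable_ccontinuous_explicit[of g] by blast
    have "\<exists>d>0. \<forall>h. 0 \<le> h \<and> h < d \<longrightarrow> cmod (integral {t..t + h} g - of_real h * g t) \<le> e * h"
      if te: "t \<notin> N" "e > 0" for t e
    proof -
      obtain d where d: "d > 0" "\<And>h. 0 < h \<Longrightarrow> h < d \<Longrightarrow> norm (integral {t..t + h} g /\<^sub>R h - g t) < e"
        using N(2)[OF te] by auto
      have "cmod (integral {t..t + h} g - of_real h * g t) \<le> e * h" if h: "0 \<le> h" "h < d" for h
      proof (cases "h = 0")
        case False
        have "integral {t..t + h} g - of_real h * g t = of_real h * (integral {t..t + h} g /\<^sub>R h - g t)"
          using False by (simp add: scaleR_conv_of_real right_diff_distrib)
        then have "cmod (integral {t..t + h} g - of_real h * g t) = h * norm (integral {t..t + h} g /\<^sub>R h - g t)"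
          using h by (simp only: norm_mult norm_of_real abs_of_nonneg)
        also have "\<dots> \<le> h * e" using d(2)[of h] h False by (intro mult_left_mono) auto
        finally show ?thesis by (simp add: mult.commute)
      qed simp
      with d(1) show ?thesis by blast
    qed
    with N(1) show ?thesis by blast
  qed
  have neg: "(\<lambda>x. f (- x)) \<in> borel_measurable borel" using f(1) by measurable
  obtain N1 where N1: "negligible N1" "\<And>t e. t \<notin> N1 \<Longrightarrow> e > 0 \<Longrightarrow>
      \<exists>d>0. \<forall>h. 0 \<le> h \<and> h < d \<longrightarrow> cmod (integral {t..t + h} f - of_real h * f t) \<le> e * h"
    using one_sided[OF f] by blast
  obtain N2 where N2: "negligible N2" "\<And>t e. t \<notin> N2 \<Longrightarrow> e > 0 \<Longrightarrow>
      \<exists>d>0. \<forall>h. 0 \<le> h \<and> h < d \<longrightarrow> cmod (integral {t..t + h} (\<lambda>x. f (- x)) - of_real h * f (- t)) \<le> e * h"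
    using one_sided[OF neg] f(2) by blast
  define N where "N = N1 \<union> uminus ` N2"
  have "negligible (uminus ` N2)" 
    by (rule negligible_differentiable_image_negligible[OF _ N2(1)]) (auto intro!: derivative_intros simp: differentiable_on_def)
  then have "negligible N" using N1 by (simp add: N_def)
  moreover have "\<exists>d>0. \<forall>s. \<bar>s - t\<bar> < d \<longrightarrow>
       cmod (integral {min s t..max s t} f - of_real \<bar>s - t\<bar> * f t) \<le> e * \<bar>s - t\<bar>"
    if t: "t \<notin> N" and e: "e > 0" for t e
  proof -
    have "t \<notin> N1" "- t \<notin> N2" using t by (auto simp: N_def image_iff)
    obtain d1 where d1: "d1 > 0" "\<And>h. 0 \<le> h \<Longrightarrow> h < d1 \<Longrightarrow> cmod (integral {t..t + h} f - of_real h * f t) \<le> e * h"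
      using N1(2)[OF \<open>t \<notin> N1\<close> e] by blast
    obtain d2 where d2: "d2 > 0" "\<And>h. 0 \<le> h \<Longrightarrow> h < d2 \<Longrightarrow>
        cmod (integral {- t..- t + h} (\<lambda>x. f (- x)) - of_real h * f t) \<le> e * h"
      using N2(2)[OF \<open>- t \<notin> N2\<close> e] by auto
    have "cmod (integral {min s t..max s t} f - of_real \<bar>s - t\<bar> * f t) \<le> e * \<bar>s - t\<bar>"
      if s: "\<bar>s - t\<bar> < min d1 d2" for s
    proof (cases "s \<ge> t")
      case True
      then have "s - t < d1" using s by auto
      then show ?thesis using d1(2)[of "s - t"] True by (simp add: min_def max_def)
    next
      case False
      have "integral {- t..- s} (\<lambda>x. f (- x)) = integral {s..t} f" by (rule Henstock_Kurzweil_Integration.integral_reflect_real)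
      moreover have "t - s < d2" using s by auto
      ultimately show ?thesis using d2(2)[of "t - s"] False by (simp add: min_def max_def)
    qed
    then show ?thesis using d1(1) d2(1) by (intro exI[of _ "min d1 d2"]) auto
  qed
  ultimately show thesis using that by blast
qed

lemma sin_ge_quarter:
  assumes "0 \<le> y" "y \<le> pi / 2" shows "y / 4 \<le> sin y"
proof (cases "y \<le> pi / 3")
  case True
  have "sin 0 - 0 / 2 \<le> sin y - y / 2"
  proof (rule DERIV_nonneg_imp_nondecreasing[OF assms(1), of "\<lambda>y. sin y - y / 2"])
    fix x assume x: "0 \<le> x" "x \<le> y"
    have "cos (pi / 3) \<le> cos x" using x True by (intro cos_monotone_0_pi_le) auto
    then have "cos x - 1 / 2 \<ge> 0" by (simp add: cos_60)
    moreover have "((\<lambda>y. sin y - y / 2) has_real_derivative cos x - 1 / 2) (at x)"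
      by (auto intro!: derivative_eq_intros)
    ultimately show "\<exists>l. ((\<lambda>y. sin y - y / 2) has_real_derivative l) (at x) \<and> l \<ge> 0" by blast
  qed
  then show ?thesis using assms(1) by simp
next
  case False
  have "sin (pi / 3) \<le> sin y" using False assms by (intro sin_monotone_2pi_le) auto
  moreover have "sin (pi / 3) \<ge> 1 / 2" using real_le_rsqrt[of 1 3] by (simp add: sin_60)
  ultimately show ?thesis using assms(2) pi_less_4 by simp
qed

lemma arc_le_chord:
  assumes "\<bar>s - t\<bar> \<le> pi" shows "\<bar>s - t\<bar> \<le> 4 * cmod (cis s - cis t)"
proof -
  define x where "x = \<bar>s - t\<bar>"
  have "cmod (cis s - cis t) = cmod (cis (s - t) - 1)"
  proof -
    have "cis s - cis t = cis t * (cis (s - t) - 1)" by (simp add: right_diff_distrib cis_mult)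
    then show ?thesis by (simp add: norm_mult)
  qed
  also have "(\<dots>)\<^sup>2 = (2 * sin (x / 2))\<^sup>2"
  proof -
    have "(cmod (cis (s - t) - 1))\<^sup>2 = (cos (s - t) - 1)\<^sup>2 + (sin (s - t))\<^sup>2" by (simp add: cmod_power2)
    also have "\<dots> = 2 - 2 * cos (s - t)"
      using sin_cos_squared_add[of "s - t"] by (simp add: power2_diff)
    also have "cos (s - t) = cos x" by (simp add: x_def abs_if cos_minus flip: cos_minus[of "s - t"])
    also have "cos x = 1 - 2 * (sin (x / 2))\<^sup>2" using cos_double_sin[of "x / 2"] by simp
    finally show ?thesis by (simp add: power_mult_distrib)
  qed
  finally have eq: "cmod (cis s - cis t) = \<bar>2 * sin (x / 2)\<bar>" by (metis norm_ge_zero real_sqrt_abs abs_of_nonneg)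
  have "x / 2 / 4 \<le> sin (x / 2)" using assms by (intro sin_ge_quarter) (auto simp: x_def)
  then show ?thesis unfolding eq x_def[symmetric] by linarith
qed


section \<open>Fatou's theorem for bounded boundary functions\<close>

text \<open>By the inequality between arithmetic and geometric means each term is at most
  \<open>|a n|\<^sup>2 + 1 / (n + 1)\<^sup>2\<close>.\<close>

lemma summable_abs_primitive_coeffs:
  fixes a :: "nat \<Rightarrow> complex"
  assumes "\<And>N. (\<Sum>n<N. (cmod (a n))\<^sup>2) \<le> B"
  shows "summable (\<lambda>n. cmod (a n / of_nat (Suc n)))"
proof (rule summable_comparison_test')
  have "summable (\<lambda>n. (cmod (a n))\<^sup>2)" by (rule summableI_nonneg_bounded) (use assms in auto)
  moreover have "summable (\<lambda>n. inverse (real n ^ 2))" by (rule inverse_power_summable) simp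
  then have "summable (\<lambda>n. inverse (real (Suc n) ^ 2))" by (subst summable_Suc_iff)
  ultimately show "summable (\<lambda>n. (cmod (a n))\<^sup>2 + inverse (real (Suc n) ^ 2))" by (rule summable_add)
  show "norm (cmod (a n / of_nat (Suc n))) \<le> (cmod (a n))\<^sup>2 + inverse (real (Suc n) ^ 2)" for n
  proof -
    have "cmod (a n / of_nat (Suc n)) = cmod (a n) * inverse (real (Suc n))"
      unfolding divide_inverse norm_mult norm_inverse norm_of_nat ..
    moreover have "2 * cmod (a n) * inverse (real (Suc n)) \<le> (cmod (a n))\<^sup>2 + (inverse (real (Suc n)))\<^sup>2"
      by (rule sum_squares_bound)
    moreover have "cmod (a n) * inverse (real (Suc n)) \<ge> 0" by simp
    ultimately show ?thesis by (simp only: power_inverse real_norm_def abs_of_nonneg)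
  qed
qed

text \<open>\<open>T\<close> is the termwise primitive of the analytic function with the Taylor coefficients \<open>a n\<close>. Its series converges
  absolutely on the closed disc. The formula on the circle holds for the Taylor polynomials of \<open>u\<close> by the fundamental
  theorem of calculus, and it passes to the limit because these converge to \<open>u\<close> in \<open>L\<^sup>2\<close>, hence in \<open>L\<^sup>1\<close>.\<close>

lemma bounded_boundary_primitive:
  assumes u[measurable]: "u \<in> borel_measurable borel" and u1: "\<And>z. cmod (u z) \<le> 1" and uH: "abs_l2 u \<in> H2"
  obtains T where "disc_algebra T"
    "\<And>s t. 0 \<le> s \<Longrightarrow> s \<le> t \<Longrightarrow> t \<le> 2 * pi \<Longrightarrow> T (cis t) - T (cis s) = integral {s..t} (\<lambda>x. \<i> * u (cis x) * cis x)"
proof -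
  define w where "w = abs_l2 u"
  have uL: "u \<in> Linf" using u u1 by (intro LinfI[where C=1])
  have rep_w: "AE z in circle. rep_l2 w z = u z" unfolding w_def by (intro rep_abs_l2 Linf_sq_integrable uL)
  define a where "a n = fourier w (int n)" for n
  \<comment> \<open>coefficients of the primitive, so that \<open>diffs c = a\<close>\<close>
  define c where "c n = (case n of 0 \<Rightarrow> 0 | Suc m \<Rightarrow> a m / of_nat (Suc m))" for n
  have "summable (\<lambda>n. cmod (c (Suc n)))"
    unfolding c_def nat.case by (rule summable_abs_primitive_coeffs) (unfold a_def, rule bessel)
  then have c_sum: "summable (\<lambda>n. cmod (c n))" by (subst (asm) summable_Suc_iff)
  define T where "T z = (\<Sum>n. c n * z ^ n)" for z
  have "uniform_limit (cball 0 1) (\<lambda>N z. \<Sum>n<N. c n * z ^ n) T sequentially"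
    unfolding T_def
  proof (rule Weierstrass_m_test[OF _ c_sum])
    fix n and z :: complex assume "z \<in> cball 0 1"
    then show "norm (c n * z ^ n) \<le> cmod (c n)"
      by (simp add: norm_mult norm_power mult_left_le power_le_one)
  qed
  then have "continuous_on (cball 0 1) T"
    by (rule uniform_limit_theorem[rotated]) (auto intro!: always_eventually continuous_intros)
  moreover have "T holomorphic_on ball 0 1"
  proof -
    have "summable (\<lambda>n. c n * 1 ^ n)" using c_sum by (simp add: summable_norm_cancel)
    then have der: "(T has_field_derivative (\<Sum>n. diffs c n * z ^ n)) (at z)" if "cmod z < 1" for z
      unfolding T_def using that by (intro termdiffs_strong[where K=1]) simp_all
    show ?thesis
      unfolding holomorphic_on_open[OF open_ball]
    proof (intro ballI exI)
      show "(T has_field_derivative (\<Sum>n. diffs c n * z ^ n)) (at z)" if "z \<in> ball 0 1" for z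
        using that by (intro der) simp
    qed
  qed
  ultimately have T: "disc_algebra T" by (simp add: disc_algebra_def)
  \<comment> \<open>the Taylor polynomials of \<open>u\<close>, as polynomials\<close>
  define p where "p N = (\<Sum>n<N. smult (a n) (monom 1 n))" for N
  have poly_p: "poly (p N) z = (\<Sum>n<N. a n * z ^ n)" for N z by (simp add: p_def poly_sum poly_monom)
  have "polyl2 (p N) = taylor_sum N w" for N
  proof (induction N)
    case 0
    then show ?case using polyl2_smult[of 0 0] by (simp add: p_def taylor_sum_def)
  next
    case (Suc N)
    then show ?case by (simp add: p_def taylor_sum_def polyl2_add polyl2_smult polyl2_monom a_def)
  qed
  then have rep_p: "AE z in circle. rep_l2 (taylor_sum N w) z = poly (p N) z" for N using rep_polyl2[of "p N"] by simp
  define f where "f x = \<i> * u (cis x) * cis x" for x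
  define q where "q N x = \<i> * poly (p N) (cis x) * cis x" for N x
  have [measurable]: "poly (p N) \<in> borel_measurable borel" for N using poly_Linf[of "p N"] by (auto simp: Linf_def)
  have [measurable]: "f \<in> borel_measurable borel" "q N \<in> borel_measurable borel" for N
    unfolding f_def q_def by measurable
  have f1: "cmod (f x) \<le> 1" for x using u1 by (simp add: f_def norm_mult)
  have f_int: "set_integrable lborel {s..t} f" for s t by (rule bounded_measurable_set_integrable[OF _ f1]) simp
  have q_cont: "continuous_on {s..t} (q N)" for s t N unfolding q_def by (intro continuous_intros)
  have q_int: "set_integrable lborel {s..t} (q N)" for s t N by (rule borel_integrable_atLeastAtMost'[OF q_cont])
  have increment: "T (cis t) - T (cis s) = integral {s..t} f" if st: "0 \<le> s" "s \<le> t" "t \<le> 2 * pi" for s t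
  proof -
    define E where "E N = norm (w - taylor_sum N w)" for N
    have "(\<lambda>N. w - taylor_sum N w) \<longlonglongrightarrow> w - w"
      using uH by (intro tendsto_diff tendsto_const taylor_sum_tendsto) (simp add: w_def)
    then have E: "E \<longlonglongrightarrow> 0" unfolding E_def using tendsto_norm_zero by force
    have "cmod ((LINT x:{s..t}|lborel. f x) - (LINT x:{s..t}|lborel. q N x)) \<le> 2 * pi * E N" for N
    proof -
      have d_int: "set_integrable lborel {x..y} (\<lambda>x. f x - q N x)" for x y by (intro set_integral_diff(1) f_int q_int)
      have dn_int: "set_integrable lborel {x..y} (\<lambda>x. cmod (f x - q N x))" for x y
        using d_int by (rule set_integrable_norm)
      have "(LINT x:{s..t}|lborel. f x) - (LINT x:{s..t}|lborel. q N x) = (LINT x:{s..t}|lborel. f x - q N x)"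
        by (rule set_integral_diff(2)[symmetric, OF f_int q_int])
      also have "cmod \<dots> \<le> (LINT x:{s..t}|lborel. cmod (f x - q N x))" by (rule set_integral_norm_bound[OF d_int])
      also have "\<dots> \<le> (LINT x:{0..2*pi}|lborel. cmod (f x - q N x))"
        unfolding set_lebesgue_integral_def using dn_int st
        by (intro integral_mono) (auto simp: set_integrable_def indicator_def)
      also have "\<dots> = (LINT x:{0..2*pi}|lborel. cmod (u (cis x) - poly (p N) (cis x)))"
      proof -
        have "f x - q N x = \<i> * cis x * (u (cis x) - poly (p N) (cis x))" for x
          by (simp add: f_def q_def algebra_simps)
        then have "cmod (f x - q N x) = cmod (u (cis x) - poly (p N) (cis x))" for x by (simp add: norm_mult)
        then show ?thesis by simp
      qed
      also have "\<dots> = 2 * pi * (LINT z|circle. cmod (u z - poly (p N) z))"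
        by (subst circle_integral_parametrized) simp_all
      also have "(LINT z|circle. cmod (u z - poly (p N) z)) = (LINT z|circle. cmod (rep_l2 (w - taylor_sum N w) z))"
      proof (rule integral_cong_AE)
        show "AE z in circle. cmod (u z - poly (p N) z) = cmod (rep_l2 (w - taylor_sum N w) z)"
          using rep_w rep_p[of N] rep_minus[of w "taylor_sum N w"] by eventually_elim simp
      qed simp_all
      also have "2 * pi * \<dots> \<le> 2 * pi * E N"
        unfolding E_def by (intro mult_left_mono L1_norm_le) simp
      finally show ?thesis .
    qed
    then have "(\<lambda>N. (LINT x:{s..t}|lborel. f x) - (LINT x:{s..t}|lborel. q N x)) \<longlonglongrightarrow> 0"
    proof (rule Lim_null_comparison[OF always_eventually[OF allI]])
      show "(\<lambda>N. 2 * pi * E N) \<longlonglongrightarrow> 0" using tendsto_mult[OF tendsto_const E, of "2 * pi"] by simp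
    qed
    then have "(\<lambda>N. (LINT x:{s..t}|lborel. f x) - ((LINT x:{s..t}|lborel. f x) - (LINT x:{s..t}|lborel. q N x)))
        \<longlonglongrightarrow> (LINT x:{s..t}|lborel. f x) - 0"
      by (intro tendsto_diff tendsto_const)
    then have 1: "(\<lambda>N. LINT x:{s..t}|lborel. q N x) \<longlonglongrightarrow> (LINT x:{s..t}|lborel. f x)" by simp
    have q_eq: "(LINT x:{s..t}|lborel. q N x) = (\<Sum>n<Suc N. c n * cis t ^ n) - (\<Sum>n<Suc N. c n * cis s ^ n)" for N
    proof -
      have "(q N has_integral (\<Sum>n<Suc N. c n * cis t ^ n) - (\<Sum>n<Suc N. c n * cis s ^ n)) {s..t}"
      proof (rule fundamental_theorem_of_calculus[OF st(2)])
        fix x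
        have "((\<lambda>z. \<Sum>n<Suc N. c n * exp (\<i> * z) ^ n) has_field_derivative
            (\<Sum>n<Suc N. c n * (of_nat n * exp (\<i> * of_real x) ^ (n - 1) * (exp (\<i> * of_real x) * \<i>)))) (at (of_real x))"
          by (intro DERIV_sum) (auto intro!: derivative_eq_intros)
        also have "(\<Sum>n<Suc N. c n * (of_nat n * exp (\<i> * of_real x) ^ (n - 1) * (exp (\<i> * of_real x) * \<i>))) = q N x"
          unfolding sum.lessThan_Suc_shift q_def poly_p sum_distrib_left sum_distrib_right
          by (simp add: c_def cis_conv_exp del: of_nat_Suc) (intro sum.cong, simp_all add: mult_ac)
        finally have "((\<lambda>x. \<Sum>n<Suc N. c n * exp (\<i> * of_real x) ^ n) has_vector_derivative q N x) (at x within {s..t})"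
          by (rule has_vector_derivative_real_field)
        then show "((\<lambda>x. \<Sum>n<Suc N. c n * cis x ^ n) has_vector_derivative q N x) (at x within {s..t})"
          by (simp only: cis_conv_exp)
      qed
      then show ?thesis
        using set_borel_integral_eq_integral(2)[OF q_int] by (simp add: integral_unique)
    qed
    have sumT: "(\<lambda>N. \<Sum>n<Suc N. c n * z ^ n) \<longlonglongrightarrow> T z" if "cmod z = 1" for z
    proof -
      have "summable (\<lambda>n. c n * z ^ n)"
        by (rule summable_norm_cancel) (simp add: norm_mult norm_power that c_sum)
      then have "(\<lambda>N. \<Sum>n<N. c n * z ^ n) \<longlonglongrightarrow> T z" unfolding T_def by (rule summable_LIMSEQ)
      then show ?thesis by (rule LIMSEQ_Suc)
    qed
    have "(\<lambda>N. LINT x:{s..t}|lborel. q N x) \<longlonglongrightarrow> T (cis t) - T (cis s)"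
      unfolding q_eq by (intro tendsto_diff sumT) simp_all
    with 1 have "T (cis t) - T (cis s) = (LINT x:{s..t}|lborel. f x)" by (rule LIMSEQ_unique[rotated])
    then show ?thesis by (simp add: set_borel_integral_eq_integral(2)[OF f_int])
  qed
  show thesis using that[OF T] increment unfolding f_def by blast
qed


lemma primitive_lipschitz_on_circle:
  assumes u: "u \<in> borel_measurable borel" "\<And>z. cmod (u z) \<le> 1"
    and T: "\<And>s t. 0 \<le> s \<Longrightarrow> s \<le> t \<Longrightarrow> t \<le> 2 * pi \<Longrightarrow> T (cis t) - T (cis s) = integral {s..t} (\<lambda>x. \<i> * u (cis x) * cis x)"
    and w: "cmod w = 1" "cmod w0 = 1"
  shows "cmod (T w - T w0) \<le> 4 * cmod (w - w0)"
proof -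
  let ?f = "\<lambda>x. \<i> * u (cis x) * cis x"
  have [measurable]: "u \<in> borel_measurable borel" by fact
  have f: "set_integrable lborel {s..t} ?f" for s t
    by (rule bounded_measurable_set_integrable[where B=1]) (use u(2) in \<open>simp_all add: norm_mult\<close>)
  have lip: "cmod (T (cis t) - T (cis s)) \<le> t - s" if "0 \<le> s" "s \<le> t" "t \<le> 2 * pi" for s t
  proof -
    have "?f integrable_on {s..t}" by (rule set_borel_integral_eq_integral(1)[OF f])
    then have "norm (integral {s..t} ?f) \<le> integral {s..t} (\<lambda>x. 1)"
      by (intro integral_norm_bound_integral) (use u(2) in \<open>auto simp: norm_mult\<close>)
    then show ?thesis using that by (simp add: T)
  qed
  have ordered: "cmod (T (cis t) - T (cis s)) \<le> 4 * cmod (cis t - cis s)"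
    if st: "0 \<le> s" "s \<le> t" "t \<le> 2 * pi" for s t
  proof (cases "t - s \<le> pi")
    case True
    then have "t - s \<le> 4 * cmod (cis t - cis s)" using arc_le_chord[of t s] st by simp
    then show ?thesis using lip[OF st] by linarith
  next
    case False
    \<comment> \<open>The shorter arc between the two points passes through 1.\<close>
    have "cis (t - 2 * pi) = cis t" by (simp add: complex_eq_iff cos_diff sin_diff)
    moreover have "\<bar>s - (t - 2 * pi)\<bar> \<le> pi" using False st by linarith
    ultimately have "\<bar>s - (t - 2 * pi)\<bar> \<le> 4 * cmod (cis s - cis t)" using arc_le_chord[of s "t - 2 * pi"] by simp
    then have chord: "s + (2 * pi - t) \<le> 4 * cmod (cis t - cis s)" using st by (simp add: norm_minus_commute)
    have "cmod (T (cis s) - T 1) \<le> s" using lip[of 0 s] st by simp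
    moreover have "cmod (T 1 - T (cis t)) \<le> 2 * pi - t" using lip[of t "2 * pi"] st by simp
    ultimately have "cmod (T (cis t) - T (cis s)) \<le> s + (2 * pi - t)"
      using norm_triangle_ineq4[of "T (cis t) - T 1" "T (cis s) - T 1"] by (simp add: norm_minus_commute)
    then show ?thesis using chord by linarith
  qed
  have arg: "cis (Arg2pi v) = v" if "cmod v = 1" for v
    using Arg2pi_eq[of v] that by (simp add: cis_conv_exp)
  have "0 \<le> Arg2pi v" "Arg2pi v \<le> 2 * pi" for v using Arg2pi_ge_0[of v] Arg2pi_lt_2pi[of v] by simp_all
  then show ?thesis
    using ordered[of "Arg2pi w" "Arg2pi w0"] ordered[of "Arg2pi w0" "Arg2pi w"] arg[OF w(1)] arg[OF w(2)]
    by (cases "Arg2pi w \<le> Arg2pi w0") (auto simp: norm_minus_commute)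
qed

text \<open>Differentiability in the angle is converted into differentiability along the circle, with the help of the continuity of
  the argument at points other than 1 and of the comparison of arcs and chords.\<close>

lemma primitive_differentiable_at_boundary:
  fixes t :: real
  assumes u1: "\<And>z. cmod (u z) \<le> 1"
    and T: "\<And>s t. 0 \<le> s \<Longrightarrow> s \<le> t \<Longrightarrow> t \<le> 2 * pi \<Longrightarrow> T (cis t) - T (cis s) = integral {s..t} (\<lambda>x. \<i> * u (cis x) * cis x)"
    and t: "0 < t" "t < 2 * pi"
    and diff: "\<And>e. e > 0 \<Longrightarrow> \<exists>d>0. \<forall>s. \<bar>s - t\<bar> < d \<longrightarrow>
       cmod (integral {min s t..max s t} (\<lambda>x. \<i> * u (cis x) * cis x) - of_real \<bar>s - t\<bar> * (\<i> * u (cis t) * cis t)) \<le> e * \<bar>s - t\<bar>"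
    and \<epsilon>: "\<epsilon> > 0"
  shows "\<exists>\<delta>>0. \<forall>w. cmod w = 1 \<and> cmod (w - cis t) < \<delta> \<longrightarrow>
      cmod (T w - T (cis t) - u (cis t) * (w - cis t)) \<le> \<epsilon> * cmod (w - cis t)"
proof -
  define f where "f x = \<i> * u (cis x) * cis x" for x
  obtain d1 where d1: "d1 > 0" "\<And>s. \<bar>s - t\<bar> < d1 \<Longrightarrow>
      cmod (integral {min s t..max s t} f - of_real \<bar>s - t\<bar> * f t) \<le> \<epsilon> / 8 * \<bar>s - t\<bar>"
    using diff[of "\<epsilon> / 8"] \<epsilon> by (auto simp: f_def[abs_def])
  have "(cis has_vector_derivative \<i> * cis t) (at t)"
  proof -
    have "((\<lambda>z. exp (\<i> * z)) has_field_derivative exp (\<i> * of_real t) * \<i>) (at (of_real t))"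
      by (auto intro!: derivative_eq_intros)
    from has_vector_derivative_real_field[OF this, of UNIV] show ?thesis by (simp add: cis_conv_exp[abs_def] mult.commute)
  qed
  then obtain d2 where d2: "d2 > 0" "\<And>s. \<bar>s - t\<bar> < d2 \<Longrightarrow>
      cmod (cis s - cis t - of_real (s - t) * (\<i> * cis t)) \<le> \<epsilon> / 8 * \<bar>s - t\<bar>"
    unfolding has_vector_derivative_def has_derivative_at_alt scaleR_conv_of_real
    using \<epsilon> by (metis divide_pos_pos real_norm_def zero_less_numeral)
  have arg_t: "Arg2pi (cis t) = t"
    by (rule Arg2pi_unique[of 1]) (use t in \<open>simp_all add: cis_conv_exp\<close>)
  \<comment> \<open>the branch cut of \<^const>\<open>Arg2pi\<close> meets the circle only at 1\<close>
  have "cis t \<notin> \<real>\<^sub>\<ge>\<^sub>0"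
  proof
    assume "cis t \<in> \<real>\<^sub>\<ge>\<^sub>0"
    then have "Arg2pi (cis t) = 0" by (simp add: Arg2pi_eq_0 complex_nonneg_Reals_iff complex_is_Real_iff)
    then show False using arg_t t by simp
  qed
  then have cont: "isCont Arg2pi (cis t)" by (rule continuous_at_Arg2pi)
  define d where "d = min (min d1 d2) (min t (2 * pi - t))"
  have "d > 0" using d1(1) d2(1) t by (simp add: d_def)
  with cont obtain \<delta> where \<delta>: "\<delta> > 0" "\<And>w. dist w (cis t) < \<delta> \<Longrightarrow> dist (Arg2pi w) t < min d pi"
    unfolding continuous_at_eps_delta arg_t using pi_gt_zero by (metis min_less_iff_conj)
  have "cmod (T w - T (cis t) - u (cis t) * (w - cis t)) \<le> \<epsilon> * cmod (w - cis t)"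
    if w: "cmod w = 1" "cmod (w - cis t) < \<delta>" for w
  proof -
    define s where "s = Arg2pi w"
    have cs: "cis s = w" using Arg2pi_eq[of w] w(1) by (simp add: s_def cis_conv_exp)
    have "\<bar>s - t\<bar> < min d pi" using \<delta>(2)[of w] w(2) by (simp add: dist_norm s_def)
    then have st: "\<bar>s - t\<bar> < d1" "\<bar>s - t\<bar> < d2" "\<bar>s - t\<bar> \<le> pi" "0 \<le> s" "s \<le> 2 * pi"
      by (auto simp: d_def)
    have chord: "\<bar>s - t\<bar> \<le> 4 * cmod (w - cis t)" using arc_le_chord[OF st(3)] by (simp add: cs)
    have inc: "cmod (T w - T (cis t) - of_real (s - t) * f t) \<le> \<epsilon> / 8 * \<bar>s - t\<bar>"
    proof (cases "s \<ge> t")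
      case True
      have "T w - T (cis t) = integral {t..s} f" using T[of t s] True t st by (simp add: cs f_def[abs_def])
      moreover have "min s t = t" "max s t = s" "\<bar>s - t\<bar> = s - t" using True by auto
      ultimately show ?thesis using d1(2)[OF st(1)] by simp
    next
      case False
      have "T (cis t) - T w = integral {s..t} f" using T[of s t] False t st by (simp add: cs f_def[abs_def])
      then have "T w - T (cis t) - of_real (s - t) * f t = - (integral {s..t} f - of_real \<bar>s - t\<bar> * f t)"
        using False by (simp add: algebra_simps)
      then have "cmod (T w - T (cis t) - of_real (s - t) * f t) = cmod (integral {s..t} f - of_real \<bar>s - t\<bar> * f t)"
        by (simp only: norm_minus_cancel)
      moreover have "min s t = s" "max s t = t" using False by auto
      ultimately show ?thesis using d1(2)[OF st(1)] by simp
    qed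
    have "u (cis t) * (w - cis t) - of_real (s - t) * f t = u (cis t) * (cis s - cis t - of_real (s - t) * (\<i> * cis t))"
      by (simp add: cs f_def algebra_simps)
    then have "cmod (of_real (s - t) * f t - u (cis t) * (w - cis t)) =
        cmod (u (cis t)) * cmod (cis s - cis t - of_real (s - t) * (\<i> * cis t))"
      by (subst norm_minus_commute) (simp only: norm_mult)
    also have "\<dots> \<le> 1 * (\<epsilon> / 8 * \<bar>s - t\<bar>)" using u1 d2(2)[OF st(2)] by (intro mult_mono) auto
    finally have "cmod (of_real (s - t) * f t - u (cis t) * (w - cis t)) \<le> \<epsilon> / 8 * \<bar>s - t\<bar>" by simp
    with inc have "cmod (T w - T (cis t) - u (cis t) * (w - cis t)) \<le> \<epsilon> / 8 * \<bar>s - t\<bar> + \<epsilon> / 8 * \<bar>s - t\<bar>"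
      by (rule norm_diff_triangle_le)
    also have "\<dots> = \<epsilon> / 4 * \<bar>s - t\<bar>" by simp
    also have "\<dots> \<le> \<epsilon> / 4 * (4 * cmod (w - cis t))" using chord \<epsilon> by (intro mult_left_mono) auto
    finally show ?thesis by simp
  qed
  then show ?thesis using \<delta>(1) by blast
qed

lemma radial_limit_eqI:
  "((\<lambda>r. \<theta> (of_real r * z)) \<longlongrightarrow> l) (at_left 1) \<Longrightarrow> radial_limit \<theta> z = l"
  unfolding radial_limit_def by (rule tendsto_Lim) simp_all

text \<open>The limit is taken over a continuum of radii, and it may fail to exist at some points of the circle, where
  \<^const>\<open>radial_limit\<close> has a constant default value. The set \<open>E\<close> of points where it exists is nevertheless a Borel
  set, and on \<open>E\<close> the limit can be computed along a sequence. Off the circle the value is \<open>\<theta> z\<close> or 0.\<close>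

lemma radial_limit_measurable:
  assumes hol: "\<theta> holomorphic_on ball 0 1" and out: "\<And>z. cmod z \<ge> 1 \<Longrightarrow> \<theta> z = 0"
  shows "radial_limit \<theta> \<in> borel_measurable borel"
proof -
  have "(\<lambda>z. if z \<in> ball 0 1 then \<theta> z else 0) \<in> borel_measurable borel"
    by (intro borel_measurable_continuous_on_if) (auto intro: holomorphic_on_imp_continuous_on[OF hol])
  also have "(\<lambda>z. if z \<in> ball 0 1 then \<theta> z else 0) = \<theta>" using out by (auto simp: not_less)
  finally have \<theta>[measurable]: "\<theta> \<in> borel_measurable borel" .
  have cont: "continuous_on (ball 0 1) \<theta>" using hol by (rule holomorphic_on_imp_continuous_on)
  define x where "x n = 1 - 1 / (real n + 2)" for n
  have x_lim: "filterlim x (at_left 1) sequentially"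
  proof (rule tendsto_imp_filterlim_at_left)
    have "(\<lambda>n. 1 / (real n + 2)) \<longlonglongrightarrow> 0" by real_asymp
    from tendsto_diff[OF tendsto_const this, of 1] show "x \<longlonglongrightarrow> 1" by (simp add: x_def[abs_def])
  qed (simp add: x_def)
  define l where "l z = lim (\<lambda>n. \<theta> (of_real (x n) * z))" for z
  have [measurable]: "l \<in> borel_measurable borel" unfolding l_def by measurable
  \<comment> \<open>By continuity, rational radii detect whether the radial limit exists, so this is a Borel condition.\<close>
  define E where "E = {z. \<forall>k::nat. \<exists>m::nat. \<forall>q::rat. 1 - 1 / (real m + 1) < of_rat q \<and> of_rat q < (1::real) \<longrightarrow>
      cmod (\<theta> (of_real (of_rat q) * z) - l z) \<le> 1 / (real k + 1)}"
  have [measurable]: "E \<in> sets borel" unfolding E_def by measurable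
  have lim_l: "((\<lambda>r. \<theta> (of_real r * z)) \<longlongrightarrow> l z) (at_left 1)" if z: "cmod z = 1" "z \<in> E" for z
  proof (rule tendstoI)
    fix e :: real assume e: "e > 0"
    then obtain k where k: "1 / (real k + 1) < e" using nat_approx_posE[OF e] by (metis of_nat_Suc add.commute)
    obtain m where m: "\<And>q. 1 - 1 / (real m + 1) < of_rat q \<Longrightarrow> of_rat q < (1::real) \<Longrightarrow>
        cmod (\<theta> (of_real (of_rat q) * z) - l z) \<le> 1 / (real k + 1)"
      using z(2) unfolding E_def by blast
    have near: "cmod (\<theta> (of_real r * z) - l z) \<le> 1 / (real k + 1)" if r: "1 - 1 / (real m + 1) < r" "r < 1" for r
    proof (rule field_le_epsilon)
      fix \<eta> :: real assume \<eta>: "\<eta> > 0"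
      have "1 - 1 / (real m + 1) \<ge> 0" by simp
      then have "r > 0" using r by linarith
      then have "of_real r * z \<in> ball 0 1" using r z(1) by (simp add: norm_mult)
      then have "isCont \<theta> (of_real r * z)" using cont by (simp add: continuous_on_eq_continuous_at)
      then obtain \<delta> where \<delta>: "\<delta> > 0" "\<And>w. dist w (of_real r * z) < \<delta> \<Longrightarrow> dist (\<theta> w) (\<theta> (of_real r * z)) < \<eta>"
        using \<eta> unfolding continuous_at_eps_delta by blast
      have "r < min 1 (r + \<delta>)" using r \<delta>(1) by simp
      then obtain q where q: "r < of_rat q" "of_rat q < min 1 (r + \<delta>)" using of_rat_dense by blast
      have "of_real (of_rat q) * z - of_real r * z = of_real (of_rat q - r) * z" by (simp add: left_diff_distrib)
      then have "dist (of_real (of_rat q) * z) (of_real r * z) = \<bar>of_rat q - r\<bar>"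
        by (simp only: dist_norm norm_mult z(1) norm_of_real mult_1_right)
      also have "\<dots> < \<delta>" using q by auto
      finally have "dist (\<theta> (of_real (of_rat q) * z)) (\<theta> (of_real r * z)) < \<eta>" by (rule \<delta>(2))
      moreover have "cmod (\<theta> (of_real (of_rat q) * z) - l z) \<le> 1 / (real k + 1)" using q r by (intro m) auto
      ultimately show "cmod (\<theta> (of_real r * z) - l z) \<le> 1 / (real k + 1) + \<eta>"
        using dist_triangle[of "\<theta> (of_real r * z)" "l z" "\<theta> (of_real (of_rat q) * z)"]
        by (simp add: dist_norm norm_minus_commute)
    qed
    have "\<forall>\<^sub>F r in at_left 1. r \<in> {1 - 1 / (real m + 1)<..<1}"
      by (rule eventually_at_leftI[of "1 - 1 / (real m + 1)"]) auto
    then show "\<forall>\<^sub>F r in at_left 1. dist (\<theta> (of_real r * z)) (l z) < e"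
    proof eventually_elim
      case (elim r)
      then have "cmod (\<theta> (of_real r * z) - l z) \<le> 1 / (real k + 1)" by (intro near) auto
      then show ?case using k by (simp add: dist_norm)
    qed
  qed
  have in_E: "z \<in> E" if z: "((\<lambda>r. \<theta> (of_real r * z)) \<longlongrightarrow> L) (at_left 1)" for z L
  proof -
    have "(\<lambda>n. \<theta> (of_real (x n) * z)) \<longlonglongrightarrow> L" using filterlim_compose[OF z x_lim] .
    then have l: "l z = L" unfolding l_def by (rule limI)
    have "\<exists>m::nat. \<forall>q::rat. 1 - 1 / (real m + 1) < of_rat q \<and> of_rat q < (1::real) \<longrightarrow>
        cmod (\<theta> (of_real (of_rat q) * z) - l z) \<le> 1 / (real k + 1)" for k :: nat
    proof -
      have "\<forall>\<^sub>F r in at_left 1. dist (\<theta> (of_real r * z)) L < 1 / (real k + 1)" using z by (rule tendstoD) simp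
      then obtain b where b: "b < 1" "\<And>r. b < r \<Longrightarrow> r < 1 \<Longrightarrow> dist (\<theta> (of_real r * z)) L < 1 / (real k + 1)"
        using eventually_at_left[of 0 "1::real"] by (auto)
      obtain m where m: "1 / (real m + 1) < 1 - b" using nat_approx_posE[of "1 - b"] b(1) by (metis of_nat_Suc add.commute diff_gt_0_iff_gt)
      have "cmod (\<theta> (of_real (of_rat q) * z) - l z) \<le> 1 / (real k + 1)"
        if "1 - 1 / (real m + 1) < of_rat q" "of_rat q < (1::real)" for q
        using b(2)[of "of_rat q"] that m l by (simp add: dist_norm)
      then show ?thesis by blast
    qed
    then show ?thesis by (simp add: E_def)
  qed
  \<comment> \<open>the value of \<^const>\<open>Lim\<close> when there is no limit\<close>
  define \<kappa> where "\<kappa> = (THE l::complex. False)"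
  have "radial_limit \<theta> z = (if cmod z > 1 then 0 else if cmod z < 1 then \<theta> z else if z \<in> E then l z else \<kappa>)" for z
  proof (cases "cmod z" "1 :: real" rule: linorder_cases)
    case less
    then have "isCont \<theta> z" using cont by (simp add: continuous_on_eq_continuous_at)
    moreover have "((\<lambda>r. of_real r * z) \<longlongrightarrow> of_real 1 * z) (at_left (1::real))" by (intro tendsto_intros)
    ultimately have "((\<lambda>r. \<theta> (of_real r * z)) \<longlongrightarrow> \<theta> z) (at_left 1)" using isCont_tendsto_compose[of z \<theta>] by simp
    from radial_limit_eqI[OF this] show ?thesis using less by simp
  next
    case greater
    have "((\<lambda>r. r * cmod z) \<longlongrightarrow> 1 * cmod z) (at_left 1)" by (intro tendsto_intros)
    then have "\<forall>\<^sub>F r in at_left 1. r * cmod z > 1" using greater by (intro order_tendstoD(1)[where y="1 * cmod z"]) simp_all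
    moreover have "\<forall>\<^sub>F r in at_left (1::real). r \<in> {0<..<1}" by (rule eventually_at_leftI[of 0]) auto
    ultimately have "\<forall>\<^sub>F r in at_left 1. \<theta> (of_real r * z) = 0"
      by eventually_elim (intro out, simp add: norm_mult)
    then have "((\<lambda>r. \<theta> (of_real r * z)) \<longlongrightarrow> 0) (at_left 1)" by (rule tendsto_eventually)
    from radial_limit_eqI[OF this] show ?thesis using greater by simp
  next
    case equal
    show ?thesis
    proof (cases "z \<in> E")
      case True
      from radial_limit_eqI[OF lim_l[OF equal True]] show ?thesis using equal True by simp
    next
      case False
      then have "\<not> ((\<lambda>r. \<theta> (of_real r * z)) \<longlongrightarrow> L) (at_left 1)" for L using in_E by blast
      then show ?thesis using equal False by (simp add: radial_limit_def Topological_Spaces.Lim_def \<kappa>_def)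
    qed
  qed
  then have "radial_limit \<theta> = (\<lambda>z. if cmod z > 1 then 0 else if cmod z < 1 then \<theta> z else if z \<in> E then l z else \<kappa>)" by blast
  also have "\<dots> \<in> borel_measurable borel" by measurable
  finally show ?thesis .
qed

text \<open>The function \<open>\<theta>\<close> is the derivative of the primitive \<open>T\<close> of the boundary function. It is bounded by the Lipschitz estimate,
  with the constant 4 of the comparison of arcs and chords, and it has the radial limit \<open>u (cis t)\<close> wherever
  \<open>t \<mapsto> T (cis t)\<close> is differentiable with the expected derivative.\<close>

theorem fatou_boundary_extension:
  assumes u: "u \<in> borel_measurable borel" "\<And>z. cmod (u z) \<le> 1" "abs_l2 u \<in> H2"
  obtains \<theta> where "\<theta> \<in> Hinf" "radial_limit \<theta> \<in> borel_measurable borel" "AE z in circle. radial_limit \<theta> z = u z"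
proof -
  have [measurable]: "u \<in> borel_measurable borel" by fact
  obtain T where T: "disc_algebra T"
    "\<And>s t. 0 \<le> s \<Longrightarrow> s \<le> t \<Longrightarrow> t \<le> 2 * pi \<Longrightarrow> T (cis t) - T (cis s) = integral {s..t} (\<lambda>x. \<i> * u (cis x) * cis x)"
    using bounded_boundary_primitive[OF u] by blast
  have Th: "T holomorphic_on ball 0 1" using T(1) by (simp add: disc_algebra_def)
  define \<theta> where "\<theta> z = (if cmod z < 1 then deriv T z else 0)" for z
  have hol: "\<theta> holomorphic_on ball 0 1"
    by (rule holomorphic_transform[OF holomorphic_deriv[OF Th]]) (auto simp: \<theta>_def)
  have bound: "cmod (\<theta> a) \<le> 16" if a: "cmod a < 1" "a \<noteq> 0" for a
  proof -
    define w0 where "w0 = a / of_real (cmod a)"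
    have w0: "cmod w0 = 1" "of_real (cmod a) * w0 = a" using a by (simp_all add: w0_def norm_divide)
    \<comment> \<open>subtracting a constant does not change the derivative and makes \<open>R\<close> vanish at the nearest boundary point\<close>
    define R where "R z = T z - T w0" for z
    have R: "disc_algebra R"
      using T(1) unfolding disc_algebra_def R_def by (auto intro!: continuous_intros holomorphic_intros)
    have "T field_differentiable at a" using Th a holomorphic_on_imp_differentiable_at[of T "ball 0 1"] by auto
    then have "(T has_field_derivative deriv T a) (at a)" by (simp add: DERIV_deriv_iff_field_differentiable)
    then have "(R has_field_derivative deriv T a) (at a)" unfolding R_def by (auto intro!: derivative_eq_intros)
    then have "deriv R a = \<theta> a" using a by (simp add: DERIV_imp_deriv \<theta>_def)
    moreover have "cmod (deriv R (of_real (cmod a) * w0)) \<le> 4 * 4 + 16 * 0 * (1 - (cmod a)\<^sup>2)"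
      by (rule deriv_bound_from_boundary_modulus[OF R w0(1)])
        (use a primitive_lipschitz_on_circle[OF u(1,2) T(2) _ w0(1)] in \<open>auto simp: R_def\<close>)
    ultimately show ?thesis by (simp add: w0)
  qed
  have "bounded (\<theta> ` ball 0 1)"
    unfolding bounded_iff
  proof (intro exI ballI)
    fix y assume "y \<in> \<theta> ` ball 0 1"
    then obtain a where "y = \<theta> a" "cmod a < 1" by auto
    then show "norm y \<le> max 16 (cmod (\<theta> 0))" using bound[of a] by (cases "a = 0") auto
  qed
  with hol have Hinf: "\<theta> \<in> Hinf" by (simp add: Hinf_def)
  have meas[measurable]: "radial_limit \<theta> \<in> borel_measurable borel"
    by (rule radial_limit_measurable[OF hol]) (simp add: \<theta>_def)
  have f: "(\<lambda>x. \<i> * u (cis x) * cis x) \<in> borel_measurable borel" "norm (\<i> * u (cis x) * cis x) \<le> 1" for x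
    using u(2) by (simp_all add: norm_mult)
  obtain N where N: "negligible N" "\<And>t e. t \<notin> N \<Longrightarrow> e > 0 \<Longrightarrow> \<exists>d>0. \<forall>s. \<bar>s - t\<bar> < d \<longrightarrow>
       cmod (integral {min s t..max s t} (\<lambda>x. \<i> * u (cis x) * cis x) - of_real \<bar>s - t\<bar> * (\<i> * u (cis t) * cis t)) \<le> e * \<bar>s - t\<bar>"
    using bounded_measurable_integral_differentiable[OF f] by blast
  have good: "radial_limit \<theta> (cis t) = u (cis t)" if t: "0 < t" "t < 2 * pi" "t \<notin> N" for t
  proof (rule radial_limit_eqI)
    have "((\<lambda>r. deriv T (of_real r * cis t)) \<longlongrightarrow> u (cis t)) (at_left 1)"
      by (rule radial_limit_of_derivative[OF T(1)])
        (use primitive_differentiable_at_boundary[OF u(2) T(2) t(1,2) N(2)[OF t(3)]] in auto)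
    moreover have "\<forall>\<^sub>F r in at_left (1::real). deriv T (of_real r * cis t) = \<theta> (of_real r * cis t)"
      by (rule eventually_at_leftI[of 0]) (auto simp: \<theta>_def norm_mult)
    ultimately show "((\<lambda>r. \<theta> (of_real r * cis t)) \<longlongrightarrow> u (cis t)) (at_left 1)" by (rule Lim_transform_eventually)
  qed
  have "AE t in lborel. t \<notin> N \<union> {0, 2 * pi}"
  proof -
    have "negligible (N \<union> {0, 2 * pi})" using N(1) by simp
    then have "N \<union> {0, 2 * pi} \<in> null_sets lebesgue" by (simp add: negligible_iff_null_sets)
    then have "AE t in lebesgue. t \<notin> N \<union> {0, 2 * pi}" by (rule AE_not_in)
    then show ?thesis by (simp add: AE_completion_iff)
  qed
  then have "AE t in lborel. t \<in> {0..2 * pi} \<longrightarrow> radial_limit \<theta> (cis t) = u (cis t)"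
    by eventually_elim (use good in auto)
  then have "AE t in uniform_measure lborel {0..2 * pi}. radial_limit \<theta> (cis t) = u (cis t)"
    by (intro AE_uniform_measureI) simp_all
  then have "AE z in circle. radial_limit \<theta> z = u z"
    unfolding circle_def by (subst AE_distr_iff) simp_all
  with Hinf meas show thesis using that by blast
qed


section \<open>Kernels of Hankel operators\<close>

text \<open>The relation \<open>S\<^sup>* H = H S\<close> makes the kernel invariant under the shift, so Beurling's theorem applies. The unimodular function
  that it provides is changed on a null set, so that it is bounded by 1 everywhere.\<close>

lemma hankel_kernel_inner:
  assumes \<psi>: "\<psi> \<in> Linf" and ker: "ker_H2 (hankel \<psi>) \<noteq> {0}"
  obtains \<theta> where "inner_function \<theta>" "radial_limit \<theta> \<in> Linf" "\<And>f. f \<in> H2 \<Longrightarrow> mult_op (radial_limit \<theta>) f \<in> H2"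
    "to_l2 ` ker_H2 (hankel \<psi>) = mult_op (radial_limit \<theta>) ` H2"
proof -
  note Hs = bounded_clinear_H2D[OF bounded_clinear_hankel[OF \<psi>]]
  define M where "M = to_l2 ` ker_H2 (hankel \<psi>)"
  have M_eq: "M = H2 \<inter> {f. hankel \<psi> (proj_H2 f) = 0}"
    by (auto simp: M_def ker_H2_def image_iff to_l2_proj_H2 intro!: exI[of _ "proj_H2 _"])
  have "csubspace {f. hankel \<psi> (proj_H2 f) = 0}"
    using bounded_linear_proj_H2 by (auto simp: csubspace_def proj_H2_plus proj_H2_scaleC Hs linear_simps
        to_l2_eq_iff[symmetric] to_l2_simps)
  then have cs: "csubspace M" unfolding M_eq by (intro csubspace_Int csubspace_H2)
  have "closed {f. hankel \<psi> (proj_H2 f) = 0}"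
    by (intro closed_Collect_eq linear_continuous_on bounded_linear_compose[OF Hs(5)] bounded_linear_proj_H2 continuous_on_const)
  then have cl: "closed M" unfolding M_eq by (intro closed_Int closed_H2)
  have "0 \<in> ker_H2 (hankel \<psi>)" by (simp add: ker_H2_def Hs)
  then obtain f where f: "f \<in> ker_H2 (hankel \<psi>)" "f \<noteq> 0" using ker by blast
  then have "to_l2 f \<in> M" "to_l2 f \<noteq> 0" by (auto simp: M_def zero_h2.rep_eq[symmetric] to_l2_eq_iff)
  then have ne: "M \<noteq> {0}" by blast
  have inv: "mult_op (\<lambda>z. z) g \<in> M" if "g \<in> M" for g
  proof -
    obtain h where h: "g = to_l2 h" "hankel \<psi> h = 0" using \<open>g \<in> M\<close> by (auto simp: M_def ker_H2_def)
    have "hankel \<psi> (T_z h) = toeplitz cnj (hankel \<psi> h)" by (rule hankel_intertwines[OF \<psi>, symmetric])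
    then have "hankel \<psi> (T_z h) = 0" by (simp add: h bounded_clinear_H2D(4)[OF bounded_clinear_adjoint_T_z])
    then show ?thesis by (auto simp: M_def ker_H2_def h to_l2_T_z[symmetric])
  qed
  obtain u where u: "u \<in> Linf" "AE z in circle. cmod (u z) = 1" "mult_op u (zpow 0) \<in> H2" "M = mult_op u ` H2"
    using beurling[OF cs cl _ ne inv] by (auto simp: M_eq)
  have [measurable]: "u \<in> borel_measurable borel" using u(1) by (auto simp: Linf_def)
  define v where "v z = (if cmod (u z) \<le> 1 then u z else 0)" for z
  have v1: "v \<in> borel_measurable borel" unfolding v_def by measurable
  have v2: "cmod (v z) \<le> 1" for z by (simp add: v_def)
  note v = v1 v2
  have vL: "v \<in> Linf" using v by (intro LinfI[where C=1])
  have vu: "AE z in circle. v z = u z" using u(2) by eventually_elim (simp add: v_def)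
  have "abs_l2 v = mult_op u (zpow 0)"
    by (rule l2_eqI, use rep_abs_l2[OF Linf_sq_integrable[OF vL]] rep_mult[OF u(1), of "zpow 0"] rep_zpow[of 0] vu
        in \<open>eventually_elim, simp\<close>)
  then obtain \<theta> where \<theta>: "\<theta> \<in> Hinf" "radial_limit \<theta> \<in> borel_measurable borel" "AE z in circle. radial_limit \<theta> z = v z"
    using fatou_boundary_extension[OF v] u(3) by auto
  have \<theta>u: "AE z in circle. radial_limit \<theta> z = u z" using \<theta>(3) vu by eventually_elim simp
  have \<theta>1: "AE z in circle. cmod (radial_limit \<theta> z) = 1" using \<theta>u u(2) by eventually_elim simp
  then have "AE z in circle. cmod (radial_limit \<theta> z) \<le> 1" by eventually_elim simp
  then have \<theta>L: "radial_limit \<theta> \<in> Linf" using \<theta>(2) by (auto simp: Linf_def)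
  have eq: "mult_op (radial_limit \<theta>) f = mult_op u f" for f by (rule mult_op_cong[OF \<theta>L u(1) \<theta>u])
  have "mult_op (radial_limit \<theta>) f \<in> H2" if "f \<in> H2" for f
    unfolding eq using that u(3) by (intro bounded_analytic_mult_H2 u(1)) (auto simp: H2_iff)
  moreover have "to_l2 ` ker_H2 (hankel \<psi>) = mult_op (radial_limit \<theta>) ` H2"
    using u(4) by (simp add: M_def eq[abs_def])
  moreover have "inner_function \<theta>" using \<theta>(1) \<theta>1 by (simp add: inner_function_def)
  ultimately show thesis using that \<theta>L by blast
qed


section \<open>Operators whose shift difference is a non-injective Hankel operator\<close>

lemma toeplitz_mult_analytic:
  assumes "\<phi> \<in> Linf" "\<tau> \<in> Linf" "\<And>f. f \<in> H2 \<Longrightarrow> mult_op \<tau> f \<in> H2"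
  shows "toeplitz \<phi> (toeplitz \<tau> f) = toeplitz (\<lambda>z. \<phi> z * \<tau> z) f"
  by (simp add: toeplitz_def[of \<phi>] toeplitz_def[of "\<lambda>z. \<phi> z * \<tau> z"] to_l2_toeplitz_analytic assms mult_op_mult)

lemma toeplitz_cong:
  assumes "\<phi> \<in> Linf" "\<psi> \<in> Linf" "AE z in circle. \<phi> z = \<psi> z"
  shows "toeplitz \<phi> = toeplitz \<psi>"
  by (rule ext) (simp add: toeplitz_def mult_op_cong[OF assms])

text \<open>The function \<open>\<tau>\<close> is the boundary function of an inner function that generates the kernel of the shift difference.
  The operator \<open>C = A - T\<^sub>\<phi>\<close> vanishes on \<open>\<tau> H\<^sup>2\<close>; this is what turns the weak relation \<open>S\<^sup>* C S - C = H\<close> into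
  the Hankel relation, by way of the Toeplitz operator \<open>D = S\<^sup>* C - C S\<close>.\<close>

lemma toeplitz_plus_hankel_decomposition:
  assumes A: "bounded_clinear_H2 A" and \<psi>1: "\<psi>1 \<in> Linf"
    and eq: "\<And>f. toeplitz cnj (A (T_z f)) - A f = hankel \<psi>1 f"
    and \<tau>: "\<tau> \<in> Linf" "AE z in circle. cmod (\<tau> z) = 1" "\<And>f. f \<in> H2 \<Longrightarrow> mult_op \<tau> f \<in> H2"
    and ker: "\<And>f. hankel \<psi>1 (toeplitz \<tau> f) = 0"
  obtains \<phi>2 \<psi> where "\<phi>2 \<in> Linf" "A \<circ> toeplitz \<tau> = toeplitz \<phi>2" "\<psi> \<in> Linf"
    "A = (\<lambda>f. toeplitz (\<lambda>z. cnj (\<tau> z) * \<phi>2 z) f + hankel \<psi> f)" "\<And>f. hankel \<psi> (toeplitz \<tau> f) = 0"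
proof -
  note S = bounded_clinear_H2D[OF bounded_clinear_adjoint_T_z]
  have T\<tau>: "toeplitz \<alpha> (toeplitz \<tau> f) = toeplitz (\<lambda>z. \<alpha> z * \<tau> z) f" if "\<alpha> \<in> Linf" for \<alpha> f
    by (intro toeplitz_mult_analytic that \<tau>)
  have comm: "T_z (toeplitz \<tau> f) = toeplitz \<tau> (T_z f)" for f
    unfolding T\<tau>[OF Linf_id] using toeplitz_mult_analytic[OF \<tau>(1) Linf_id, of f] mult_id_H2
    by (simp add: mult.commute)
  have "is_toeplitz (\<lambda>f. A (toeplitz \<tau> f))"
  proof (rule brown_halmos)
    show "bounded_clinear_H2 (\<lambda>f. A (toeplitz \<tau> f))"
      by (intro bounded_clinear_H2_comp[OF A] bounded_clinear_toeplitz \<tau>)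
    show "toeplitz cnj (A (toeplitz \<tau> (T_z f))) = A (toeplitz \<tau> f)" for f
      using eq[of "toeplitz \<tau> f"] ker[of f] by (simp add: comm)
  qed
  then obtain \<phi>2 where \<phi>2: "\<phi>2 \<in> Linf" "A \<circ> toeplitz \<tau> = toeplitz \<phi>2" by (auto simp: is_toeplitz_def o_def)
  define \<phi> where "\<phi> z = cnj (\<tau> z) * \<phi>2 z" for z
  have \<phi>: "\<phi> \<in> Linf" unfolding \<phi>_def by (intro Linf_mult Linf_cnj \<tau> \<phi>2)
  have "AE z in circle. \<phi> z * \<tau> z = \<phi>2 z" using \<tau>(2)
  proof eventually_elim
    case (elim z)
    then have "\<tau> z * cnj (\<tau> z) = 1" by (simp add: complex_norm_square[symmetric])
    then have "\<phi> z * \<tau> z = \<phi>2 z * 1" unfolding \<phi>_def by (metis mult.assoc mult.commute)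
    then show ?case by simp
  qed
  then have \<phi>\<tau>: "toeplitz \<phi> (toeplitz \<tau> f) = toeplitz \<phi>2 f" for f
    unfolding T\<tau>[OF \<phi>] by (simp add: toeplitz_cong[OF Linf_mult[OF \<phi> \<tau>(1)] \<phi>2(1)])
  define C where "C f = A f - toeplitz \<phi> f" for f
  have C: "bounded_clinear_H2 C" unfolding C_def by (intro bounded_clinear_H2_diff A bounded_clinear_toeplitz \<phi>)
  have C\<tau>: "C (toeplitz \<tau> f) = 0" for f using fun_cong[OF \<phi>2(2), of f] by (simp add: C_def \<phi>\<tau>)
  \<comment> \<open>the Toeplitz part does not contribute to the shift difference\<close>
  have C_eq: "toeplitz cnj (C (T_z f)) = C f + hankel \<psi>1 f" for f
    using eq[of f] by (simp add: C_def S toeplitz_shift_invariant[OF \<phi>] algebra_simps)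
  define D where "D f = toeplitz cnj (C f) - C (T_z f)" for f
  have "is_toeplitz D"
  proof (rule brown_halmos)
    show "bounded_clinear_H2 D" unfolding D_def
      by (intro bounded_clinear_H2_diff bounded_clinear_H2_comp[OF bounded_clinear_adjoint_T_z C]
          bounded_clinear_H2_comp[OF C bounded_clinear_T_z])
    show "toeplitz cnj (D (T_z f)) = D f" for f
      by (simp add: D_def S C_eq hankel_intertwines[OF \<psi>1])
  qed
  then obtain \<delta> where \<delta>: "\<delta> \<in> Linf" "D = toeplitz \<delta>" by (auto simp: is_toeplitz_def)
  have "toeplitz (\<lambda>z. \<delta> z * \<tau> z) f = 0" for f
  proof -
    have "toeplitz (\<lambda>z. \<delta> z * \<tau> z) f = D (toeplitz \<tau> f)"
      unfolding \<delta>(2) by (rule T\<tau>[OF \<delta>(1), symmetric])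
    also have "\<dots> = 0" by (simp add: D_def comm C\<tau> S)
    finally show ?thesis .
  qed
  then have "AE z in circle. \<delta> z * \<tau> z = 0" by (intro toeplitz_symbol_unique Linf_mult \<delta> \<tau>)
  then have "AE z in circle. \<delta> z = 0" using \<tau>(2) by eventually_elim auto
  then have "toeplitz \<delta> = toeplitz (\<lambda>z. 0 * 1)"
    by (intro toeplitz_cong \<delta>) (simp_all add: LinfI[where C=0])
  moreover have "toeplitz (\<lambda>z. 0 * 1) f = 0" for f
    using mult_op_diff[OF Linf_1 Linf_1, of "to_l2 f"] bounded_linear_proj_H2 by (simp add: toeplitz_def linear_simps)
  ultimately have "D f = 0" for f by (simp add: \<delta>(2))
  then have "toeplitz cnj (C f) = C (T_z f)" for f by (simp add: D_def)
  then have "is_hankel C" by (intro nehari C)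
  then obtain \<psi> where \<psi>: "\<psi> \<in> Linf" "C = hankel \<psi>" by (auto simp: is_hankel_def)
  have "A = (\<lambda>f. toeplitz (\<lambda>z. cnj (\<tau> z) * \<phi>2 z) f + hankel \<psi> f)"
    using fun_cong[OF \<psi>(2)] by (simp add: C_def \<phi>_def[abs_def] fun_eq_iff diff_eq_eq add.commute)
  moreover have "hankel \<psi> (toeplitz \<tau> f) = 0" for f using C\<tau> by (simp add: \<psi>)
  ultimately show thesis using that \<phi>2 \<psi>(1) by blast
qed

text \<open>The Toeplitz part cancels, and \<open>S\<^sup>* S\<^sup>* H\<^sub>\<psi> - H\<^sub>\<psi>\<close> is the Hankel operator with symbol \<open>(cnj z)\<^sup>2 \<psi> - \<psi>\<close>,
  which vanishes on the kernel of \<open>H\<^sub>\<psi>\<close>.\<close>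

lemma shift_difference_toeplitz_plus_hankel:
  assumes \<phi>: "\<phi> \<in> Linf" and \<psi>: "\<psi> \<in> Linf" and ker: "ker_H2 (hankel \<psi>) \<noteq> {0}"
    and A: "A = (\<lambda>f. toeplitz \<phi> f + hankel \<psi> f)"
  shows "is_noninjective_hankel (\<lambda>f. toeplitz cnj (A (T_z f)) - A f)"
proof -
  note S = bounded_clinear_H2D[OF bounded_clinear_adjoint_T_z]
  define \<eta> where "\<eta> z = cnj z * (cnj z * \<psi> z) - \<psi> z" for z
  have c\<psi>: "(\<lambda>z. cnj z * \<psi> z) \<in> Linf" "(\<lambda>z. cnj z * (cnj z * \<psi> z)) \<in> Linf"
    using \<psi> by (intro Linf_mult Linf_cnj_id; assumption)+
  have eq: "toeplitz cnj (A (T_z f)) - A f = toeplitz cnj (toeplitz cnj (hankel \<psi> f)) - hankel \<psi> f" for f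
    by (simp add: A S toeplitz_shift_invariant[OF \<phi>] hankel_intertwines[OF \<psi>])
  also have "toeplitz cnj (toeplitz cnj (hankel \<psi> f)) - hankel \<psi> f = hankel \<eta> f" for f
    unfolding \<eta>_def hankel_diff[OF c\<psi>(2) \<psi>] hankel_cnj_mult[OF c\<psi>(1)] hankel_cnj_mult[OF \<psi>] ..
  finally have "(\<lambda>f. toeplitz cnj (A (T_z f)) - A f) = hankel \<eta>" by (rule ext)
  moreover have "\<eta> \<in> Linf" unfolding \<eta>_def by (intro Linf_diff c\<psi> \<psi>)
  moreover have "\<exists>f. f \<noteq> 0 \<and> toeplitz cnj (A (T_z f)) - A f = 0"
  proof -
    have "0 \<in> ker_H2 (hankel \<psi>)" by (simp add: ker_H2_def bounded_clinear_H2D[OF bounded_clinear_hankel[OF \<psi>]])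
    then obtain f where "f \<noteq> 0" "hankel \<psi> f = 0" using ker by (auto simp: ker_H2_def)
    then show ?thesis by (intro exI[of _ f]) (simp add: eq S)
  qed
  ultimately show ?thesis unfolding is_noninjective_hankel_def is_hankel_def ker_H2_def by blast
qed

theorem theorem1p2:
  fixes A :: "h2 \<Rightarrow> h2"
  assumes "bounded_clinear_H2 A"
  shows "((\<exists>B C. is_toeplitz B \<and> is_noninjective_hankel C \<and> A = (\<lambda>f. B f + C f)) \<longleftrightarrow>
          is_noninjective_hankel (\<lambda>f. adjoint_H2 T_z (A (T_z f)) - A f)) \<and>
         (\<forall>\<psi>\<^sub>1\<in>Linf.
            (\<lambda>f. adjoint_H2 T_z (A (T_z f)) - A f) = hankel \<psi>\<^sub>1 \<and> ker_H2 (hankel \<psi>\<^sub>1) \<noteq> {0} \<longrightarrow>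
            (\<exists>\<theta> \<phi>\<^sub>2. inner_function \<theta> \<and> \<phi>\<^sub>2 \<in> Linf \<and>
               to_l2 ` ker_H2 (hankel \<psi>\<^sub>1) = mult_op (radial_limit \<theta>) ` H2 \<and>
               A \<circ> toeplitz (radial_limit \<theta>) = toeplitz \<phi>\<^sub>2 \<and>
               (\<exists>\<psi>\<in>Linf. A = (\<lambda>f. toeplitz (\<lambda>z. cnj (radial_limit \<theta> z) * \<phi>\<^sub>2 z) f + hankel \<psi> f))))"
proof -
  let ?\<Delta> = "\<lambda>f. toeplitz cnj (A (T_z f)) - A f"
  have main: "\<exists>\<theta> \<phi>\<^sub>2 \<psi>. inner_function \<theta> \<and> radial_limit \<theta> \<in> Linf \<and> \<phi>\<^sub>2 \<in> Linf \<and> \<psi> \<in> Linf \<and>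
      to_l2 ` ker_H2 (hankel \<psi>\<^sub>1) = mult_op (radial_limit \<theta>) ` H2 \<and>
      A \<circ> toeplitz (radial_limit \<theta>) = toeplitz \<phi>\<^sub>2 \<and>
      A = (\<lambda>f. toeplitz (\<lambda>z. cnj (radial_limit \<theta> z) * \<phi>\<^sub>2 z) f + hankel \<psi> f) \<and> ker_H2 (hankel \<psi>) \<noteq> {0}"
    if \<psi>1: "\<psi>\<^sub>1 \<in> Linf" and eq: "?\<Delta> = hankel \<psi>\<^sub>1" and ker: "ker_H2 (hankel \<psi>\<^sub>1) \<noteq> {0}" for \<psi>\<^sub>1
  proof -
    obtain \<theta> where \<theta>: "inner_function \<theta>" "radial_limit \<theta> \<in> Linf"
      "\<And>f. f \<in> H2 \<Longrightarrow> mult_op (radial_limit \<theta>) f \<in> H2"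
      "to_l2 ` ker_H2 (hankel \<psi>\<^sub>1) = mult_op (radial_limit \<theta>) ` H2"
      using hankel_kernel_inner[OF \<psi>1 ker] by blast
    have uni: "AE z in circle. cmod (radial_limit \<theta> z) = 1" using \<theta>(1) by (simp add: inner_function_def)
    have kill: "hankel \<psi>\<^sub>1 (toeplitz (radial_limit \<theta>) f) = 0" for f
    proof -
      have "to_l2 (toeplitz (radial_limit \<theta>) f) \<in> to_l2 ` ker_H2 (hankel \<psi>\<^sub>1)"
        unfolding \<theta>(4) by (simp add: to_l2_toeplitz_analytic \<theta>(3))
      then show ?thesis by (auto simp: to_l2_eq_iff ker_H2_def)
    qed
    obtain \<phi>2 \<psi> where d: "\<phi>2 \<in> Linf" "A \<circ> toeplitz (radial_limit \<theta>) = toeplitz \<phi>2" "\<psi> \<in> Linf"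
      "A = (\<lambda>f. toeplitz (\<lambda>z. cnj (radial_limit \<theta> z) * \<phi>2 z) f + hankel \<psi> f)"
      "\<And>f. hankel \<psi> (toeplitz (radial_limit \<theta>) f) = 0"
      using toeplitz_plus_hankel_decomposition[OF assms \<psi>1 fun_cong[OF eq] \<theta>(2) uni \<theta>(3) kill] by blast
    \<comment> \<open>\<open>\<theta>\<close> itself is a nonzero element of the kernel of \<open>H\<^sub>\<psi>\<close>\<close>
    have "norm (toeplitz (radial_limit \<theta>) (hpow 0)) = 1"
      by (simp add: norm_to_l2[symmetric] to_l2_toeplitz_analytic \<theta>(3) norm_mult_unimodular[OF \<theta>(2) uni] zpow_in_H2)
    then have "toeplitz (radial_limit \<theta>) (hpow 0) \<noteq> 0" by auto
    then have "ker_H2 (hankel \<psi>) \<noteq> {0}" using d(5)[of "hpow 0"] by (auto simp: ker_H2_def)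
    with \<theta> d show ?thesis by blast
  qed
  have "is_noninjective_hankel ?\<Delta>"
    if BC: "is_toeplitz B" "is_noninjective_hankel C" "A = (\<lambda>f. B f + C f)" for B C
  proof -
    obtain \<phi> \<psi> where "\<phi> \<in> Linf" "B = toeplitz \<phi>" "\<psi> \<in> Linf" "C = hankel \<psi>" "ker_H2 (hankel \<psi>) \<noteq> {0}"
      using BC(1,2) by (auto simp: is_toeplitz_def is_noninjective_hankel_def is_hankel_def)
    then show ?thesis using BC(3) by (intro shift_difference_toeplitz_plus_hankel) auto
  qed
  moreover have "\<exists>B C. is_toeplitz B \<and> is_noninjective_hankel C \<and> A = (\<lambda>f. B f + C f)"
    if \<Delta>: "is_noninjective_hankel ?\<Delta>"
  proof -
    obtain \<psi>\<^sub>1 where "\<psi>\<^sub>1 \<in> Linf" "?\<Delta> = hankel \<psi>\<^sub>1" "ker_H2 (hankel \<psi>\<^sub>1) \<noteq> {0}"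
      using \<Delta> unfolding is_noninjective_hankel_def is_hankel_def by metis
    from main[OF this] obtain \<theta> \<phi>\<^sub>2 \<psi> where d: "radial_limit \<theta> \<in> Linf" "\<phi>\<^sub>2 \<in> Linf" "\<psi> \<in> Linf"
      "A = (\<lambda>f. toeplitz (\<lambda>z. cnj (radial_limit \<theta> z) * \<phi>\<^sub>2 z) f + hankel \<psi> f)" "ker_H2 (hankel \<psi>) \<noteq> {0}" by blast
    have "(\<lambda>z. cnj (radial_limit \<theta> z) * \<phi>\<^sub>2 z) \<in> Linf" by (intro Linf_mult Linf_cnj d)
    then have "is_toeplitz (toeplitz (\<lambda>z. cnj (radial_limit \<theta> z) * \<phi>\<^sub>2 z))" by (auto simp: is_toeplitz_def)
    moreover have "is_noninjective_hankel (hankel \<psi>)" using d by (auto simp: is_noninjective_hankel_def is_hankel_def)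
    ultimately show ?thesis using d(4) by blast
  qed
  ultimately show ?thesis unfolding adjoint_T_z using main by blast
qed

end
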